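(* For every integer $n\ge 1$ there exists a constant $c_n>0$, depending only on the dimension $n$, such that the following holds. Let $w\in A_\infty^\ast$ be a multiparameter (strong) Muckenhoupt weight on $\mathbb{R}^n$, with constant $[w]_{A_\infty^\ast}$, and for $\alpha\in(0,1)$ let $$\mathsf{C}_{\mathsf{S},w}(\alpha) := \sup_{\substack{E\subset\mathbb{R}^n\text{ measurable}\\ 0<w(E)<\infty}} \frac{1}{w(E)}\, w\big(\{x\in\mathbb{R}^n : \mathsf{M}_{\mathsf{S}}\chi_E(x)>\alpha\}\big),$$ where $\mathsf{M}_{\mathsf{S}}$ is the strong maximal operator on $\mathbb{R}^n$. Then $$\mathsf{C}_{\mathsf{S},w}\in C^{(c_n[w]_{A_\infty^\ast})^{-1}}(0,1).$$
   Context: The strong maximal operator on $\mathbb{R}^n$ is $$\mathsf{M}_{\mathsf{S}}f(x):=\sup_{R\ni x}\frac{1}{|R|}\int_R|f|,$$ the supremum being over all rectangular parallelepipeds $R\subset\mathbb{R}^n$ with sides parallel to the coordinate axes that contain $x$; $|\cdot|$ is Lebesgue measure and $\chi_E$ is the indicator function of $E$. A weight $w$ is a non-negative, locally integrable function on $\mathbb{R}^n$, not almost everywhere equal to $0$, and $w(E):=\int_E w$ for measurable $E$. One-dimensional Fujii–Wilson constant: for a non-negative locally integrable function $\nu$ on $\mathbb{R}$, $$[\nu]_{A_\infty}:=\sup_I\frac{1}{\nu(I)}\int_I\mathsf{M}_1(\nu\chi_I),$$ where the supremum is over all intervals $I\subset\mathbb{R}$ (bounded, with $\nu(I)>0$),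 $\nu(I)=\int_I\nu$, and $\mathsf{M}_1$ is the uncentered Hardy–Littlewood maximal operator on $\mathbb{R}$, $\mathsf{M}_1 f(t)=\sup_{J\ni t}\frac{1}{|J|}\int_J|f|$ (supremum over bounded intervals $J$ containing $t$). Multiparameter Muckenhoupt weights: for $x=(x_1,\ldots,x_n)\in\mathbb{R}^n$ and $1\le j\le n$ let $\bar{x}^j:=(x_1,\ldots,x_{j-1},x_{j+1},\ldots,x_n)\in\mathbb{R}^{n-1}$, and define the one-dimensional weight $$w_{\bar{x}^j}(t):=w(x_1,\ldots,x_{j-1},t,x_{j+1},\ldots,x_n),\qquad t\in\mathbb{R}.$$ Set $$[w]_{A_\infty^\ast}:=\sup_{1\le j\le n}\ \operatorname*{ess\,sup}_{\bar{x}^j\in\mathbb{R}^{n-1}}\,[w_{\bar{x}^j}]_{A_\infty}.$$ (For $n=1$ this is just $[w]_{A_\infty}$.) The weight $w$ belongs to $A_\infty^\ast$ if and only if $[w]_{A_\infty^\ast}<+\infty$. Local Hölder classes: for an interval $I\subset\mathbb{R}$ and an exponent $p>0$, a real-valued function $f$ on $I$ lies in $C^p(I)$ if for every compact set $K\subset I$ there is a constant $C_K$ (which may also depend on $f$) such that $|f(x)-f(y)|\le C_K|x-y|^p$ for all $x,y\in K$. *)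

theory Defs
  imports "HOL-Analysis.Analysis" "HOL-Probability.Essential_Supremum"
begin

text \<open>
  A set satisfying \<^const>\<open>is_interval\<close> is a product of intervals, so these are the
  bounded nondegenerate parallelepipeds with sides parallel to the coordinate axes, with any choice
  of which faces are included. On \<^typ>\<open>real\<close> they are the bounded nondegenerate intervals.
\<close>

definition parallelepipeds :: "'a::euclidean_space set set" where
  "parallelepipeds = {R. is_interval R \<and> bounded R \<and> 0 < emeasure lebesgue R}"

text \<open>On \<^typ>\<open>real\<close> this is the uncentered Hardy--Littlewood maximal operator.\<close>

definition strong_maximal :: "('a::euclidean_space \<Rightarrow> real) \<Rightarrow> 'a \<Rightarrow> ennreal" where
  "strong_maximal f x =
    (SUP R\<in>{R \<in> parallelepipeds. x \<in> R}.
      (\<integral>\<^sup>+y\<in>R. ennreal \<bar>f y\<bar> \<partial>lebesgue) / emeasure lebesgue R)"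

definition weight :: "('a::euclidean_space \<Rightarrow> real) \<Rightarrow> bool" where
  "weight w \<longleftrightarrow> (\<forall>x. 0 \<le> w x) \<and> (\<forall>K. compact K \<longrightarrow> w absolutely_integrable_on K) \<and>
    \<not> (AE x in lebesgue. w x = 0)"

definition weight_measure :: "('a::euclidean_space \<Rightarrow> real) \<Rightarrow> 'a set \<Rightarrow> ennreal" where
  "weight_measure w A = (\<integral>\<^sup>+x\<in>A. ennreal (w x) \<partial>lebesgue)"

definition fujii_wilson :: "(real \<Rightarrow> real) \<Rightarrow> ennreal" where
  "fujii_wilson \<nu> =
    (SUP I\<in>{I. is_interval I \<and> bounded I \<and> 0 < weight_measure \<nu> I}.
      (\<integral>\<^sup>+t\<in>I. strong_maximal (\<lambda>s. \<nu> s * indicator I s) t \<partial>lebesgue) / weight_measure \<nu> I)"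

text \<open>
  Unlike \<^const>\<open>esssup\<close>, which is \<^term>\<open>top\<close> on functions that are not measurable, this can be
  applied before the measurability of the function is known.
\<close>

definition ess_sup :: "'a measure \<Rightarrow> ('a \<Rightarrow> ennreal) \<Rightarrow> ennreal" where
  "ess_sup M f = Inf {c. AE x in M. f x \<le> c}"

lemma ess_sup_eq_esssup: "f \<in> borel_measurable M \<Longrightarrow> ess_sup M f = esssup M f"
  by (simp add: ess_sup_def esssup_eq_AE)

text \<open>
  A point with the \<^term>\<open>j\<close>-th coordinate deleted is a function \<^term>\<open>y\<close> on the index set
  \<^term>\<open>UNIV - {j}\<close>; \<^term>\<open>y j\<close> is never used.
\<close>

definition slice :: "(real ^ 'n \<Rightarrow> real) \<Rightarrow> 'n \<Rightarrow> ('n \<Rightarrow> real) \<Rightarrow> real \<Rightarrow> real" where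
  "slice w j y t = w (\<chi> i. if i = j then t else y i)"

text \<open>
  The product measure is Lebesgue measure on the space of points with \<^term>\<open>j\<close>-th coordinate
  deleted. In dimension one it is the unit point mass on a one-point space, and \<^term>\<open>slice w j y\<close>
  is \<^term>\<open>w\<close> regarded as a function on \<^typ>\<open>real\<close>.
\<close>

definition A_infinity_star_const :: "(real ^ 'n \<Rightarrow> real) \<Rightarrow> ennreal" where
  "A_infinity_star_const w =
    (SUP j. ess_sup (PiM (UNIV - {j}) (\<lambda>_. lborel)) (\<lambda>y. fujii_wilson (slice w j y)))"

definition A_infinity_star :: "(real ^ 'n \<Rightarrow> real) set" where
  "A_infinity_star = {w. weight w \<and> A_infinity_star_const w < \<infinity>}"

definition sharp_tauberian :: "('a::euclidean_space \<Rightarrow> real) \<Rightarrow> real \<Rightarrow> ennreal" where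
  "sharp_tauberian w \<alpha> =
    (SUP E\<in>{E \<in> sets lebesgue. 0 < weight_measure w E \<and> weight_measure w E < \<infinity>}.
      weight_measure w {x. ennreal \<alpha> < strong_maximal (indicator E) x} / weight_measure w E)"

definition local_hoelder :: "real \<Rightarrow> real set \<Rightarrow> (real \<Rightarrow> real) \<Rightarrow> bool" where
  "local_hoelder p I f \<longleftrightarrow>
    (\<forall>K\<subseteq>I. compact K \<longrightarrow> (\<exists>C. \<forall>x\<in>K. \<forall>y\<in>K. \<bar>f x - f y\<bar> \<le> C * \<bar>x - y\<bar> powr p))"

end

theory Submission
  imports Defs "HOL-Probability.Distribution_Functions"
begin

text \<open>
  For a measurable set \<open>E\<close> let \<open>H\<^sub>\<alpha>(E)\<close> be the halo of level \<open>\<alpha>\<close>, the set where the strong maximal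
  function of the indicator of \<open>E\<close> exceeds \<open>\<alpha>\<close>, and let \<open>C(\<alpha>)\<close> be the sharp Tauberian constant.
  The theorem rests on two properties of \<open>C\<close>.

  The first is submultiplicativity, \<open>C(\<alpha>) \<le> C(\<alpha>/\<beta>) C(\<beta>)\<close> for \<open>\<alpha> < \<beta>\<close>. It holds because \<open>H\<^sub>\<alpha>(E)\<close> is
  contained in the halo of level \<open>\<alpha>/\<beta>\<close> of \<open>H\<^sub>\<beta>(E)\<close> (\<open>halo_subset_halo_halo\<close>). Indeed, if \<open>E\<close> has
  density more than \<open>\<alpha>\<close> but at most \<open>\<beta>\<close> in a box, then the box can be cut successively, moving a cut
  away from the middle whenever a half would become too dense, so that disjoint boxes of one
  prescribed density slightly above \<open>\<beta>\<close> cover almost all of \<open>E\<close> (\<open>stopping_partition\<close>). These boxes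
  lie in \<open>H\<^sub>\<beta>(E)\<close> and fill more than the proportion \<open>\<alpha>/\<beta>\<close> of the given box.

  The second is the Solyanik estimate \<open>C(1 - d) \<le> 1 + K d\<^sup>r\<close> for small \<open>d\<close>, where \<open>r\<close> is the reciprocal
  of a dimensional multiple of the \<open>A\<^sub>\<infinity>\<^sup>*\<close> constant (\<open>halo_solyanik\<close>). Given both,
  \<open>C(\<alpha>) - C(\<beta>) \<le> C(\<beta>) (C(\<alpha>/\<beta>) - 1) \<le> C(\<beta>) K (1 - \<alpha>/\<beta>)\<^sup>r\<close> when \<open>\<alpha>/\<beta>\<close> is close to \<open>1\<close>, and the
  finiteness of \<open>C\<close> near \<open>1\<close> spreads to all levels.

  The Solyanik estimate is reduced to the line. If a box is filled by \<open>E\<close> up to the proportion \<open>d\<close>,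
  then, by Chebyshev's inequality, most lines in a coordinate direction meet it in a segment that is
  filled up to the proportion \<open>sqrt d\<close>. Adding to \<open>E\<close> all such segments, and repeating this for every
  coordinate, one covers the box (\<open>coord_integrals_small_imp_iter_dir_halo\<close>). The repeated square
  roots cost a factor \<open>2\<^sup>n\<close> in the exponent, and each step adds little mass because of the estimate on
  the line and Fubini's theorem (\<open>dir_halo_estimate\<close>).

  On the line, a minimal finite cover by intervals overlaps at most twice, so it suffices to know that
  a subset of relative length \<open>s\<close> of an interval has relative mass at most a constant times \<open>s\<close> to a
  power of order \<open>1/Q\<close>, where \<open>Q\<close> is the Fujii--Wilson constant (\<open>A_infinity_power_bound\<close>). For this
  let \<open>a\<close> be the average of the weight over the interval. Stopping partitions at the heights
  \<open>2a, 4a, ..., 2\<^sup>ma\<close> each force the maximal function to have a sizeable integral, unless the part of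
  the weight concentrated above the height \<open>2\<^sup>m\<^sup>+\<^sup>1a\<close> is small; with \<open>m\<close> of order \<open>Q\<close> at most half of the
  mass can be there (\<open>stopping_set_halves_mass\<close>). Iteration gives the power.
\<close>

section \<open>Stopping partitions by continuous bisection\<close>

text \<open>The boxes that the bisection below produces are obtained by cutting a given box along
  hyperplanes, so they contain some of their faces and not others.\<close>

definition cell :: "'a::euclidean_space measure \<Rightarrow> real \<Rightarrow> 'a set \<Rightarrow> bool" where
  "cell M l Q \<longleftrightarrow> is_interval Q \<and> bounded Q \<and> Q \<in> sets borel \<and>
    emeasure M Q \<le> ennreal l * emeasure lborel Q"

definition saturated :: "'a::euclidean_space measure \<Rightarrow> real \<Rightarrow> 'a set \<Rightarrow> bool" where
  "saturated M l Q \<longleftrightarrow> emeasure M Q = ennreal l * emeasure lborel Q"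

definition width_le :: "'a::euclidean_space \<Rightarrow> real \<Rightarrow> 'a set \<Rightarrow> bool" where
  "width_le b s Q \<longleftrightarrow> (\<forall>x\<in>Q. \<forall>y\<in>Q. x \<bullet> b - y \<bullet> b \<le> s)"

lemma width_le_subset: "width_le b s Q \<Longrightarrow> P \<subseteq> Q \<Longrightarrow> width_le b s P"
  unfolding width_le_def by blast

lemma null_hyperplane:
  fixes b :: "'a::euclidean_space"
  assumes "b \<in> Basis"
  shows "emeasure lborel {x. x \<bullet> b = t} = 0"
proof -
  have "negligible {x. x \<bullet> b = t}"
    using negligible_standard_hyperplane[OF assms, of t] by simp
  moreover have "{x. x \<bullet> b = t} \<in> sets borel" by measurable
  ultimately show ?thesis
    by (metis emeasure_completion negligible_iff_null_sets null_setsD1 null_sets_completion_iff sets_lborel)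
qed

text \<open>The mass below a moving hyperplane is the distribution function of a finite measure on the
  line, and that measure has no atoms because hyperplanes are null sets.\<close>

lemma continuous_halfspace_measure:
  fixes b :: "'a::euclidean_space"
  assumes M: "sets M = sets borel" "absolutely_continuous lborel M"
    and Q: "Q \<in> sets borel" "emeasure M Q < \<infinity>" and b: "b \<in> Basis"
  shows "continuous_on UNIV (\<lambda>t. measure M (Q \<inter> {x. x \<bullet> b \<le> t}))"
proof -
  define N where "N = distr (density M (indicator Q)) borel (\<lambda>x. x \<bullet> b)"
  have meas: "(\<lambda>x. x \<bullet> b) \<in> measurable (density M (indicator Q)) borel"
    using measurable_cong_sets[of "density M (indicator Q)" borel borel borel] M by simp
  have emN: "emeasure N X = emeasure M (Q \<inter> ((\<lambda>x. x \<bullet> b) -` X))" if "X \<in> sets borel" for X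
  proof -
    have sp: "space M = UNIV" using sets_eq_imp_space_eq[OF M(1)] by simp
    have X: "(\<lambda>x. x \<bullet> b) -` X \<in> sets M"
      using measurable_sets[OF meas that] sp by simp
    have "emeasure N X = (\<integral>\<^sup>+x. indicator Q x * indicator ((\<lambda>x. x \<bullet> b) -` X) x \<partial>M)"
      unfolding N_def using meas that X Q M sp
      by (subst emeasure_distr) (auto simp: emeasure_density)
    also have "\<dots> = (\<integral>\<^sup>+x. indicator (Q \<inter> (\<lambda>x. x \<bullet> b) -` X) x \<partial>M)"
      by (simp add: indicator_inter_arith)
    finally show ?thesis using X Q M by simp
  qed
  have fin: "finite_borel_measure N"
  proof (intro finite_borel_measure.intro finite_borel_measure_axioms.intro finite_measureI)
    show "sets N = sets borel" unfolding N_def by simp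
    have sp: "space N = UNIV" unfolding N_def by simp
    show "emeasure N (space N) \<noteq> \<infinity>" unfolding sp
      using emN[of UNIV] Q by simp
  qed
  interpret finite_borel_measure N by fact
  have cdfN: "cdf N t = measure M (Q \<inter> {x. x \<bullet> b \<le> t})" for t
    unfolding cdf_def measure_def using emN[of "{..t}"] by (simp add: vimage_def)
  have "isCont (cdf N) t" for t
  proof -
    have "emeasure lborel (Q \<inter> {x. x \<bullet> b = t}) \<le> emeasure lborel {x. x \<bullet> b = t}"
      by (intro emeasure_mono) auto
    hence "emeasure lborel (Q \<inter> {x. x \<bullet> b = t}) = 0"
      using null_hyperplane[OF b, of t] by simp
    moreover have "Q \<inter> {x. x \<bullet> b = t} \<in> sets borel" using Q by measurable
    ultimately have "Q \<inter> {x. x \<bullet> b = t} \<in> null_sets lborel" by auto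
    hence "Q \<inter> {x. x \<bullet> b = t} \<in> null_sets M" using M(2) unfolding absolutely_continuous_def by blast
    hence "measure N {t} = 0" unfolding measure_def using emN[of "{t}"] by (simp add: vimage_def null_setsD1)
    thus ?thesis using isCont_cdf by blast
  qed
  thus ?thesis unfolding cdfN[abs_def, symmetric]
    using cdfN continuous_at_imp_continuous_on by (metis (no_types, lifting) ext)
qed

text \<open>In the application, \<open>F t\<close> is the excess of mass over \<open>l\<close> times volume in the part of a box
  below height \<open>t\<close>, and \<open>F hi - F t\<close> is the excess of the part above. The cut is made at the
  midpoint \<open>m\<close> unless one half is too heavy; then the heavy half is enlarged until its excess
  vanishes.\<close>

lemma balanced_cut_value:
  fixes F :: "real \<Rightarrow> real"
  assumes "continuous_on UNIV F" "lo \<le> m" "m \<le> hi" "F lo = 0" "F hi \<le> 0"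
  obtains t where "F hi \<le> F t" "F t \<le> 0" "F t = 0 \<or> t \<le> m" "F t = F hi \<or> m \<le> t"
proof -
  have cont: "continuous_on X F" for X using assms(1) continuous_on_subset by blast
  consider "F m > 0" | "F m < F hi" | "F m \<le> 0" "F hi \<le> F m" by linarith
  thus thesis
  proof cases
    case 1
    then obtain t where "m \<le> t" "t \<le> hi" "F t = 0"
      using IVT2'[of F hi 0 m] assms cont by auto
    thus thesis using that[of t] assms by auto
  next
    case 2
    then obtain t where "lo \<le> t" "t \<le> m" "F t = F hi"
      using IVT2'[of F m "F hi" lo] assms cont by auto
    thus thesis using that[of t] assms by auto
  next
    case 3
    thus thesis using that[of m] by auto
  qed
qed

text \<open>One cut: each of the two parts is again light enough, and it is at most half as wide unless
  its density is exactly \<open>l\<close>. A part of density \<open>l\<close> is finished and will not be cut again.\<close>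

lemma cut_cell:
  fixes M :: "'a::euclidean_space measure"
  assumes M: "sets M = sets borel" "absolutely_continuous lborel M" and l: "0 \<le> l"
    and Q: "cell M l Q" and b: "b \<in> Basis" and w: "width_le b s Q"
  obtains A B where "A \<union> B = Q" "A \<inter> B = {}" "cell M l A" "cell M l B"
    "saturated M l A \<or> width_le b (s/2) A" "saturated M l B \<or> width_le b (s/2) B"
proof (cases "Q = {}")
  case True
  thus thesis using that[of "{}" "{}"] Q by (auto simp: width_le_def)
next
  case False
  have Qi: "is_interval Q" "bounded Q" "Q \<in> sets borel" and Qm: "emeasure M Q \<le> ennreal l * emeasure lborel Q"
    using Q by (auto simp: cell_def)
  have fL: "emeasure lborel Q < \<infinity>" using emeasure_bounded_finite[OF Qi(2)] .
  hence fM: "emeasure M Q < \<infinity>" using Qm by (metis ennreal_less_top ennreal_mult_less_top infinity_ennreal_def order_le_less_trans)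
  have nz: "\<exists>m. \<forall>x\<in>Q. \<bar>x \<bullet> b - m\<bar> \<le> s / 2"
  proof -
    let ?P = "(\<lambda>x. x \<bullet> b) ` Q"
    have bd: "bounded ?P" by (rule bounded_linear_image[OF Qi(2)]) (rule bounded_linear_inner_left)
    hence bdd: "bdd_above ?P" "bdd_below ?P" by (auto intro: bounded_imp_bdd_above bounded_imp_bdd_below)
    have ne: "?P \<noteq> {}" using False by simp
    have "Sup ?P \<le> s + y" if "y \<in> ?P" for y
      using that w by (intro cSup_least[OF ne]) (force simp: width_le_def)
    hence "Sup ?P - s \<le> Inf ?P" by (intro cInf_greatest[OF ne]) (auto simp: algebra_simps)
    moreover have "x \<bullet> b \<le> Sup ?P" "Inf ?P \<le> x \<bullet> b" if "x \<in> Q" for x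
      using that bdd by (auto intro: cSup_upper cInf_lower)
    ultimately have "\<forall>x\<in>Q. \<bar>x \<bullet> b - (Sup ?P + Inf ?P) / 2\<bar> \<le> s / 2"
      by (force simp: abs_le_iff field_simps)
    thus ?thesis by blast
  qed
  then obtain m where m: "\<And>x. x \<in> Q \<Longrightarrow> \<bar>x \<bullet> b - m\<bar> \<le> s / 2" by blast
  obtain q where "q \<in> Q" using False by blast
  hence s: "0 \<le> s" using m[of q] by linarith
  define F where "F t = measure M (Q \<inter> {x. x \<bullet> b \<le> t}) - l * measure lborel (Q \<inter> {x. x \<bullet> b \<le> t})" for t
  have cF: "continuous_on UNIV F" unfolding F_def
    by (intro continuous_intros continuous_halfspace_measure M Qi b fM fL)
       (auto simp: absolutely_continuous_def)
  define lo hi where "lo = m - s/2 - 1" and "hi = m + s/2"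
  have "Q \<inter> {x. x \<bullet> b \<le> lo} = {}"
  proof (intro equals0I)
    fix x assume "x \<in> Q \<inter> {x. x \<bullet> b \<le> lo}"
    hence "\<bar>x \<bullet> b - m\<bar> \<le> s / 2" "x \<bullet> b \<le> m - s / 2 - 1" using m[of x] by (auto simp: lo_def)
    thus False by linarith
  qed
  hence F0: "F lo = 0" by (simp add: F_def)
  have "x \<bullet> b \<le> hi" if "x \<in> Q" for x using m[OF that] unfolding hi_def by linarith
  hence hiQ: "Q \<inter> {x. x \<bullet> b \<le> hi} = Q" by blast
  have real_le: "emeasure M X \<le> ennreal l * emeasure lborel X \<longleftrightarrow> measure M X \<le> l * measure lborel X"
    and real_eq: "emeasure M X = ennreal l * emeasure lborel X \<longleftrightarrow> measure M X = l * measure lborel X"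
    if "X \<subseteq> Q" "X \<in> sets borel" for X
  proof -
    have "emeasure M X < \<infinity>" "emeasure lborel X < \<infinity>"
      using emeasure_mono[OF that(1)] fM fL Qi M by (metis order_le_less_trans sets_lborel)+
    hence "emeasure M X = ennreal (measure M X)" "emeasure lborel X = ennreal (measure lborel X)"
      by (simp_all add: emeasure_eq_ennreal_measure)
    thus "emeasure M X \<le> ennreal l * emeasure lborel X \<longleftrightarrow> measure M X \<le> l * measure lborel X"
      "emeasure M X = ennreal l * emeasure lborel X \<longleftrightarrow> measure M X = l * measure lborel X"
      using l by (simp_all add: ennreal_mult[symmetric])
  qed
  have Fhi: "F hi \<le> 0" unfolding F_def hiQ using Qm real_le[of Q] Qi by simp
  (* The box lies within distance s/2 of the hyperplane at height m, so a part that ends at m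
     has width at most s/2. *)
  obtain t where t: "F hi \<le> F t" "F t \<le> 0" "F t = 0 \<or> t \<le> m" "F t = F hi \<or> m \<le> t"
    using balanced_cut_value[OF cF _ _ F0 Fhi, of m] s by (auto simp: lo_def hi_def)
  define A B where "A = Q \<inter> {x. x \<bullet> b \<le> t}" and "B = Q \<inter> {x. t < x \<bullet> b}"
  have borel: "A \<in> sets borel" "B \<in> sets borel" unfolding A_def B_def using Qi by measurable
  have sub: "A \<subseteq> Q" "B \<subseteq> Q" "A \<union> B = Q" "A \<inter> B = {}" unfolding A_def B_def by auto
  have add: "measure N Q = measure N A + measure N B" if "sets N = sets borel" "emeasure N Q < \<infinity>" for N
  proof -
    have "measure N (A \<union> B) = measure N A + measure N B"
      using that sub borel emeasure_mono[of A Q N] emeasure_mono[of B Q N] Qi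
      by (intro measure_Union) (auto simp: less_top[symmetric] top_unique)
    thus ?thesis using sub by simp
  qed
  have FA: "F t = measure M A - l * measure lborel A" unfolding F_def A_def ..
  have FB: "F hi - F t = measure M B - l * measure lborel B"
    using add[OF M(1) fM] add[of lborel] fL unfolding FA unfolding F_def hiQ by (simp add: algebra_simps)
  have int: "is_interval A" "is_interval B"
    unfolding A_def B_def
    by (auto intro!: is_interval_Int Qi(1)) (use b in \<open>force simp: is_interval_def\<close>)+
  have cells: "cell M l A" "cell M l B"
    using real_le[OF sub(1) borel(1)] real_le[OF sub(2) borel(2)] FA FB t int borel bounded_subset[OF Qi(2)] sub
    by (auto simp: cell_def)
  have "saturated M l A \<or> width_le b (s/2) A"
  proof (cases "F t = 0")
    case True thus ?thesis using real_eq[OF sub(1) borel(1)] FA by (simp add: saturated_def)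
  next
    case False
    have "x \<bullet> b - y \<bullet> b \<le> s/2" if "x \<in> A" "y \<in> A" for x y
      using m[of y] that t(3) False unfolding A_def by auto
    thus ?thesis by (simp add: width_le_def)
  qed
  moreover have "saturated M l B \<or> width_le b (s/2) B"
  proof (cases "F t = F hi")
    case True thus ?thesis using real_eq[OF sub(2) borel(2)] FB by (simp add: saturated_def)
  next
    case False
    have "x \<bullet> b - y \<bullet> b \<le> s/2" if "x \<in> B" "y \<in> B" for x y
      using m[of x] that t(4) False unfolding B_def by auto
    thus ?thesis by (simp add: width_le_def)
  qed
  ultimately show thesis using that sub cells by blast
qed


lemma disjoint_UN_refine:
  assumes "disjoint \<P>" and "\<And>C. C \<in> \<P> \<Longrightarrow> disjoint (\<A> C)" and "\<And>C. C \<in> \<P> \<Longrightarrow> \<Union>(\<A> C) = C"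
  shows "disjoint (\<Union>C\<in>\<P>. \<A> C)"
proof (intro pairwiseI)
  fix X Y assume "X \<in> (\<Union>C\<in>\<P>. \<A> C)" "Y \<in> (\<Union>C\<in>\<P>. \<A> C)" and ne: "X \<noteq> Y"
  then obtain C D where CD: "C \<in> \<P>" "D \<in> \<P>" "X \<in> \<A> C" "Y \<in> \<A> D" by auto
  show "disjnt X Y"
  proof (cases "C = D")
    case True
    thus ?thesis using assms(2)[of C] CD ne by (auto simp: pairwise_def)
  next
    case False
    hence "disjnt C D" using assms(1) CD by (auto simp: pairwise_def)
    moreover have "X \<subseteq> C" "Y \<subseteq> D" using assms(3) CD by blast+
    ultimately show ?thesis by (meson disjnt_subset1 disjnt_subset2)
  qed
qed

text \<open>Cutting successively in all coordinate directions, and leaving finished boxes alone.\<close>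

lemma refine_cell:
  fixes M :: "'a::euclidean_space measure"
  assumes M: "sets M = sets borel" "absolutely_continuous lborel M" and l: "0 \<le> l"
    and Q: "cell M l Q" and w: "\<And>b. b \<in> Basis \<Longrightarrow> width_le b s Q"
  shows "\<exists>\<P>. finite \<P> \<and> disjoint \<P> \<and> \<Union>\<P> = Q \<and>
    (\<forall>C\<in>\<P>. cell M l C \<and> (saturated M l C \<or> (\<forall>b\<in>Basis. width_le b (s/2) C)))"
proof -
  have "\<exists>\<P>. finite \<P> \<and> disjoint \<P> \<and> \<Union>\<P> = Q \<and>
    (\<forall>C\<in>\<P>. cell M l C \<and> (saturated M l C \<or> (\<forall>b\<in>bs. width_le b (s/2) C)))"
    if "finite bs" "bs \<subseteq> Basis" for bs
    using that
  proof (induction bs rule: finite_induct)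
    case empty
    show ?case using Q by (intro exI[of _ "{Q}"]) (auto simp: pairwise_def)
  next
    case (insert b bs)
    then obtain \<P> where P: "finite \<P>" "disjoint \<P>" "\<Union>\<P> = Q"
      "\<And>C. C \<in> \<P> \<Longrightarrow> cell M l C" "\<And>C. C \<in> \<P> \<Longrightarrow> saturated M l C \<or> (\<forall>b\<in>bs. width_le b (s/2) C)"
      by auto
    have b: "b \<in> Basis" using insert by simp
    have "\<exists>\<A>. finite \<A> \<and> disjoint \<A> \<and> \<Union>\<A> = C \<and>
      (\<forall>D\<in>\<A>. cell M l D \<and> (saturated M l D \<or> (\<forall>b\<in>insert b bs. width_le b (s/2) D)))"
      if C: "C \<in> \<P>" for C
    proof (cases "saturated M l C")
      case True
      thus ?thesis using P(4)[OF C] by (intro exI[of _ "{C}"]) (auto simp: pairwise_def)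
    next
      case False
      have "C \<subseteq> Q" using P C by blast
      then obtain A B where AB: "A \<union> B = C" "A \<inter> B = {}" "cell M l A" "cell M l B"
        "saturated M l A \<or> width_le b (s/2) A" "saturated M l B \<or> width_le b (s/2) B"
        using cut_cell[OF M l P(4)[OF C] b width_le_subset[OF w[OF b]]] by metis
      have "\<forall>b\<in>bs. width_le b (s/2) C" using P(5)[OF C] False by blast
      hence "\<forall>b\<in>bs. width_le b (s/2) A \<and> width_le b (s/2) B"
        using AB(1) by (meson Un_upper1 Un_upper2 width_le_subset)
      thus ?thesis using AB by (intro exI[of _ "{A, B}"]) (auto simp: pairwise_def disjnt_def)
    qed
    then obtain \<A> where A: "\<And>C. C \<in> \<P> \<Longrightarrow> finite (\<A> C) \<and> disjoint (\<A> C) \<and> \<Union>(\<A> C) = C \<and>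
      (\<forall>D\<in>\<A> C. cell M l D \<and> (saturated M l D \<or> (\<forall>b\<in>insert b bs. width_le b (s/2) D)))"
      by metis
    have "disjoint (\<Union>C\<in>\<P>. \<A> C)"
      by (rule disjoint_UN_refine) (use A P in auto)
    moreover have "\<Union>(\<Union>C\<in>\<P>. \<A> C) = (\<Union>C\<in>\<P>. \<Union>(\<A> C))" by blast
    hence "\<Union>(\<Union>C\<in>\<P>. \<A> C) = Q" using A P(3) by simp
    ultimately show ?case using A P by (intro exI[of _ "\<Union>C\<in>\<P>. \<A> C"]) auto
  qed
  from this[OF finite_Basis order_refl] show ?thesis .
qed


lemma emeasure_disjoint_Union:
  assumes "countable \<C>" "disjoint \<C>" "\<And>C. C \<in> \<C> \<Longrightarrow> C \<in> sets N"
  shows "emeasure N (\<Union>\<C>) = (\<integral>\<^sup>+C. emeasure N C \<partial>count_space \<C>)"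
proof -
  have "disjoint_family_on (\<lambda>C. C) \<C>"
    using assms(2) by (simp add: disjoint_family_on_def pairwise_def disjnt_def)
  from emeasure_UN_countable[OF assms(3) assms(1) this] show ?thesis by simp
qed

lemma emeasure_Union_le_cmult:
  assumes "countable \<C>" "disjoint \<C>" "\<And>C. C \<in> \<C> \<Longrightarrow> C \<in> sets borel" "sets M = sets borel"
    and "\<And>C. C \<in> \<C> \<Longrightarrow> emeasure M C \<le> c * emeasure lborel C"
  shows "emeasure M (\<Union>\<C>) \<le> c * emeasure lborel (\<Union>\<C>)"
proof -
  have "emeasure M (\<Union>\<C>) = (\<integral>\<^sup>+C. emeasure M C \<partial>count_space \<C>)"
    by (intro emeasure_disjoint_Union) (use assms in auto)
  also have "\<dots> \<le> (\<integral>\<^sup>+C. c * emeasure lborel C \<partial>count_space \<C>)"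
    by (intro nn_integral_mono) (use assms in auto)
  also have "\<dots> = c * (\<integral>\<^sup>+C. emeasure lborel C \<partial>count_space \<C>)"
    by (intro nn_integral_cmult) auto
  also have "(\<integral>\<^sup>+C. emeasure lborel C \<partial>count_space \<C>) = emeasure lborel (\<Union>\<C>)"
    by (intro emeasure_disjoint_Union[symmetric]) (use assms in auto)
  finally show ?thesis .
qed

lemma emeasure_Union_eq_cmult:
  assumes "countable \<C>" "disjoint \<C>" "\<And>C. C \<in> \<C> \<Longrightarrow> C \<in> sets borel" "sets M = sets borel"
    and "\<And>C. C \<in> \<C> \<Longrightarrow> emeasure M C = c * emeasure lborel C"
  shows "emeasure M (\<Union>\<C>) = c * emeasure lborel (\<Union>\<C>)"
proof -
  have "emeasure M (\<Union>\<C>) = (\<integral>\<^sup>+C. emeasure M C \<partial>count_space \<C>)"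
    by (intro emeasure_disjoint_Union) (use assms in auto)
  also have "\<dots> = (\<integral>\<^sup>+C. c * emeasure lborel C \<partial>count_space \<C>)"
    by (intro nn_integral_cong) (use assms in auto)
  also have "\<dots> = c * (\<integral>\<^sup>+C. emeasure lborel C \<partial>count_space \<C>)"
    by (intro nn_integral_cmult) auto
  also have "(\<integral>\<^sup>+C. emeasure lborel C \<partial>count_space \<C>) = emeasure lborel (\<Union>\<C>)"
    by (intro emeasure_disjoint_Union[symmetric]) (use assms in auto)
  finally show ?thesis .
qed

text \<open>
  Refining again and again gives nested finite partitions of \<open>R\<close>. The family \<open>\<F>\<close> consists of the
  boxes that are finished at some stage. A point outside \<open>\<Union>\<F>\<close> lies in boxes of density at most
  \<open>l\<close> whose diameters tend to \<open>0\<close>, so any open set containing \<open>B\<close> eventually contains these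
  boxes. This replaces Lebesgue's differentiation theorem, which would need more care here since
  the boxes can be arbitrarily eccentric.
\<close>

lemma stopping_partition_aux:
  fixes M :: "'a::euclidean_space measure"
  assumes M: "sets M = sets borel" "absolutely_continuous lborel M" and l: "0 \<le> l"
    and R: "cell M l R"
  obtains \<F> where "countable \<F>" "disjoint \<F>"
    "\<And>C. C \<in> \<F> \<Longrightarrow> is_interval C \<and> C \<subseteq> R \<and> C \<in> sets borel"
    "\<And>C. C \<in> \<F> \<Longrightarrow> emeasure M C = ennreal l * emeasure lborel C"
    "\<And>B. B \<in> sets borel \<Longrightarrow> B \<subseteq> R - \<Union>\<F> \<Longrightarrow> emeasure M B \<le> ennreal l * emeasure lborel B"
proof -
  obtain D where D: "\<And>x. x \<in> R \<Longrightarrow> norm x \<le> D" using R by (auto simp: cell_def bounded_iff)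
  define s where "s k = 2 * D / 2 ^ k" for k :: nat
  have s_Suc: "s (Suc k) = s k / 2" for k by (simp add: s_def)
  define ok where "ok k C \<longleftrightarrow> cell M l C \<and> (saturated M l C \<or> (\<forall>b\<in>Basis. width_le b (s k) C))" for k C
  define rfn where "rfn Q k \<P> \<longleftrightarrow> finite \<P> \<and> disjoint \<P> \<and> \<Union>\<P> = Q \<and> (\<forall>C\<in>\<P>. ok (Suc k) C) \<and>
    (saturated M l Q \<longrightarrow> \<P> = {Q})" for Q k \<P>
  have "\<exists>\<P>. rfn Q k \<P>" if "ok k Q" for Q k
  proof (cases "saturated M l Q")
    case True
    thus ?thesis using that by (intro exI[of _ "{Q}"]) (auto simp: ok_def rfn_def pairwise_def)
  next
    case False
    hence "\<And>b. b \<in> Basis \<Longrightarrow> width_le b (s k) Q" "cell M l Q" using that by (auto simp: ok_def)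
    from refine_cell[OF M l this(2,1)] False show ?thesis by (auto simp: ok_def s_Suc rfn_def)
  qed
  define ref where "ref Q k = (SOME \<P>. rfn Q k \<P>)" for Q k
  have rfn: "rfn Q k (ref Q k)" if "ok k Q" for Q k
    unfolding ref_def using \<open>\<And>Q k. ok k Q \<Longrightarrow> \<exists>\<P>. rfn Q k \<P>\<close>[OF that] by (rule someI_ex)
  have ref: "\<And>Q k. ok k Q \<Longrightarrow> finite (ref Q k)" "\<And>Q k. ok k Q \<Longrightarrow> disjoint (ref Q k)"
    "\<And>Q k. ok k Q \<Longrightarrow> \<Union>(ref Q k) = Q" "\<And>Q k C. ok k Q \<Longrightarrow> C \<in> ref Q k \<Longrightarrow> ok (Suc k) C"
    "\<And>Q k. ok k Q \<Longrightarrow> saturated M l Q \<Longrightarrow> ref Q k = {Q}"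
    using rfn unfolding rfn_def by blast+
  define lev where "lev = rec_nat {R} (\<lambda>k \<P>. \<Union>Q\<in>\<P>. ref Q k)"
  have lev_0: "lev 0 = {R}" and lev_Suc: "lev (Suc k) = (\<Union>Q\<in>lev k. ref Q k)" for k
    by (simp_all add: lev_def)
  have width_R: "width_le b (s 0) R" if "b \<in> Basis" for b
  proof -
    have "x \<bullet> b - y \<bullet> b \<le> 2 * D" if "x \<in> R" "y \<in> R" for x y
      using D[OF that(1)] D[OF that(2)] Basis_le_norm[OF \<open>b \<in> Basis\<close>, of x] Basis_le_norm[OF \<open>b \<in> Basis\<close>, of y]
      by linarith
    thus ?thesis by (simp add: width_le_def s_def)
  qed
  have inv: "finite (lev k) \<and> disjoint (lev k) \<and> \<Union>(lev k) = R \<and> (\<forall>C\<in>lev k. ok k C)" for k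
  proof (induction k)
    case 0
    show ?case using R width_R by (auto simp: lev_0 ok_def pairwise_def)
  next
    case (Suc k)
    have ok: "ok k Q" if "Q \<in> lev k" for Q using Suc that by blast
    have "disjoint (lev (Suc k))" unfolding lev_Suc
      by (rule disjoint_UN_refine) (use Suc ref ok in auto)
    moreover have "finite (lev (Suc k))" unfolding lev_Suc using Suc ref(1) ok by blast
    moreover have "\<Union>(lev (Suc k)) = (\<Union>Q\<in>lev k. \<Union>(ref Q k))" unfolding lev_Suc by blast
    hence "\<Union>(lev (Suc k)) = R" using Suc ref(3) ok by simp
    moreover have "\<forall>C\<in>lev (Suc k). ok (Suc k) C" unfolding lev_Suc using ref(4) ok by blast
    ultimately show ?case by blast
  qed
  have ok_borel: "C \<in> sets borel" if "ok k C" for k C using that by (auto simp: ok_def cell_def)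
  define \<F> where "\<F> = (\<Union>k. {C \<in> lev k. saturated M l C})"
  have stay: "C \<in> lev (k + i)" if "C \<in> lev k" "saturated M l C" for C k i
  proof (induction i)
    case (Suc i)
    thus ?case using inv[of "k+i"] ref(5)[of "k+i" C] that(2) by (auto simp: lev_Suc)
  qed (use that in simp)
  have "countable {C \<in> lev k. saturated M l C}" for k using inv[of k] by (intro countable_finite) auto
  hence "countable \<F>" unfolding \<F>_def by (intro countable_UN) auto
  moreover have "disjoint \<F>"
  proof (intro pairwiseI)
    fix X Y assume "X \<in> \<F>" "Y \<in> \<F>" and ne: "X \<noteq> Y"
    then obtain i j where ij: "X \<in> lev i" "saturated M l X" "Y \<in> lev j" "saturated M l Y" by (auto simp: \<F>_def)
    have "X \<in> lev (i + j)" "Y \<in> lev (i + j)"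
      using stay[OF ij(1,2), of j] stay[OF ij(3,4), of i] by (auto simp: add.commute)
    thus "disjnt X Y" using inv[of "i+j"] ne by (auto simp: pairwise_def)
  qed
  moreover have "is_interval C \<and> C \<subseteq> R \<and> C \<in> sets borel" if "C \<in> \<F>" for C
    using that inv unfolding \<F>_def ok_def cell_def by blast
  moreover have "emeasure M C = ennreal l * emeasure lborel C" if "C \<in> \<F>" for C
    using that unfolding \<F>_def saturated_def by auto
  moreover have "emeasure M B \<le> ennreal l * emeasure lborel B"
    if B: "B \<in> sets borel" "B \<subseteq> R - \<Union>\<F>" for B
  proof -
    have bound: "emeasure M B \<le> ennreal l * emeasure lborel U" if U: "open U" "B \<subseteq> U" for U
    proof -
      (* V k collects the boxes of stage k inside U; it has mass at most l times the volume of U,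
         and it exhausts B as k grows. *)
      define V where "V k = \<Union>{C \<in> lev k. C \<subseteq> U}" for k
      have fam: "countable {C \<in> lev k. C \<subseteq> U}" "disjoint {C \<in> lev k. C \<subseteq> U}" for k
        using inv[of k] by (auto intro: countable_finite simp: pairwise_def)
      have Vb: "V k \<in> sets borel" for k
        unfolding V_def using inv[of k] ok_borel[of k]
        by (intro sets.finite_Union) auto
      have MV: "emeasure M (V k) \<le> ennreal l * emeasure lborel U" for k
      proof -
        have "emeasure M (V k) \<le> ennreal l * emeasure lborel (V k)"
          unfolding V_def
        proof (intro emeasure_Union_le_cmult fam M(1))
          fix C assume "C \<in> {C \<in> lev k. C \<subseteq> U}"
          hence "ok k C" using inv[of k] by blast
          thus "C \<in> sets borel" "emeasure M C \<le> ennreal l * emeasure lborel C"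
            by (simp_all add: ok_def cell_def)
        qed
        also have "\<dots> \<le> ennreal l * emeasure lborel U"
          by (intro mult_left_mono emeasure_mono) (auto simp: V_def U)
        finally show ?thesis .
      qed
      have "incseq (\<lambda>k. B \<inter> V k)"
      proof (rule incseq_SucI)
        fix k
        have "V k \<subseteq> V (Suc k)"
        proof
          fix x assume "x \<in> V k"
          then obtain C where C: "C \<in> lev k" "C \<subseteq> U" "x \<in> C" by (auto simp: V_def)
          have "\<Union>(ref C k) = C" using ref(3) inv C(1) by blast
          then obtain C' where "C' \<in> ref C k" "x \<in> C'" "C' \<subseteq> C" using C(3) by blast
          thus "x \<in> V (Suc k)" using C unfolding V_def lev_Suc by blast
        qed
        thus "B \<inter> V k \<subseteq> B \<inter> V (Suc k)" by blast
      qed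
      moreover have "(\<Union>k. B \<inter> V k) = B"
      proof -
        have "\<exists>k. x \<in> V k" if x: "x \<in> B" for x
        proof -
          obtain e where e: "e > 0" "ball x e \<subseteq> U" using U x open_contains_ball by blast
          have "(\<lambda>k. 2 * D * real DIM('a) * (1/2) ^ k) \<longlonglongrightarrow> 2 * D * real DIM('a) * 0"
            by (intro tendsto_intros) auto
          hence "eventually (\<lambda>k. 2 * D * real DIM('a) * (1/2) ^ k < e) sequentially"
            using e order_tendstoD(2) by fastforce
          then obtain k where k: "2 * D * real DIM('a) * (1/2) ^ k < e"
            by (auto simp: eventually_sequentially)
          have "x \<in> R" using x B by blast
          then obtain C where C: "C \<in> lev k" "x \<in> C" using inv[of k] by blast
          have nf: "\<not> saturated M l C" using C x B unfolding \<F>_def by blast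
          have "y \<in> U" if y: "y \<in> C" for y
          proof -
            have w: "\<bar>(x - y) \<bullet> b\<bar> \<le> s k" if "b \<in> Basis" for b
              using nf inv[of k] C y that by (auto simp: ok_def width_le_def abs_le_iff inner_diff_left)
            have "norm (x - y) \<le> (\<Sum>b\<in>Basis. \<bar>(x - y) \<bullet> b\<bar>)" by (rule norm_le_l1)
            also have "\<dots> \<le> (\<Sum>b\<in>(Basis::'a set). s k)" using w by (intro sum_mono) auto
            also have "\<dots> = 2 * D * real DIM('a) * (1/2) ^ k" by (simp add: s_def field_simps)
            finally show ?thesis using k e by (auto simp: dist_norm)
          qed
          thus ?thesis using C unfolding V_def by blast
        qed
        thus ?thesis by blast
      qed
      moreover have "range (\<lambda>k. B \<inter> V k) \<subseteq> sets M" using B Vb M by auto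
      ultimately have "(\<lambda>k. emeasure M (B \<inter> V k)) \<longlonglongrightarrow> emeasure M B"
        using Lim_emeasure_incseq[of "\<lambda>k. B \<inter> V k" M] B Vb M by auto
      moreover have "emeasure M (B \<inter> V k) \<le> ennreal l * emeasure lborel U" for k
        by (rule order_trans[OF emeasure_mono MV]) (use Vb M in auto)
      ultimately show ?thesis by (intro LIMSEQ_le_const2[of _ "emeasure M B"]) auto
    qed
    have "B \<subseteq> R" using B by blast
    hence "bounded B" using R bounded_subset[of R B] by (auto simp: cell_def)
    hence fin: "emeasure lborel B < \<infinity>" by (rule emeasure_bounded_finite)
    show ?thesis
    proof (rule ennreal_le_epsilon)
      fix e :: real assume e: "0 < e"
      obtain U where U: "open U" "B \<subseteq> U" "emeasure lborel (U - B) < ennreal (e / (l + 1))"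
        using outer_regular_lborel[OF B(1), of "e / (l + 1)"] e l by auto
      have "emeasure lborel U = emeasure lborel B + emeasure lborel (U - B)"
        using U B by (subst plus_emeasure) (auto intro!: arg_cong[where f = "emeasure lborel"])
      hence "ennreal l * emeasure lborel U \<le> ennreal l * (emeasure lborel B + ennreal (e / (l + 1)))"
        using U(3) by (intro mult_left_mono) (auto intro!: add_mono)
      also have "\<dots> = ennreal l * emeasure lborel B + ennreal (l * (e / (l + 1)))"
        using l e ennreal_mult[of l "e / (l + 1)"] by (simp add: distrib_left)
      also have "\<dots> \<le> ennreal l * emeasure lborel B + ennreal e"
        using l e by (intro add_mono ennreal_leI) (auto simp: field_simps)
      finally show "emeasure M B \<le> ennreal l * emeasure lborel B + ennreal e"
        using bound[OF U(1,2)] by simp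
    qed
  qed
  ultimately show thesis using that by blast
qed


text \<open>A Calderon--Zygmund decomposition in which the density on the selected boxes is equal to \<open>l\<close>,
  without the usual loss of a factor \<open>2\<^sup>n\<close>, and without any restriction on the shape of \<open>R\<close>. Boxes of
  volume \<open>0\<close> carry no mass and are discarded.\<close>

theorem stopping_partition:
  fixes M :: "'a::euclidean_space measure"
  assumes M: "sets M = sets borel" "absolutely_continuous lborel M" and l: "0 \<le> l"
    and R: "cell M l R"
  obtains \<F> where "countable \<F>" "disjoint \<F>"
    "\<And>C. C \<in> \<F> \<Longrightarrow> is_interval C \<and> C \<subseteq> R \<and> C \<in> sets borel \<and> bounded C \<and> 0 < emeasure lborel C"
    "\<And>C. C \<in> \<F> \<Longrightarrow> emeasure M C = ennreal l * emeasure lborel C"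
    "\<And>B. B \<in> sets borel \<Longrightarrow> B \<subseteq> R - \<Union>\<F> \<Longrightarrow> emeasure M B \<le> ennreal l * emeasure lborel B"
proof -
  obtain \<F> where F: "countable \<F>" "disjoint \<F>"
    "\<And>C. C \<in> \<F> \<Longrightarrow> is_interval C \<and> C \<subseteq> R \<and> C \<in> sets borel"
    "\<And>C. C \<in> \<F> \<Longrightarrow> emeasure M C = ennreal l * emeasure lborel C"
    "\<And>B. B \<in> sets borel \<Longrightarrow> B \<subseteq> R - \<Union>\<F> \<Longrightarrow> emeasure M B \<le> ennreal l * emeasure lborel B"
    using stopping_partition_aux[OF assms] by blast
  define \<G> where "\<G> = {C \<in> \<F>. 0 < emeasure lborel C}"
  define Z where "Z = \<Union>{C \<in> \<F>. emeasure lborel C = 0}"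
  have "{C \<in> \<F>. emeasure lborel C = 0} \<subseteq> null_sets lborel" using F(3) by auto
  moreover have "countable {C \<in> \<F>. emeasure lborel C = 0}" using F(1) by (rule countable_subset[rotated]) auto
  ultimately have Z: "Z \<in> null_sets lborel"
    using null_sets_UN'[of "{C \<in> \<F>. emeasure lborel C = 0}" "\<lambda>C. C" lborel] unfolding Z_def by auto
  hence ZM: "Z \<in> null_sets M" using M by (auto simp: absolutely_continuous_def)
  have FG: "\<Union>\<F> = \<Union>\<G> \<union> Z" unfolding \<G>_def Z_def by (auto simp: zero_less_iff_neq_zero)
  show thesis
  proof (rule that)
    show "countable \<G>" using F(1) unfolding \<G>_def by (rule countable_subset[rotated]) auto
    show "disjoint \<G>" using F(2) unfolding \<G>_def by (auto simp: pairwise_def)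
    fix C assume C: "C \<in> \<G>"
    hence "C \<in> \<F>" by (simp add: \<G>_def)
    from F(3)[OF this] F(4)[OF this] C
    show "is_interval C \<and> C \<subseteq> R \<and> C \<in> sets borel \<and> bounded C \<and> 0 < emeasure lborel C"
      "emeasure M C = ennreal l * emeasure lborel C"
      using R bounded_subset[of R C] by (auto simp: \<G>_def cell_def)
  next
    fix B assume B: "B \<in> sets borel" "B \<subseteq> R - \<Union>\<G>"
    have Zb: "Z \<in> sets borel" using Z by auto
    have "emeasure M B = emeasure M (B - Z)"
      using emeasure_Diff_null_set[OF ZM, of B] B M by simp
    also have "\<dots> \<le> ennreal l * emeasure lborel (B - Z)"
      using B Zb FG by (intro F(5)) auto
    also have "\<dots> \<le> ennreal l * emeasure lborel B"
      using B by (intro mult_left_mono emeasure_mono) auto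
    finally show "emeasure M B \<le> ennreal l * emeasure lborel B" .
  qed
qed

section \<open>The power form of the Fujii--Wilson condition\<close>

abbreviation weighted :: "('a::euclidean_space \<Rightarrow> real) \<Rightarrow> 'a measure" where
  "weighted w \<equiv> density lborel (\<lambda>x. ennreal (w x))"

lemma weight_measure_eq_weighted:
  fixes w :: "'a::euclidean_space \<Rightarrow> real"
  assumes "w \<in> borel_measurable borel" "A \<in> sets borel"
  shows "weight_measure w A = emeasure (weighted w) A"
  unfolding weight_measure_def using assms
  by (subst nn_integral_completion) (auto simp: emeasure_density)

lemma absolutely_continuous_weighted:
  fixes w :: "'a::euclidean_space \<Rightarrow> real"
  shows "w \<in> borel_measurable borel \<Longrightarrow> absolutely_continuous lborel (weighted w)"
  by (intro absolutely_continuousI_density) auto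

lemma lborel_pos_if_weighted_pos:
  fixes w :: "'a::euclidean_space \<Rightarrow> real"
  assumes "w \<in> borel_measurable borel" "A \<in> sets borel" "0 < emeasure (weighted w) A"
  shows "0 < emeasure lborel A"
proof (rule ccontr)
  assume "\<not> 0 < emeasure lborel A"
  hence "A \<in> null_sets lborel" using assms(2) by (auto simp: zero_less_iff_neq_zero)
  hence "A \<in> null_sets (weighted w)"
    using absolutely_continuous_weighted[OF assms(1)] unfolding absolutely_continuous_def by blast
  thus False using assms(3) by auto
qed

lemma strong_maximal_ge_average:
  fixes w :: "'a::euclidean_space \<Rightarrow> real"
  assumes w: "w \<in> borel_measurable borel" "\<And>x. 0 \<le> w x"
    and C: "is_interval C" "bounded C" "C \<in> sets borel" "0 < emeasure lborel C" "C \<subseteq> J" "x \<in> C"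
  shows "emeasure (weighted w) C / emeasure lborel C \<le> strong_maximal (\<lambda>s. w s * indicator J s) x"
proof -
  have "(\<integral>\<^sup>+y\<in>C. ennreal \<bar>w y * indicator J y\<bar> \<partial>lebesgue) = (\<integral>\<^sup>+y\<in>C. ennreal (w y) \<partial>lebesgue)"
    using C(5) w(2) by (intro nn_integral_cong) (auto simp: indicator_def)
  also have "\<dots> = emeasure (weighted w) C" using weight_measure_eq_weighted[OF w(1) C(3)] by (simp add: weight_measure_def)
  finally have "emeasure (weighted w) C / emeasure lborel C =
     (\<integral>\<^sup>+y\<in>C. ennreal \<bar>w y * indicator J y\<bar> \<partial>lebesgue) / emeasure lebesgue C" using C by simp
  also have "\<dots> \<le> strong_maximal (\<lambda>s. w s * indicator J s) x"
    unfolding strong_maximal_def using C by (intro SUP_upper) (auto simp: parallelepipeds_def)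
  finally show ?thesis .
qed

lemma measure_pos_iff: "0 < measure M A \<longleftrightarrow> 0 < emeasure M A \<and> emeasure M A < \<infinity>"
  by (simp add: measure_def enn2real_positive_iff)

lemma ennreal_divide_le_iff:
  fixes x y q :: ennreal
  assumes "0 < y" "y < \<infinity>"
  shows "x / y \<le> q \<longleftrightarrow> x \<le> q * y"
proof -
  have *: "x / y * y = x"
    using assms by (metis ennreal_times_divide infinity_ennreal_def mult.commute mult_divide_eq_ennreal order_less_irrefl)
  show ?thesis
  proof
    assume "x / y \<le> q"
    from mult_right_mono[OF this, of y] show "x \<le> q * y" using * by simp
  next
    assume "x \<le> q * y"
    thus "x / y \<le> q" using assms(1) by (intro divide_le_posI_ennreal) (auto simp: mult.commute)
  qed
qed

lemma fujii_wilson_integral_le: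
  fixes \<nu> :: "real \<Rightarrow> real"
  assumes \<nu>: "\<nu> \<in> borel_measurable borel" and Q: "fujii_wilson \<nu> \<le> Q"
    and J: "is_interval J" "bounded J" "J \<in> sets borel" "0 < emeasure (weighted \<nu>) J" "emeasure (weighted \<nu>) J < \<infinity>"
  shows "(\<integral>\<^sup>+t\<in>J. strong_maximal (\<lambda>s. \<nu> s * indicator J s) t \<partial>lebesgue) \<le> Q * emeasure (weighted \<nu>) J"
proof -
  have W: "weight_measure \<nu> J = emeasure (weighted \<nu>) J" by (rule weight_measure_eq_weighted[OF \<nu> J(3)])
  have "(\<integral>\<^sup>+t\<in>J. strong_maximal (\<lambda>s. \<nu> s * indicator J s) t \<partial>lebesgue) / weight_measure \<nu> J \<le> fujii_wilson \<nu>"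
    unfolding fujii_wilson_def using J W by (intro SUP_upper) auto
  also have "\<dots> \<le> Q" by (rule Q)
  finally show ?thesis using J by (simp add: W ennreal_divide_le_iff)
qed

text \<open>
  Let \<open>a\<close> be the average of \<open>\<nu>\<close> over \<open>J\<close>, and let \<open>\<Omega> i\<close> be the union of the stopping intervals at
  height \<open>2^i * a\<close>. On \<open>\<Omega> i\<close> the maximal function is at least \<open>2^i * a\<close>, and off \<open>\<Omega> i\<close> the mass
  of a set is at most \<open>2^i * a\<close> times its length. For \<open>i \<le> m\<close> the second fact shows that \<open>\<Omega> i\<close>
  contains at least half of the mass of \<open>\<Omega> (Suc m)\<close>. By the first fact, each of the \<open>m\<close> heights then
  contributes at least a quarter of that mass to the integral of the maximal function over \<open>J\<close>,
  which is at most \<open>Q\<close> times the mass of \<open>J\<close>.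
\<close>

lemma stopping_set_halves_mass:
  fixes \<nu> :: "real \<Rightarrow> real"
  assumes \<nu>: "\<nu> \<in> borel_measurable borel" "\<And>x. 0 \<le> \<nu> x"
    and Q: "fujii_wilson \<nu> \<le> ennreal Q" and m: "8 * Q \<le> real m" "0 \<le> Q" "0 < m"
    and J: "is_interval J" "bounded J" "J \<in> sets borel" "0 < emeasure (weighted \<nu>) J" "emeasure (weighted \<nu>) J < \<infinity>"
  defines "l \<equiv> 2 ^ Suc m * (measure (weighted \<nu>) J / measure lborel J)"
  obtains \<G> where "countable \<G>" "disjoint \<G>"
    "\<And>C. C \<in> \<G> \<Longrightarrow> is_interval C \<and> C \<subseteq> J \<and> C \<in> sets borel \<and> bounded C \<and> 0 < emeasure lborel C"
    "\<And>C. C \<in> \<G> \<Longrightarrow> emeasure (weighted \<nu>) C = ennreal l * emeasure lborel C"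
    "\<And>B. B \<in> sets borel \<Longrightarrow> B \<subseteq> J - \<Union>\<G> \<Longrightarrow> emeasure (weighted \<nu>) B \<le> ennreal l * emeasure lborel B"
    "emeasure (weighted \<nu>) (\<Union>\<G>) \<le> ennreal (1/2) * emeasure (weighted \<nu>) J"
proof -
  let ?M = "weighted \<nu>"
  have M: "sets ?M = sets borel" "absolutely_continuous lborel ?M"
    using absolutely_continuous_weighted[OF \<nu>(1)] by auto
  have fJ: "emeasure lborel J < \<infinity>" using emeasure_bounded_finite[OF J(2)] .
  have "emeasure lborel J \<noteq> 0"
    using lborel_pos_if_weighted_pos[OF \<nu>(1) J(3,4)] by simp
  hence L: "measure lborel J > 0" "emeasure lborel J = ennreal (measure lborel J)"
    using fJ by (auto simp: measure_pos_iff zero_less_iff_neq_zero intro!: emeasure_eq_ennreal_measure)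
  have MJ: "measure ?M J > 0" "emeasure ?M J = ennreal (measure ?M J)"
    using J by (auto simp: measure_pos_iff intro!: emeasure_eq_ennreal_measure)
  define a where "a = measure ?M J / measure lborel J"
  have a: "a > 0" using L MJ by (simp add: a_def)
  have cellJ: "cell ?M (2 ^ i * a) J" for i
  proof -
    have "emeasure ?M J = ennreal (a * measure lborel J)" using L MJ by (simp add: a_def)
    also have "\<dots> \<le> ennreal (2 ^ i * a * measure lborel J)"
      using a L by (intro ennreal_leI mult_right_mono) (auto simp: mult_le_cancel_right1)
    also have "\<dots> = ennreal (2 ^ i * a) * emeasure lborel J" using a L by (simp add: ennreal_mult)
    finally show ?thesis using J by (simp add: cell_def)
  qed
  define P where "P i \<F> \<longleftrightarrow> countable \<F> \<and> disjoint \<F> \<and>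
    (\<forall>C\<in>\<F>. (is_interval C \<and> C \<subseteq> J \<and> C \<in> sets borel \<and> bounded C \<and> 0 < emeasure lborel C) \<and>
       emeasure ?M C = ennreal (2 ^ i * a) * emeasure lborel C) \<and>
    (\<forall>B\<in>sets borel. B \<subseteq> J - \<Union>\<F> \<longrightarrow> emeasure ?M B \<le> ennreal (2 ^ i * a) * emeasure lborel B)" for i \<F>
  have "\<exists>\<F>. P i \<F>" for i
    using stopping_partition[OF M _ cellJ[of i]] a unfolding P_def by (smt (verit) mult_nonneg_nonneg zero_le_power)
  then obtain \<F> where F: "\<And>i. P i (\<F> i)" by metis
  have FP: "countable (\<F> i)" "disjoint (\<F> i)"
    "C \<in> \<F> i \<Longrightarrow> is_interval C \<and> C \<subseteq> J \<and> C \<in> sets borel \<and> bounded C \<and> 0 < emeasure lborel C"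
    "C \<in> \<F> i \<Longrightarrow> emeasure ?M C = ennreal (2 ^ i * a) * emeasure lborel C"
    "B \<in> sets borel \<Longrightarrow> B \<subseteq> J - \<Union>(\<F> i) \<Longrightarrow> emeasure ?M B \<le> ennreal (2 ^ i * a) * emeasure lborel B" for i C B
    using F[of i] unfolding P_def by blast+
  define \<Omega> where "\<Omega> i = \<Union>(\<F> i)" for i
  have \<Omega>J: "\<Omega> i \<subseteq> J" for i unfolding \<Omega>_def using FP(3) by blast
  have \<Omega>b: "\<Omega> i \<in> sets borel" for i
    unfolding \<Omega>_def using FP(1,3) by (intro sets.countable_Union) auto
  have \<Omega>l: "\<Omega> i \<in> sets lebesgue" for i using \<Omega>b by simp
  have fin: "emeasure ?M A = ennreal (measure ?M A)" "emeasure lborel A = ennreal (measure lborel A)"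
    if "A \<subseteq> J" "A \<in> sets borel" for A
    using emeasure_mono[OF that(1), of ?M] emeasure_mono[OF that(1), of lborel] J fJ
    by (auto intro!: emeasure_eq_ennreal_measure simp: top_unique)
  have \<Omega>eq: "measure ?M (\<Omega> i) = 2 ^ i * a * measure lborel (\<Omega> i)" for i
  proof -
    have "emeasure ?M (\<Omega> i) = ennreal (2 ^ i * a) * emeasure lborel (\<Omega> i)"
      unfolding \<Omega>_def using FP by (intro emeasure_Union_eq_cmult) auto
    thus ?thesis unfolding fin[OF \<Omega>J \<Omega>b] using a by (simp add: ennreal_mult[symmetric])
  qed
  define K where "K = Suc m"
  have half: "measure ?M (\<Omega> K) / 2 \<le> measure ?M (\<Omega> i)" if i: "i \<le> m" for i
  proof -
    have b: "\<Omega> K - \<Omega> i \<in> sets borel" "\<Omega> K - \<Omega> i \<subseteq> J" using \<Omega>b \<Omega>J by auto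
    have "emeasure ?M (\<Omega> K - \<Omega> i) \<le> ennreal (2 ^ i * a) * emeasure lborel (\<Omega> K - \<Omega> i)"
      using b \<Omega>J by (intro FP(5)) (auto simp: \<Omega>_def)
    also have "\<dots> \<le> ennreal (2 ^ i * a) * emeasure lborel (\<Omega> K)"
      using \<Omega>b by (intro mult_left_mono emeasure_mono) auto
    finally have "measure ?M (\<Omega> K - \<Omega> i) \<le> 2 ^ i * a * measure lborel (\<Omega> K)"
      unfolding fin[OF \<Omega>J \<Omega>b] fin[OF b(2,1)] using a by (simp add: ennreal_mult[symmetric])
    also have "\<dots> \<le> 2 ^ m * a * measure lborel (\<Omega> K)"
      using a i by (intro mult_right_mono power_increasing) auto
    also have "\<dots> = measure ?M (\<Omega> K) / 2" unfolding \<Omega>eq K_def by simp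
    finally have 1: "measure ?M (\<Omega> K - \<Omega> i) \<le> measure ?M (\<Omega> K) / 2" .
    have "emeasure ?M (\<Omega> K) \<le> emeasure ?M ((\<Omega> K - \<Omega> i) \<union> \<Omega> i)"
      using \<Omega>b by (intro emeasure_mono) auto
    also have "\<dots> \<le> emeasure ?M (\<Omega> K - \<Omega> i) + emeasure ?M (\<Omega> i)"
      using \<Omega>b by (intro emeasure_subadditive) auto
    finally have "measure ?M (\<Omega> K) \<le> measure ?M (\<Omega> K - \<Omega> i) + measure ?M (\<Omega> i)"
      unfolding fin[OF \<Omega>J \<Omega>b] fin[OF b(2,1)] by (simp add: ennreal_plus[symmetric] del: ennreal_plus)
    thus ?thesis using 1 by simp
  qed
  let ?SM = "strong_maximal (\<lambda>s. \<nu> s * indicator J s)"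
  have SM: "ennreal (2 ^ i * a) \<le> ?SM x" if "x \<in> \<Omega> i" for i x
  proof -
    obtain C where C: "C \<in> \<F> i" "x \<in> C" using \<open>x \<in> \<Omega> i\<close> by (auto simp: \<Omega>_def)
    note C' = FP(3)[OF C(1)]
    have "ennreal (2 ^ i * a) = emeasure ?M C / emeasure lborel C"
      using C' emeasure_bounded_finite[of C] unfolding FP(4)[OF C(1)]
      by (subst mult_divide_eq_ennreal) auto
    also have "\<dots> \<le> ?SM x" using C' C by (intro strong_maximal_ge_average \<nu>) auto
    finally show ?thesis .
  qed
  (* The maximal function dominates the sum over all heights, not only the largest term: the
     increments 2^0 a, ..., 2^(k-1) a add up to less than 2^k a. *)
  have pointwise: "(\<Sum>i<k. ennreal (2 ^ i * a) * indicator (\<Omega> (Suc i)) x) \<le> ?SM x \<and>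
    (\<Sum>i<k. ennreal (2 ^ i * a) * indicator (\<Omega> (Suc i)) x) \<le> ennreal (2 ^ k * a)" for k x
  proof (induction k)
    case (Suc k)
    let ?s = "\<Sum>i<k. ennreal (2 ^ i * a) * indicator (\<Omega> (Suc i)) x"
    have dbl: "ennreal (2 ^ k * a) + ennreal (2 ^ k * a) = ennreal (2 ^ Suc k * a)"
      using a by (simp add: ennreal_plus[symmetric] del: ennreal_plus)
    show ?case
    proof (cases "x \<in> \<Omega> (Suc k)")
      case True
      have "?s + ennreal (2 ^ k * a) \<le> ennreal (2 ^ Suc k * a)"
        using add_right_mono[of ?s "ennreal (2 ^ k * a)" "ennreal (2 ^ k * a)"] Suc by (simp only: dbl)
      thus ?thesis using SM[OF True] True by (auto intro: order_trans)
    next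
      case False
      have "ennreal (2 ^ k * a) \<le> ennreal (2 ^ Suc k * a)" using a by (intro ennreal_leI) simp
      thus ?thesis using Suc False by (auto intro: order_trans)
    qed
  qed simp
  have "ennreal (\<Sum>i<m. measure ?M (\<Omega> (Suc i)) / 2) = (\<Sum>i<m. ennreal (2 ^ i * a) * emeasure lborel (\<Omega> (Suc i)))"
    unfolding \<Omega>eq fin(2)[OF \<Omega>J \<Omega>b] using a by (simp add: ennreal_mult[symmetric] sum_ennreal mult.assoc)
  also have "\<dots> = (\<integral>\<^sup>+x. (\<Sum>i<m. ennreal (2 ^ i * a) * indicator (\<Omega> (Suc i)) x) \<partial>lebesgue)"
    using \<Omega>l by (subst nn_integral_sum) (auto simp: nn_integral_cmult_indicator \<Omega>b
        intro!: sum.cong borel_measurable_times_ennreal borel_measurable_indicator)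
  also have "\<dots> \<le> (\<integral>\<^sup>+t\<in>J. ?SM t \<partial>lebesgue)"
  proof (intro nn_integral_mono)
    fix x
    show "(\<Sum>i<m. ennreal (2 ^ i * a) * indicator (\<Omega> (Suc i)) x) \<le> ?SM x * indicator J x"
    proof (cases "x \<in> J")
      case True thus ?thesis using pointwise[of x m] by simp
    next
      case False
      hence "x \<notin> \<Omega> i" for i using \<Omega>J by blast
      thus ?thesis by simp
    qed
  qed
  also have "\<dots> \<le> ennreal Q * emeasure ?M J"
    by (rule fujii_wilson_integral_le[OF \<nu>(1) Q J])
  also have "\<dots> = ennreal (Q * measure ?M J)" using MJ m by (simp add: ennreal_mult)
  finally have "(\<Sum>i<m. measure ?M (\<Omega> (Suc i)) / 2) \<le> Q * measure ?M J"
    using m MJ by (subst (asm) ennreal_le_iff) auto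
  moreover have "(\<Sum>i<m. measure ?M (\<Omega> K) / 2 / 2) \<le> (\<Sum>i<m. measure ?M (\<Omega> (Suc i)) / 2)"
    using half by (intro sum_mono divide_right_mono) auto
  moreover have "8 * Q * measure ?M J \<le> m * measure ?M J" using m MJ by (intro mult_right_mono) auto
  ultimately have "real m * (2 * measure ?M (\<Omega> K)) \<le> real m * measure ?M J" by simp
  hence "2 * measure ?M (\<Omega> K) \<le> measure ?M J" using m by simp
  hence small: "emeasure ?M (\<Omega> K) \<le> ennreal (1/2) * emeasure ?M J"
    unfolding fin[OF \<Omega>J \<Omega>b] MJ by (simp add: ennreal_mult[symmetric] ennreal_le_iff del: ennreal_half)
  have lK: "l = 2 ^ K * a" by (simp add: l_def K_def a_def)
  show thesis
    using small FP(1,2) FP(3)[where i = K] FP(4)[where i = K] FP(5)[where i = K] unfolding \<Omega>_def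
    by (intro that[of "\<F> K"]) (auto simp: lK)
qed


text \<open>The stopping intervals of the previous lemma are intervals on which the average of \<open>\<nu>\<close> is
  exactly \<open>l\<close>, so the construction can be repeated inside each of them.\<close>

lemma stopping_set_mass_decay:
  fixes \<nu> :: "real \<Rightarrow> real"
  assumes \<nu>: "\<nu> \<in> borel_measurable borel" "\<And>x. 0 \<le> \<nu> x"
    and Q: "fujii_wilson \<nu> \<le> ennreal Q" and m: "8 * Q \<le> real m" "0 \<le> Q" "0 < m"
    and fin: "\<And>J. bounded J \<Longrightarrow> emeasure (weighted \<nu>) J < \<infinity>"
    and J: "is_interval J" "bounded J" "J \<in> sets borel"
  shows "\<exists>\<Omega>\<in>sets borel. \<Omega> \<subseteq> J \<and> emeasure (weighted \<nu>) \<Omega> \<le> ennreal ((1/2) ^ k) * emeasure (weighted \<nu>) J \<and>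
    (\<forall>B\<in>sets borel. B \<subseteq> J - \<Omega> \<longrightarrow> emeasure (weighted \<nu>) B \<le>
       ennreal ((2 ^ Suc m) ^ k * (measure (weighted \<nu>) J / measure lborel J)) * emeasure lborel B)"
  using J
proof (induction k arbitrary: J)
  case 0
  thus ?case by (intro bexI[of _ J]) auto
next
  case (Suc k J)
  let ?M = "weighted \<nu>" let ?\<Lambda> = "2 ^ Suc m :: real"
  show ?case
  proof (cases "emeasure ?M J = 0")
    case True
    thus ?thesis using Suc.prems by (intro bexI[of _ J]) auto
  next
    case False
    hence pos: "0 < emeasure ?M J" by (simp add: zero_less_iff_neq_zero)
    define l where "l = 2 ^ Suc m * (measure ?M J / measure lborel J)"
    have l: "0 \<le> l" by (simp add: l_def)
    obtain \<G> where G: "countable \<G>" "disjoint \<G>"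
      "\<And>C. C \<in> \<G> \<Longrightarrow> is_interval C \<and> C \<subseteq> J \<and> C \<in> sets borel \<and> bounded C \<and> 0 < emeasure lborel C"
      "\<And>C. C \<in> \<G> \<Longrightarrow> emeasure ?M C = ennreal l * emeasure lborel C"
      "\<And>B. B \<in> sets borel \<Longrightarrow> B \<subseteq> J - \<Union>\<G> \<Longrightarrow> emeasure ?M B \<le> ennreal l * emeasure lborel B"
      "emeasure ?M (\<Union>\<G>) \<le> ennreal (1/2) * emeasure ?M J"
      using stopping_set_halves_mass[OF \<nu> Q m Suc.prems pos fin[OF Suc.prems(2)], folded l_def] by blast
    have avg: "measure ?M C / measure lborel C = l" if "C \<in> \<G>" for C
    proof -
      have "0 < measure lborel C"
        using G(3)[OF that] emeasure_bounded_finite[of C] by (auto simp: measure_pos_iff)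
      moreover have "measure ?M C = l * measure lborel C"
        using G(4)[OF that] l by (simp add: measure_def enn2real_mult)
      ultimately show ?thesis by simp
    qed
    define P where "P C \<Omega> \<longleftrightarrow> \<Omega> \<in> sets borel \<and> \<Omega> \<subseteq> C \<and> emeasure ?M \<Omega> \<le> ennreal ((1/2) ^ k) * emeasure ?M C \<and>
      (\<forall>B\<in>sets borel. B \<subseteq> C - \<Omega> \<longrightarrow> emeasure ?M B \<le> ennreal (?\<Lambda> ^ k * l) * emeasure lborel B)" for C \<Omega>
    have "\<exists>\<Omega>. P C \<Omega>" if "C \<in> \<G>" for C
      using Suc.IH[of C] G(3)[OF that] unfolding avg[OF that] P_def by blast
    then obtain \<Omega> where \<Omega>: "\<And>C. C \<in> \<G> \<Longrightarrow> P C (\<Omega> C)" by metis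
    have \<Omega>b: "\<Omega> C \<in> sets borel" and \<Omega>C: "\<Omega> C \<subseteq> C"
      and \<Omega>M: "emeasure ?M (\<Omega> C) \<le> ennreal ((1/2) ^ k) * emeasure ?M C"
      and \<Omega>r: "B \<in> sets borel \<Longrightarrow> B \<subseteq> C - \<Omega> C \<Longrightarrow> emeasure ?M B \<le> ennreal (?\<Lambda> ^ k * l) * emeasure lborel B"
      if "C \<in> \<G>" for C B
      using \<Omega>[OF that] unfolding P_def by blast+
    define U where "U = (\<Union>C\<in>\<G>. \<Omega> C)"
    have Ub: "U \<in> sets borel" unfolding U_def using G(1) \<Omega>b by (intro sets.countable_UN') auto
    have UJ: "U \<subseteq> J" unfolding U_def using \<Omega>C G(3) by blast
    have dis: "disjoint_family_on \<Omega> \<G>"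
      using G(2) \<Omega>C unfolding disjoint_family_on_def pairwise_def disjnt_def by blast
    have "emeasure ?M U = (\<integral>\<^sup>+C. emeasure ?M (\<Omega> C) \<partial>count_space \<G>)"
      unfolding U_def using \<Omega>b dis G(1) by (intro emeasure_UN_countable) auto
    also have "\<dots> \<le> (\<integral>\<^sup>+C. ennreal ((1/2) ^ k) * emeasure ?M C \<partial>count_space \<G>)"
      using \<Omega>M by (intro nn_integral_mono) auto
    also have "\<dots> = ennreal ((1/2) ^ k) * emeasure ?M (\<Union>\<G>)"
      using G by (subst emeasure_disjoint_Union) (auto simp: nn_integral_cmult)
    also have "\<dots> \<le> ennreal ((1/2) ^ k) * (ennreal (1/2) * emeasure ?M J)"
      using G(6) by (intro mult_left_mono) auto
    also have "\<dots> = ennreal ((1/2) ^ Suc k) * emeasure ?M J"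
      by (simp add: mult.assoc[symmetric] ennreal_mult[symmetric] mult.commute del: ennreal_half)
    finally have MU: "emeasure ?M U \<le> ennreal ((1/2) ^ Suc k) * emeasure ?M J" .
    have rest: "emeasure ?M B \<le> ennreal (?\<Lambda> ^ k * l) * emeasure lborel B"
      if B: "B \<in> sets borel" "B \<subseteq> J - U" for B
    proof -
      let ?B1 = "B - \<Union>\<G>" and ?B2 = "\<Union>((\<lambda>C. B \<inter> C) ` \<G>)"
      have GU: "\<Union>\<G> \<in> sets borel" using G by (intro sets.countable_Union) auto
      have b1: "?B1 \<in> sets borel" using B GU by auto
      have b2: "?B2 \<in> sets borel" using B G(1,3) by (intro sets.countable_UN') auto
      have "1 \<le> ?\<Lambda> ^ k" by (intro one_le_power) simp
      hence "l \<le> ?\<Lambda> ^ k * l" using l mult_right_mono[of 1 "?\<Lambda> ^ k" l] by simp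
      hence "emeasure ?M ?B1 \<le> ennreal (?\<Lambda> ^ k * l) * emeasure lborel ?B1"
        using b1 B by (intro order_trans[OF G(5)] mult_right_mono ennreal_leI) auto
      moreover have "emeasure ?M ?B2 \<le> ennreal (?\<Lambda> ^ k * l) * emeasure lborel ?B2"
      proof (rule emeasure_Union_le_cmult)
        show "disjoint ((\<lambda>C. B \<inter> C) ` \<G>)" using G(2) unfolding pairwise_def disjnt_def by blast
        fix D assume "D \<in> (\<lambda>C. B \<inter> C) ` \<G>"
        then obtain C where C: "C \<in> \<G>" "D = B \<inter> C" by blast
        have "D \<subseteq> C - \<Omega> C" using B C unfolding U_def by blast
        moreover show "D \<in> sets borel" using C B G(3) by auto
        ultimately show "emeasure ?M D \<le> ennreal (?\<Lambda> ^ k * l) * emeasure lborel D"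
          by (intro \<Omega>r[OF C(1)])
      qed (use G(1) in auto)
      moreover have "B = ?B1 \<union> ?B2" "?B1 \<inter> ?B2 = {}" by auto
      hence "emeasure ?M B = emeasure ?M ?B1 + emeasure ?M ?B2"
        "emeasure lborel B = emeasure lborel ?B1 + emeasure lborel ?B2"
        using plus_emeasure[of ?B1 ?M ?B2] plus_emeasure[of ?B1 lborel ?B2] b1 b2 by auto
      ultimately show ?thesis by (simp add: distrib_left add_mono)
    qed
    have "?\<Lambda> ^ k * l = ?\<Lambda> ^ Suc k * (measure ?M J / measure lborel J)" by (simp add: l_def)
    thus ?thesis using Ub UJ MU rest by (intro bexI[of _ U]) auto
  qed
qed

text \<open>The two summands are balanced when \<open>2^((m + 2) * k)\<close> is about \<open>1 / s\<close>.\<close>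

lemma dyadic_exponent:
  fixes s :: real and m :: nat
  assumes s: "0 < s" "s \<le> 1"
  obtains k where "(2 ^ Suc m) ^ k * s + (1/2) ^ k \<le> 4 * s powr (1 / (real m + 2))"
proof -
  define u where "u = - log 2 s"
  have u: "0 \<le> u" using s by (simp add: u_def log_le_zero_cancel_iff)
  have s2: "s = 2 powr (- u)" using s by (simp add: u_def)
  define k where "k = nat \<lfloor>u / (real m + 2)\<rfloor>"
  have "0 \<le> u / (real m + 2)" using u by simp
  hence k: "real k \<le> u / (real m + 2)" "u / (real m + 2) < real k + 1"
    unfolding k_def by linarith+
  have "real k * (real m + 2) \<le> u" using k(1) by (simp add: field_simps)
  hence ku: "real k * (real m + 1) - u \<le> - real k" by (simp add: algebra_simps)
  have "(2 ^ Suc m) ^ k = (2::real) powr (real k * (real m + 1))"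
    using powr_realpow[of 2 "Suc m * k"] by (simp only: power_mult) (simp add: algebra_simps)
  hence "(2 ^ Suc m) ^ k * s = 2 powr (real k * (real m + 1) - u)"
    by (simp only: s2 powr_add[symmetric]) simp
  also have "\<dots> \<le> 2 powr (- real k)" using ku by simp
  also have "\<dots> = (1/2) ^ k" by (simp add: powr_minus_divide powr_realpow power_one_over)
  finally have 1: "(2 ^ Suc m) ^ k * s + (1/2) ^ k \<le> 2 * (1/2) ^ k" by simp
  have "(1/2) ^ k = 2 powr (- real k)" by (simp add: powr_minus_divide powr_realpow power_one_over)
  also have "\<dots> \<le> 2 powr (1 - u / (real m + 2))" using k(2) by simp
  also have "\<dots> = 2 * 2 powr (- u * (1 / (real m + 2)))"
    by (simp add: powr_diff powr_minus_divide)
  also have "2 powr (- u * (1 / (real m + 2))) = s powr (1 / (real m + 2))"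
    by (subst s2) (simp add: powr_powr)
  finally show thesis using 1 that[of k] by simp
qed

text \<open>Split \<open>A\<close> into its part in the stopping set of generation \<open>k\<close>, whose mass is at most
  \<open>(1/2)^k\<close> of that of \<open>J\<close>, and the rest, where \<open>\<nu>\<close> is at most \<open>(2^(m + 1))^k\<close> times its average;
  then optimise in \<open>k\<close>. Since \<open>m\<close> can be taken comparable to \<open>Q\<close>, the exponent is of order \<open>1 / Q\<close>.\<close>

lemma A_infinity_power_bound:
  fixes \<nu> :: "real \<Rightarrow> real"
  assumes \<nu>: "\<nu> \<in> borel_measurable borel" "\<And>x. 0 \<le> \<nu> x"
    and Q: "fujii_wilson \<nu> \<le> ennreal Q" and m: "8 * Q \<le> real m" "0 \<le> Q" "0 < m"
    and fin: "\<And>J. bounded J \<Longrightarrow> emeasure (weighted \<nu>) J < \<infinity>"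
    and J: "is_interval J" "bounded J" "J \<in> sets borel"
    and A: "A \<in> sets borel" "A \<subseteq> J" "emeasure lborel A \<le> ennreal s * emeasure lborel J" and s: "0 < s" "s \<le> 1"
  shows "emeasure (weighted \<nu>) A \<le> ennreal (4 * s powr (1 / (real m + 2))) * emeasure (weighted \<nu>) J"
proof -
  let ?M = "weighted \<nu>" let ?\<Lambda> = "2 ^ Suc m :: real"
  obtain k where k: "?\<Lambda> ^ k * s + (1/2) ^ k \<le> 4 * s powr (1 / (real m + 2))"
    using dyadic_exponent[OF s] by blast
  obtain \<Omega> where \<Omega>: "\<Omega> \<in> sets borel" "\<Omega> \<subseteq> J" "emeasure ?M \<Omega> \<le> ennreal ((1/2) ^ k) * emeasure ?M J"
    "\<And>B. B \<in> sets borel \<Longrightarrow> B \<subseteq> J - \<Omega> \<Longrightarrow> emeasure ?M B \<le>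
       ennreal (?\<Lambda> ^ k * (measure ?M J / measure lborel J)) * emeasure lborel B"
    using stopping_set_mass_decay[OF \<nu> Q m fin J, of k] by blast
  have fM: "emeasure ?M J = ennreal (measure ?M J)"
    using fin[OF J(2)] by (intro emeasure_eq_ennreal_measure) auto
  have fL: "emeasure lborel J = ennreal (measure lborel J)"
    using emeasure_bounded_finite[OF J(2)] by (intro emeasure_eq_ennreal_measure) auto
  define a where "a = measure ?M J / measure lborel J"
  have a: "0 \<le> a" "a * measure lborel J \<le> measure ?M J" by (auto simp: a_def)
  have "emeasure ?M (A - \<Omega>) \<le> ennreal (?\<Lambda> ^ k * a) * emeasure lborel (A - \<Omega>)"
    unfolding a_def using A \<Omega> by (intro \<Omega>(4)) auto
  also have "\<dots> \<le> ennreal (?\<Lambda> ^ k * a) * emeasure lborel A"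
    using A by (intro mult_left_mono emeasure_mono) auto
  also have "\<dots> \<le> ennreal (?\<Lambda> ^ k * a) * (ennreal s * emeasure lborel J)"
    by (intro mult_left_mono A) auto
  also have "\<dots> = ennreal (?\<Lambda> ^ k * s * (a * measure lborel J))"
    using a s by (simp add: fL ennreal_mult[symmetric] mult.assoc mult.left_commute mult.commute)
  also have "\<dots> \<le> ennreal (?\<Lambda> ^ k * s * measure ?M J)"
    using a s by (intro ennreal_leI mult_left_mono) auto
  finally have 1: "emeasure ?M (A - \<Omega>) \<le> ennreal (?\<Lambda> ^ k * s * measure ?M J)" .
  have "emeasure ?M A \<le> emeasure ?M ((A - \<Omega>) \<union> \<Omega>)" using A \<Omega> by (intro emeasure_mono) auto
  also have "\<dots> \<le> emeasure ?M (A - \<Omega>) + emeasure ?M \<Omega>" using A \<Omega> by (intro emeasure_subadditive) auto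
  also have "\<dots> \<le> ennreal (?\<Lambda> ^ k * s * measure ?M J) + ennreal ((1/2) ^ k) * emeasure ?M J"
    by (intro add_mono 1 \<Omega>)
  also have "\<dots> = ennreal ((?\<Lambda> ^ k * s + (1/2) ^ k) * measure ?M J)"
    using s by (simp add: fM ennreal_mult[symmetric] ennreal_plus[symmetric] distrib_right del: ennreal_plus ennreal_half)
  also have "\<dots> \<le> ennreal (4 * s powr (1 / (real m + 2)) * measure ?M J)"
    using k by (intro ennreal_leI mult_right_mono) auto
  also have "\<dots> = ennreal (4 * s powr (1 / (real m + 2))) * emeasure ?M J"
    by (simp add: fM ennreal_mult)
  finally show ?thesis .
qed

section \<open>The Solyanik estimate on the line\<close>

text \<open>If three intervals of a subfamily of least cardinality had a common point, then the one that
  extends furthest to the left and the one that extends furthest to the right would cover the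
  third, which could be removed.\<close>

lemma minimal_interval_cover:
  fixes \<I> :: "real set set"
  assumes fin: "finite \<I>" and int: "\<And>I. I \<in> \<I> \<Longrightarrow> \<exists>a b. I = {a<..<b}"
  obtains \<J> where "\<J> \<subseteq> \<I>" "\<Union>\<J> = \<Union>\<I>" "\<And>x. card {I \<in> \<J>. x \<in> I} \<le> 2"
proof -
  let ?P = "\<lambda>\<J>. \<J> \<subseteq> \<I> \<and> \<Union>\<J> = \<Union>\<I>"
  obtain \<J> where J: "?P \<J>" and least: "\<And>\<K>. ?P \<K> \<Longrightarrow> card \<J> \<le> card \<K>"
    using ex_has_least_nat[of ?P \<I> card] by auto
  have finJ: "finite \<J>" using J fin finite_subset by blast
  have "card {I \<in> \<J>. x \<in> I} \<le> 2" for x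
  proof (rule ccontr)
    define S where "S = {I \<in> \<J>. x \<in> I}"
    assume "\<not> card {I \<in> \<J>. x \<in> I} \<le> 2"
    hence c: "2 < card S" by (simp add: S_def)
    hence S: "finite S" "S \<noteq> {}" by (auto intro: card_ge_0_finite)
    have "Min (Inf ` S) \<in> Inf ` S" "Max (Sup ` S) \<in> Sup ` S" using S by (auto intro!: Min_in Max_in)
    then obtain L R where L: "L \<in> S" "Inf L = Min (Inf ` S)" and R: "R \<in> S" "Sup R = Max (Sup ` S)"
      by (metis imageE)
    have "\<not> S \<subseteq> {L, R}"
    proof
      assume "S \<subseteq> {L, R}"
      hence "card S \<le> card {L, R}" by (intro card_mono) auto
      also have "\<dots> \<le> 2" by (simp add: card_insert_if)
      finally show False using c by simp
    qed
    then obtain K where K: "K \<in> S" "K \<noteq> L" "K \<noteq> R" by blast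
    have oi: "\<exists>a b. I = {a<..<b} \<and> a < x \<and> x < b \<and> Inf I = a \<and> Sup I = b" if "I \<in> S" for I
    proof -
      have "I \<in> \<I>" using that J unfolding S_def by blast
      then obtain a b where "I = {a<..<b}" using int by blast
      moreover have "x \<in> I" using that by (simp add: S_def)
      ultimately show ?thesis by auto
    qed
    have "K \<subseteq> L \<union> R"
    proof -
      have "Inf L \<le> Inf K" "Sup K \<le> Sup R" using L R K S by auto
      moreover obtain a b a' b' a'' b'' where "L = {a<..<b}" "x < b" "Inf L = a"
        "R = {a'<..<b'}" "a' < x" "Sup R = b'" "K = {a''<..<b''}" "Inf K = a''" "Sup K = b''"
        using oi[OF L(1)] oi[OF R(1)] oi[OF K(1)] by blast
      ultimately show ?thesis by (auto simp: not_less)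
    qed
    hence "\<Union>(\<J> - {K}) = \<Union>\<J>" using L R K unfolding S_def by blast
    hence "?P (\<J> - {K})" using J by auto
    hence "card \<J> \<le> card (\<J> - {K})" by (rule least)
    moreover have "K \<in> \<J>" using K by (simp add: S_def)
    ultimately show False using finJ by (meson card_Diff1_less leD)
  qed
  thus thesis using that J by blast
qed

lemma sum_emeasure_le_overlap:
  assumes "finite \<J>" "\<And>I. I \<in> \<J> \<Longrightarrow> I \<in> sets M" "\<And>x. card {I \<in> \<J>. x \<in> I} \<le> N"
  shows "(\<Sum>I\<in>\<J>. emeasure M I) \<le> of_nat N * emeasure M (\<Union>\<J>)"
proof -
  have U: "\<Union>\<J> \<in> sets M" using assms by (intro sets.finite_Union) auto
  have "(\<Sum>I\<in>\<J>. emeasure M I) = (\<integral>\<^sup>+x. (\<Sum>I\<in>\<J>. indicator I x) \<partial>M)"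
    using assms by (subst nn_integral_sum) auto
  also have "\<dots> \<le> (\<integral>\<^sup>+x. of_nat N * indicator (\<Union>\<J>) x \<partial>M)"
  proof (intro nn_integral_mono)
    fix x
    have "(\<Sum>I\<in>\<J>. indicator I x :: ennreal) = of_nat (card {I \<in> \<J>. x \<in> I})"
      using assms(1) by (simp add: indicator_def of_bool_def sum.If_cases Int_def)
    also have "\<dots> \<le> of_nat N * indicator (\<Union>\<J>) x"
    proof (cases "x \<in> \<Union>\<J>")
      case True thus ?thesis using assms(3)[of x] by simp
    next
      case False
      hence "{I \<in> \<J>. x \<in> I} = {}" by blast
      hence "card {I \<in> \<J>. x \<in> I} = 0" by (simp only: card.empty)
      thus ?thesis by (simp only:) simp
    qed
    finally show "(\<Sum>I\<in>\<J>. indicator I x :: ennreal) \<le> of_nat N * indicator (\<Union>\<J>) x" .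
  qed
  also have "\<dots> = of_nat N * emeasure M (\<Union>\<J>)" using U by (simp add: nn_integral_cmult_indicator)
  finally show ?thesis .
qed

text \<open>The parameter \<open>d\<close> is the proportion that may be missing, so up to the choice of end points this
  is where the maximal function of the indicator of \<open>E\<close> exceeds \<open>1 - d\<close>. Rational end points keep
  the family countable, which gives measurability in all variables later on.\<close>

definition interval_halo :: "real \<Rightarrow> real set \<Rightarrow> real set" where
  "interval_halo d E = \<Union>{I. \<exists>a\<in>\<rat>. \<exists>b\<in>\<rat>. a < b \<and> I = {a<..<b} \<and> emeasure lborel (I - E) < ennreal (d * (b - a))}"

lemma absorb_small_multiple:
  fixes u e c :: real
  assumes "u \<le> e + 2 * c * u" "0 \<le> c" "c \<le> 1/4" "0 \<le> u" "0 \<le> e"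
  shows "u \<le> (1 + 4 * c) * e"
proof -
  have "(1 - 2 * c) * u \<le> e" using assms by (simp add: algebra_simps)
  hence "(1 + 4 * c) * ((1 - 2 * c) * u) \<le> (1 + 4 * c) * e" using assms by (intro mult_left_mono) auto
  moreover have "0 \<le> 2 * c * (1 - 4 * c) * u" using assms by simp
  moreover have "(1 + 4 * c) * ((1 - 2 * c) * u) = u + 2 * c * (1 - 4 * c) * u" by algebra
  ultimately show ?thesis by linarith
qed

text \<open>For finitely many intervals with overlap at most two, the mass of the union \<open>U\<close> outside \<open>E\<close> is
  at most \<open>c\<close> times the sum of the masses of the intervals, hence at most \<open>2 * c\<close> times the mass of
  \<open>U\<close>. That mass is finite, so the term can be absorbed on the left.\<close>

lemma interval_halo_estimate:
  fixes M :: "real measure"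
  assumes M: "sets M = sets borel" "\<And>J. bounded J \<Longrightarrow> emeasure M J < \<infinity>"
    and E: "E \<in> sets borel" and c: "0 \<le> c" "c \<le> 1/4"
    and small: "\<And>a b A. a < b \<Longrightarrow> A \<in> sets borel \<Longrightarrow> A \<subseteq> {a<..<b} \<Longrightarrow>
      emeasure lborel A \<le> ennreal (d * (b - a)) \<Longrightarrow> emeasure M A \<le> ennreal c * emeasure M {a<..<b}"
  shows "emeasure M (interval_halo d E) \<le> ennreal (1 + 4 * c) * emeasure M E"
proof (cases "emeasure M E = \<infinity>")
  case True
  have "1 + 4 * c > 0" using c by simp
  thus ?thesis using True by (simp add: ennreal_mult_top)
next
  case False
  define \<I> where "\<I> = {I. \<exists>a\<in>\<rat>. \<exists>b\<in>\<rat>. a < b \<and> I = {a<..<b} \<and> emeasure lborel (I - E) < ennreal (d * (b - a))}"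
  have finite_case: "emeasure M (\<Union>\<K>) \<le> ennreal (1 + 4 * c) * emeasure M E" if K: "finite \<K>" "\<K> \<subseteq> \<I>" for \<K>
  proof -
    have "\<exists>a b. I = {a<..<b}" if "I \<in> \<K>" for I using that K unfolding \<I>_def by blast
    then obtain \<J> where J: "\<J> \<subseteq> \<K>" "\<Union>\<J> = \<Union>\<K>" "\<And>x. card {I \<in> \<J>. x \<in> I} \<le> 2"
      using minimal_interval_cover[OF K(1)] by blast
    have fJ: "finite \<J>" using J(1) K(1) by (rule finite_subset)
    have I: "I \<in> sets borel" "emeasure M (I - E) \<le> ennreal c * emeasure M I" "bounded I" if "I \<in> \<J>" for I
    proof -
      have "I \<in> \<I>" using that J(1) K(2) by blast
      then obtain a b where ab: "a < b" "I = {a<..<b}" "emeasure lborel (I - E) < ennreal (d * (b - a))"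
        unfolding \<I>_def by blast
      show "I \<in> sets borel" "bounded I" using ab by auto
      show "emeasure M (I - E) \<le> ennreal c * emeasure M I"
        using ab E by (auto intro!: small simp: less_imp_le)
    qed
    have UK: "\<Union>\<J> \<in> sets borel" using I(1) fJ by (intro sets.finite_Union) auto
    have "bounded (\<Union>\<J>)" using I(3) fJ by (intro bounded_Union) auto
    hence fU: "emeasure M (\<Union>\<J>) = ennreal (measure M (\<Union>\<J>))"
      using M(2)[of "\<Union>\<J>"] by (intro emeasure_eq_ennreal_measure) auto
    have fE: "emeasure M E = ennreal (measure M E)" using False by (intro emeasure_eq_ennreal_measure) auto
    have D: "(\<Union>I\<in>\<J>. I - E) \<in> sets M" using E I(1) fJ M(1) by (intro sets.finite_UN) auto
    have "emeasure M (\<Union>\<J>) \<le> emeasure M (E \<union> (\<Union>I\<in>\<J>. I - E))"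
      using E D M(1) by (intro emeasure_mono sets.Un) auto
    also have "\<dots> \<le> emeasure M E + emeasure M (\<Union>I\<in>\<J>. I - E)"
      using E D M(1) by (intro emeasure_subadditive) auto
    also have "emeasure M (\<Union>I\<in>\<J>. I - E) \<le> (\<Sum>I\<in>\<J>. emeasure M (I - E))"
      using E I(1) fJ M(1) by (intro emeasure_subadditive_finite) auto
    also have "\<dots> \<le> (\<Sum>I\<in>\<J>. ennreal c * emeasure M I)" using I(2) by (intro sum_mono) auto
    also have "\<dots> = ennreal c * (\<Sum>I\<in>\<J>. emeasure M I)" by (simp add: sum_distrib_left)
    also have "\<dots> \<le> ennreal c * (of_nat 2 * emeasure M (\<Union>\<J>))"
      using I(1) M(1) J(3) by (intro mult_left_mono sum_emeasure_le_overlap fJ) auto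
    finally have "emeasure M (\<Union>\<J>) \<le> emeasure M E + ennreal c * (of_nat 2 * emeasure M (\<Union>\<J>))"
      by (simp add: add_left_mono)
    also have "\<dots> = ennreal (measure M E + 2 * c * measure M (\<Union>\<J>))"
    proof -
      have "of_nat 2 * ennreal (measure M (\<Union>\<J>)) = ennreal (2 * measure M (\<Union>\<J>))"
        by (subst ennreal_mult) auto
      thus ?thesis using c unfolding fE fU by (simp add: ennreal_mult[symmetric] ennreal_plus[symmetric] ac_simps del: ennreal_plus)
    qed
    finally have "measure M (\<Union>\<J>) \<le> measure M E + 2 * c * measure M (\<Union>\<J>)"
      using c unfolding fU by (subst (asm) ennreal_le_iff) auto
    hence "measure M (\<Union>\<J>) \<le> (1 + 4 * c) * measure M E" using c by (intro absorb_small_multiple) auto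
    hence "emeasure M (\<Union>\<J>) \<le> ennreal (1 + 4 * c) * emeasure M E"
      unfolding fU fE using c by (subst ennreal_mult[symmetric]) (auto intro: ennreal_leI)
    thus ?thesis by (simp only: J(2))
  qed
  show ?thesis
  proof (cases "\<I> = {}")
    case True thus ?thesis unfolding interval_halo_def \<I>_def[symmetric] by simp
  next
    case ne: False
    have "\<I> \<subseteq> (\<lambda>(a, b). {a<..<b}) ` (\<rat> \<times> \<rat>)" unfolding \<I>_def by auto
    hence cI: "countable \<I>" using countable_rat by (meson countable_SIGMA countable_image countable_subset)
    define f where "f = from_nat_into \<I>"
    have f: "range f = \<I>" unfolding f_def by (rule range_from_nat_into[OF ne cI])
    define U where "U n = \<Union>(f ` {..<n})" for n
    have "f i \<in> sets borel" for i
    proof -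
      have "f i \<in> \<I>" using f by blast
      thus ?thesis unfolding \<I>_def by auto
    qed
    hence Ub: "range U \<subseteq> sets M" using M(1) by (auto simp: U_def)
    have "interval_halo d E = (\<Union>n. U n)"
    proof -
      have "x \<in> (\<Union>n. U n)" if "x \<in> f i" for x i
      proof -
        have "x \<in> U (Suc i)" using that by (auto simp: U_def)
        thus ?thesis by blast
      qed
      hence "(\<Union>n. U n) = \<Union>(range f)" unfolding U_def by auto
      thus ?thesis by (simp add: f interval_halo_def \<I>_def)
    qed
    moreover have "incseq U" unfolding U_def by (intro monoI Union_mono image_mono) auto
    ultimately have "emeasure M (interval_halo d E) = (SUP n. emeasure M (U n))"
      using SUP_emeasure_incseq[OF Ub] by simp
    also have "\<dots> \<le> ennreal (1 + 4 * c) * emeasure M E"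
      unfolding U_def using f by (intro SUP_least finite_case) auto
    finally show ?thesis .
  qed
qed

lemma interval_halo_solyanik:
  fixes \<nu> :: "real \<Rightarrow> real"
  assumes \<nu>: "\<nu> \<in> borel_measurable borel" "\<And>x. 0 \<le> \<nu> x"
    and Q: "fujii_wilson \<nu> \<le> ennreal Q" and m: "8 * Q \<le> real m" "0 \<le> Q" "0 < m"
    and fin: "\<And>J. bounded J \<Longrightarrow> emeasure (weighted \<nu>) J < \<infinity>"
    and d: "0 < d" "d \<le> 1" "16 * d powr (1 / (real m + 2)) \<le> 1" and E: "E \<in> sets borel"
  shows "emeasure (weighted \<nu>) (interval_halo d E) \<le> ennreal (1 + 16 * d powr (1 / (real m + 2))) * emeasure (weighted \<nu>) E"
proof -
  have "emeasure (weighted \<nu>) (interval_halo d E) \<le> ennreal (1 + 4 * (4 * d powr (1 / (real m + 2)))) * emeasure (weighted \<nu>) E"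
  proof (rule interval_halo_estimate)
    fix a b :: real and A assume A: "a < b" "A \<in> sets borel" "A \<subseteq> {a<..<b}" "emeasure lborel A \<le> ennreal (d * (b - a))"
    have "emeasure lborel A \<le> ennreal d * emeasure lborel {a<..<b}"
      using A d by (simp add: ennreal_mult[symmetric])
    thus "emeasure (weighted \<nu>) A \<le> ennreal (4 * d powr (1 / (real m + 2))) * emeasure (weighted \<nu>) {a<..<b}"
      using A_infinity_power_bound[OF \<nu> Q m fin _ _ _ A(2,3) _ d(1,2)] by (auto simp: is_interval_oo)
  qed (use d E fin in auto)
  thus ?thesis by simp
qed

section \<open>Halos in one coordinate direction\<close>

definition set_coord :: "real ^ 'n \<Rightarrow> 'n \<Rightarrow> real \<Rightarrow> real ^ 'n" where
  "set_coord x j t = (\<chi> i. if i = j then t else x $ i)"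

lemma set_coord_nth [simp]: "set_coord x j t $ i = (if i = j then t else x $ i)"
  by (simp add: set_coord_def)

lemma borel_measurable_vecI:
  assumes "\<And>i. (\<lambda>x. f x $ i) \<in> borel_measurable N"
  shows "(f :: 'b \<Rightarrow> real ^ 'n) \<in> borel_measurable N"
  unfolding borel_measurable_euclidean_space[of f]
  using assms by (auto simp: Basis_vec_def inner_axis)

lemma measurable_nth [measurable]: "(\<lambda>x :: real ^ 'n. x $ i) \<in> borel_measurable borel"
  by (intro borel_measurable_continuous_onI continuous_intros)

lemma measurable_set_coord: "(\<lambda>p. set_coord (fst p) j (snd p)) \<in> borel \<Otimes>\<^sub>M lborel \<rightarrow>\<^sub>M borel"
  by (intro borel_measurable_vecI) simp

lemma measurable_set_coord': "(\<lambda>t. set_coord x j t) \<in> borel_measurable borel"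
  by (intro borel_measurable_vecI) simp

lemma measurable_integral_set_coord:
  fixes f :: "real ^ 'n \<Rightarrow> ennreal"
  assumes f: "f \<in> borel_measurable borel" and g: "g \<in> borel_measurable borel"
  shows "(\<lambda>x. \<integral>\<^sup>+t. g t * f (set_coord x j t) \<partial>lborel :: ennreal) \<in> borel_measurable borel"
proof -
  have "(\<lambda>p. f (set_coord (fst p) j (snd p))) \<in> borel_measurable (borel \<Otimes>\<^sub>M lborel)"
    by (rule measurable_compose[OF measurable_set_coord f])
  moreover have "(\<lambda>p. g (snd p)) \<in> borel_measurable ((borel :: (real ^ 'n) measure) \<Otimes>\<^sub>M lborel)"
    using g by (intro measurable_compose[OF measurable_snd]) simp
  ultimately have "(\<lambda>(x, t). g t * f (set_coord x j t)) \<in> borel_measurable (borel \<Otimes>\<^sub>M lborel)"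
    by (simp add: case_prod_beta)
  thus ?thesis by (rule lborel.borel_measurable_nn_integral)
qed

lemma measurable_override:
  "(\<lambda>z. \<chi> i. if i \<in> S then z i else x $ i) \<in> PiM S (\<lambda>_. lborel) \<rightarrow>\<^sub>M (borel :: (real ^ 'n) measure)"
proof (intro borel_measurable_vecI)
  fix i
  have "(\<lambda>z. z i) \<in> PiM S (\<lambda>_. lborel) \<rightarrow>\<^sub>M (borel :: real measure)" if "i \<in> S"
    using measurable_component_singleton[OF that, of "\<lambda>_. lborel :: real measure"] by (simp add: measurable_lborel1)
  thus "(\<lambda>z. (\<chi> i. if i \<in> S then z i else x $ i) $ i) \<in> borel_measurable (PiM S (\<lambda>_. lborel))"
    by (cases "i \<in> S") auto
qed

lemma measurable_vec_lambda:
  "(\<lambda>z. \<chi> i. z i) \<in> PiM UNIV (\<lambda>_. lborel) \<rightarrow>\<^sub>M (borel :: (real ^ 'n) measure)"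
  using measurable_override[of UNIV] by simp

lemma prod_Basis_cart: "(\<Prod>e\<in>Basis. (b - a) \<bullet> e) = (\<Prod>i\<in>UNIV. b $ i - a $ i)"
  for a b :: "real ^ 'n"
proof -
  have "inj (\<lambda>i :: 'n. axis i (1 :: real))" by (auto simp: inj_on_def axis_eq_axis)
  thus ?thesis unfolding Basis_vec_def
    by (simp add: UNION_singleton_eq_range prod.reindex inner_axis)
qed

text \<open>This connects the product measures of the slices with Lebesgue measure on \<open>real ^ 'n\<close>.\<close>

lemma lborel_vec:
  "(lborel :: (real ^ 'n) measure) = distr (PiM UNIV (\<lambda>_. lborel)) borel (\<lambda>z. \<chi> i. z i)"
proof (rule lborel_eqI)
  interpret product_sigma_finite "\<lambda>_ :: 'n. lborel :: real measure" ..
  fix l u :: "real ^ 'n"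
  assume lu: "\<And>b. b \<in> Basis \<Longrightarrow> l \<bullet> b \<le> u \<bullet> b"
  have le: "l $ i \<le> u $ i" for i using lu[of "axis i 1"] by (auto simp: inner_axis)
  have "emeasure (distr (PiM UNIV (\<lambda>_. lborel)) borel (\<lambda>z. \<chi> i. z i)) (box l u) =
    emeasure (PiM UNIV (\<lambda>_. lborel)) (\<Pi>\<^sub>E i\<in>UNIV. {l $ i<..<u $ i})"
    by (subst emeasure_distr[OF measurable_vec_lambda])
       (auto simp: mem_box_cart space_PiM PiE_def Pi_def intro!: arg_cong[where f = "emeasure _"])
  also have "\<dots> = (\<Prod>i\<in>UNIV. ennreal (u $ i - l $ i))"
    using le by (subst emeasure_PiM) auto
  also have "\<dots> = ennreal (\<Prod>i\<in>UNIV. u $ i - l $ i)" using le by (subst prod_ennreal) auto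
  also have "(\<Prod>i\<in>UNIV. u $ i - l $ i) = (\<Prod>b\<in>Basis. (u - l) \<bullet> b)"
    by (rule prod_Basis_cart[symmetric])
  finally show "emeasure (distr (PiM UNIV (\<lambda>_. lborel)) borel (\<lambda>z. \<chi> i. z i)) (box l u) =
    ennreal (\<Prod>b\<in>Basis. (u - l) \<bullet> b)" .
qed simp

definition line_point :: "'n \<Rightarrow> ('n \<Rightarrow> real) \<Rightarrow> real \<Rightarrow> real ^ 'n" where
  "line_point j y t = (\<chi> i. if i = j then t else y i)"

lemma slice_eq_line_point: "slice w j y t = w (line_point j y t)"
  by (simp add: slice_def line_point_def)

lemma set_coord_line_point [simp]: "set_coord (line_point j y s) j t = line_point j y t"
  by (simp add: line_point_def vec_eq_iff)

lemma line_point_nth_same [simp]: "line_point j y t $ j = t"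
  by (simp add: line_point_def)

lemma measurable_integral_line_point:
  assumes f: "f \<in> borel_measurable borel"
  shows "(\<lambda>y. \<integral>\<^sup>+t. f (line_point j y t) \<partial>lborel :: ennreal) \<in> borel_measurable (PiM (UNIV - {j}) (\<lambda>_. lborel))"
proof -
  have "(\<lambda>p. line_point j (fst p) (snd p)) \<in> PiM (UNIV - {j}) (\<lambda>_. lborel) \<Otimes>\<^sub>M lborel \<rightarrow>\<^sub>M borel"
  proof (intro borel_measurable_vecI)
    fix i
    have "(\<lambda>z. z i) \<in> PiM (UNIV - {j}) (\<lambda>_. lborel) \<rightarrow>\<^sub>M (borel :: real measure)" if "i \<noteq> j"
      using measurable_component_singleton[of i "UNIV - {j}" "\<lambda>_. lborel :: real measure"] that
      by (simp add: measurable_lborel1)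
    thus "(\<lambda>p. line_point j (fst p) (snd p) $ i) \<in> borel_measurable (PiM (UNIV - {j}) (\<lambda>_. lborel) \<Otimes>\<^sub>M lborel)"
      by (cases "i = j") (auto simp: line_point_def intro: measurable_compose[OF measurable_fst])
  qed
  from measurable_compose[OF this f]
  have "(\<lambda>(y, t). f (line_point j y t)) \<in> borel_measurable (PiM (UNIV - {j}) (\<lambda>_. lborel) \<Otimes>\<^sub>M lborel)"
    by (simp add: case_prod_beta)
  thus ?thesis by (rule lborel.borel_measurable_nn_integral)
qed

lemma measurable_line_point': "(\<lambda>t. line_point j y t) \<in> borel_measurable borel"
proof (intro borel_measurable_vecI)
  fix i show "(\<lambda>t. line_point j y t $ i) \<in> borel_measurable borel" by (cases "i = j") (auto simp: line_point_def)
qed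

lemma nn_integral_slices:
  fixes f :: "real ^ 'n \<Rightarrow> ennreal"
  assumes f: "f \<in> borel_measurable borel"
  shows "(\<integral>\<^sup>+x. f x \<partial>lborel) = (\<integral>\<^sup>+y. \<integral>\<^sup>+t. f (line_point j y t) \<partial>lborel \<partial>PiM (UNIV - {j}) (\<lambda>_. lborel))"
proof -
  interpret product_sigma_finite "\<lambda>_ :: 'n. lborel :: real measure" ..
  have "(\<integral>\<^sup>+x. f x \<partial>lborel) = (\<integral>\<^sup>+z. f (\<chi> i. z i) \<partial>PiM (insert j (UNIV - {j})) (\<lambda>_. lborel))"
    using f measurable_vec_lambda unfolding lborel_vec by (subst nn_integral_distr) (auto simp: insert_absorb)
  also have "\<dots> = (\<integral>\<^sup>+y. \<integral>\<^sup>+t. f (\<chi> i. (y(j := t)) i) \<partial>lborel \<partial>PiM (UNIV - {j}) (\<lambda>_. lborel))"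
    using measurable_compose[OF measurable_vec_lambda f]
    by (intro product_nn_integral_insert) (auto simp: insert_absorb)
  also have "\<dots> = (\<integral>\<^sup>+y. \<integral>\<^sup>+t. f (line_point j y t) \<partial>lborel \<partial>PiM (UNIV - {j}) (\<lambda>_. lborel))"
    by (simp add: line_point_def fun_upd_def)
  finally show ?thesis .
qed

definition dir_halo :: "'n \<Rightarrow> real \<Rightarrow> (real ^ 'n) set \<Rightarrow> (real ^ 'n) set" where
  "dir_halo j d E = {x. x $ j \<in> interval_halo d {t. set_coord x j t \<in> E}}"

lemma mem_interval_halo:
  "x \<in> interval_halo d E \<longleftrightarrow> (\<exists>a\<in>\<rat>. \<exists>b\<in>\<rat>. a < x \<and> x < b \<and> emeasure lborel ({a<..<b} - E) < ennreal (d * (b - a)))"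
proof
  assume "x \<in> interval_halo d E"
  then obtain I a b where "a \<in> \<rat>" "b \<in> \<rat>" "x \<in> I" "I = {a<..<b}" "emeasure lborel (I - E) < ennreal (d * (b - a))"
    unfolding interval_halo_def by blast
  thus "\<exists>a\<in>\<rat>. \<exists>b\<in>\<rat>. a < x \<and> x < b \<and> emeasure lborel ({a<..<b} - E) < ennreal (d * (b - a))" by auto
next
  assume "\<exists>a\<in>\<rat>. \<exists>b\<in>\<rat>. a < x \<and> x < b \<and> emeasure lborel ({a<..<b} - E) < ennreal (d * (b - a))"
  then obtain a b where ab: "a \<in> \<rat>" "b \<in> \<rat>" "a < x" "x < b" "emeasure lborel ({a<..<b} - E) < ennreal (d * (b - a))"
    by blast
  hence "a < b" "x \<in> {a<..<b}" by auto
  thus "x \<in> interval_halo d E" unfolding interval_halo_def using ab by blast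
qed

lemma emeasure_interval_diff_slice:
  fixes E :: "(real ^ 'n) set"
  assumes "E \<in> sets borel"
  shows "emeasure lborel ({a<..<b} - {t. set_coord x j t \<in> E}) =
    (\<integral>\<^sup>+t. indicator {a<..<b} t * indicator (- E) (set_coord x j t) \<partial>lborel)"
proof -
  have "{t. set_coord x j t \<in> E} \<in> sets borel"
    using measurable_sets_borel[OF measurable_set_coord' assms] by (simp add: vimage_def)
  hence "emeasure lborel ({a<..<b} - {t. set_coord x j t \<in> E}) =
      (\<integral>\<^sup>+t. indicator ({a<..<b} - {t. set_coord x j t \<in> E}) t \<partial>lborel)"
    by (subst nn_integral_indicator) auto
  also have "\<dots> = (\<integral>\<^sup>+t. indicator {a<..<b} t * indicator (- E) (set_coord x j t) \<partial>lborel)"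
    by (intro nn_integral_cong) (auto simp: indicator_def)
  finally show ?thesis .
qed

text \<open>A countable union over the rational end points of sets defined by a parameter integral.\<close>

lemma dir_halo_borel:
  assumes E: "E \<in> sets borel"
  shows "dir_halo j d E \<in> sets borel"
proof -
  define S where "S a b = {x. a < x $ j \<and> x $ j < b \<and>
    emeasure lborel ({a<..<b} - {t. set_coord x j t \<in> E}) < ennreal (d * (b - a))}" for a b
  have "dir_halo j d E = (\<Union>a\<in>\<rat>. \<Union>b\<in>\<rat>. S a b)"
    unfolding dir_halo_def S_def by (auto simp: mem_interval_halo)
  moreover have "S a b \<in> sets borel" for a b
  proof -
    have "(\<lambda>x. \<integral>\<^sup>+t. indicator {a<..<b} t * indicator (- E) (set_coord x j t) \<partial>lborel) \<in> borel_measurable borel"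
      using E by (intro measurable_integral_set_coord) auto
    hence "(\<lambda>x. emeasure lborel ({a<..<b} - {t. set_coord x j t \<in> E})) \<in> borel_measurable borel"
      by (simp add: emeasure_interval_diff_slice[OF E])
    thus ?thesis unfolding S_def by measurable
  qed
  ultimately show ?thesis
    using countable_rat by (auto intro!: sets.countable_UN')
qed

lemma emeasure_weighted_slices:
  fixes w :: "real ^ 'n \<Rightarrow> real"
  assumes w: "w \<in> borel_measurable borel" and G: "G \<in> sets borel"
  shows "emeasure (weighted w) G =
    (\<integral>\<^sup>+y. emeasure (weighted (slice w j y)) {t. line_point j y t \<in> G} \<partial>PiM (UNIV - {j}) (\<lambda>_. lborel))"
proof -
  have "emeasure (weighted w) G = (\<integral>\<^sup>+x. ennreal (w x) * indicator G x \<partial>lborel)"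
    using w G by (simp add: emeasure_density)
  also have "\<dots> = (\<integral>\<^sup>+y. \<integral>\<^sup>+t. ennreal (w (line_point j y t)) * indicator G (line_point j y t) \<partial>lborel \<partial>PiM (UNIV - {j}) (\<lambda>_. lborel))"
    using w G by (intro nn_integral_slices) auto
  also have "\<dots> = (\<integral>\<^sup>+y. emeasure (weighted (slice w j y)) {t. line_point j y t \<in> G} \<partial>PiM (UNIV - {j}) (\<lambda>_. lborel))"
  proof (intro nn_integral_cong)
    fix y
    have "{t. line_point j y t \<in> G} \<in> sets borel" using measurable_sets_borel[OF measurable_line_point' G] by (simp add: vimage_def)
    moreover have "(\<lambda>t. w (line_point j y t)) \<in> borel_measurable borel"
      by (rule measurable_compose[OF measurable_line_point' w])
    ultimately show "(\<integral>\<^sup>+t. ennreal (w (line_point j y t)) * indicator G (line_point j y t) \<partial>lborel) =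
      emeasure (weighted (slice w j y)) {t. line_point j y t \<in> G}"
      by (subst emeasure_density) (auto simp: slice_eq_line_point[abs_def] indicator_def intro!: nn_integral_cong)
  qed
  finally show ?thesis .
qed

text \<open>On every line in direction \<open>j\<close> the directional halo is the one-dimensional halo of the slice
  of \<open>E\<close>, so the one-dimensional estimate can be integrated over the lines.\<close>

lemma dir_halo_estimate:
  fixes w :: "real ^ 'n \<Rightarrow> real"
  assumes w: "w \<in> borel_measurable borel" "\<And>x. 0 \<le> w x"
    and Q: "AE y in PiM (UNIV - {j}) (\<lambda>_. lborel). fujii_wilson (slice w j y) \<le> ennreal Q"
    and fin: "AE y in PiM (UNIV - {j}) (\<lambda>_. lborel). \<forall>J. bounded J \<longrightarrow> emeasure (weighted (slice w j y)) J < \<infinity>"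
    and m: "8 * Q \<le> real m" "0 \<le> Q" "0 < m"
    and d: "0 < d" "d \<le> 1" "16 * d powr (1 / (real m + 2)) \<le> 1" and E: "E \<in> sets borel"
  shows "emeasure (weighted w) (dir_halo j d E) \<le> ennreal (1 + 16 * d powr (1 / (real m + 2))) * emeasure (weighted w) E"
proof -
  let ?c = "ennreal (1 + 16 * d powr (1 / (real m + 2)))"
  have b: "slice w j y \<in> borel_measurable borel" for y
    unfolding slice_eq_line_point[abs_def] by (rule measurable_compose[OF measurable_line_point' w(1)])
  have Eb: "{t. line_point j y t \<in> E} \<in> sets borel" for y
    using measurable_sets_borel[OF measurable_line_point' E] by (simp add: vimage_def)
  have "emeasure (weighted w) (dir_halo j d E) =
     (\<integral>\<^sup>+y. emeasure (weighted (slice w j y)) (interval_halo d {t. line_point j y t \<in> E}) \<partial>PiM (UNIV - {j}) (\<lambda>_. lborel))"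
    by (subst emeasure_weighted_slices[OF w(1) dir_halo_borel[OF E], where j = j]) (simp add: dir_halo_def)
  also have "\<dots> \<le> (\<integral>\<^sup>+y. ?c * emeasure (weighted (slice w j y)) {t. line_point j y t \<in> E} \<partial>PiM (UNIV - {j}) (\<lambda>_. lborel))"
  proof (intro nn_integral_mono_AE)
    from Q fin show "AE y in PiM (UNIV - {j}) (\<lambda>_. lborel). emeasure (weighted (slice w j y)) (interval_halo d {t. line_point j y t \<in> E})
        \<le> ?c * emeasure (weighted (slice w j y)) {t. line_point j y t \<in> E}"
    proof eventually_elim
      case (elim y)
      thus ?case using w(2) by (intro interval_halo_solyanik[OF b _ _ m _ d Eb]) (auto simp: slice_def)
    qed
  qed
  also have "\<dots> = ?c * emeasure (weighted w) E"
  proof -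
    have "(\<lambda>y. emeasure (weighted (slice w j y)) {t. line_point j y t \<in> E}) =
      (\<lambda>y. \<integral>\<^sup>+t. ennreal (w (line_point j y t)) * indicator E (line_point j y t) \<partial>lborel)"
    proof (intro ext)
      fix y
      show "emeasure (weighted (slice w j y)) {t. line_point j y t \<in> E} =
        (\<integral>\<^sup>+t. ennreal (w (line_point j y t)) * indicator E (line_point j y t) \<partial>lborel)"
        using b[of y] Eb[of y] unfolding slice_eq_line_point[abs_def]
        by (subst emeasure_density) (auto simp: indicator_def intro!: nn_integral_cong)
    qed
    also have "\<dots> \<in> borel_measurable (PiM (UNIV - {j}) (\<lambda>_. lborel))"
      using measurable_integral_line_point[of "\<lambda>x. ennreal (w x) * indicator E x"] w(1) E by simp
    finally show ?thesis
      by (subst emeasure_weighted_slices[OF w(1) E, where j = j]) (rule nn_integral_cmult)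
  qed
  finally show ?thesis .
qed


section \<open>Reduction of boxes to intervals\<close>

definition coord_integral :: "real ^ 'n \<Rightarrow> real ^ 'n \<Rightarrow> 'n \<Rightarrow> (real ^ 'n \<Rightarrow> ennreal) \<Rightarrow> real ^ 'n \<Rightarrow> ennreal" where
  "coord_integral a b j f x = (\<integral>\<^sup>+t. indicator {a $ j<..<b $ j} t * f (set_coord x j t) \<partial>lborel)"

fun coord_integrals :: "real ^ 'n \<Rightarrow> real ^ 'n \<Rightarrow> 'n list \<Rightarrow> (real ^ 'n \<Rightarrow> ennreal) \<Rightarrow> real ^ 'n \<Rightarrow> ennreal" where
  "coord_integrals a b [] f = f"
| "coord_integrals a b (j # js) f = coord_integrals a b js (coord_integral a b j f)"

text \<open>The admissible proportion is replaced by its square root in each step, as Chebyshev's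
  inequality requires.\<close>

fun iter_dir_halo :: "'n list \<Rightarrow> real \<Rightarrow> (real ^ 'n) set \<Rightarrow> (real ^ 'n) set" where
  "iter_dir_halo [] d E = E"
| "iter_dir_halo (j # js) d E = iter_dir_halo js (sqrt d) (dir_halo j (sqrt d) E)"

lemma measurable_coord_integral:
  assumes "f \<in> borel_measurable borel"
  shows "coord_integral a b j f \<in> borel_measurable borel"
  unfolding coord_integral_def[abs_def] by (rule measurable_integral_set_coord[OF assms]) simp

lemma coord_integrals_mono:
  assumes "\<And>z. P z \<Longrightarrow> f z \<le> g z" "\<And>z i t. P z \<Longrightarrow> i \<in> set js \<Longrightarrow> P (set_coord z i t)" "P x"
  shows "coord_integrals a b js f x \<le> coord_integrals a b js g x"
  using assms
proof (induction js arbitrary: f g)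
  case (Cons j js)
  have "coord_integral a b j f z \<le> coord_integral a b j g z" if "P z" for z
    unfolding coord_integral_def using Cons.prems that by (intro nn_integral_mono mult_left_mono) auto
  thus ?case using Cons.prems by (auto intro!: Cons.IH)
qed simp

lemma coord_integrals_cmult:
  assumes "f \<in> borel_measurable borel"
  shows "coord_integrals a b js (\<lambda>z. c * f z) x = c * coord_integrals a b js f x"
  using assms
proof (induction js arbitrary: f)
  case (Cons j js)
  have "(\<lambda>t. indicator {a $ j<..<b $ j} t * f (set_coord z j t)) \<in> borel_measurable borel" for z
    using measurable_compose[OF measurable_set_coord' Cons.prems] by simp
  hence "coord_integral a b j (\<lambda>z. c * f z) = (\<lambda>z. c * coord_integral a b j f z)"
    unfolding coord_integral_def by (intro ext, subst nn_integral_cmult[symmetric]) (auto simp: ac_simps)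
  thus ?case using Cons measurable_coord_integral[OF Cons.prems] by simp
qed simp

text \<open>Fubini's theorem, one coordinate at a time; the coordinates outside the list keep the values
  that they have in \<open>x\<close>.\<close>

lemma coord_integrals_eq_integral:
  fixes f :: "real ^ 'n \<Rightarrow> ennreal"
  assumes "f \<in> borel_measurable borel" "distinct js"
  shows "coord_integrals a b js f x = (\<integral>\<^sup>+z. (\<Prod>i\<in>set js. indicator {a $ i<..<b $ i} (z i)) * f (\<chi> i. if i \<in> set js then z i else x $ i)
      \<partial>PiM (set js) (\<lambda>_. lborel))"
  using assms
proof (induction js arbitrary: f)
  case Nil
  interpret product_sigma_finite "\<lambda>_ :: 'n. lborel :: real measure" ..
  show ?case by (simp add: PiM_empty nn_integral_count_space_finite)
next
  case (Cons j js)
  interpret product_sigma_finite "\<lambda>_ :: 'n. lborel :: real measure" ..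
  let ?S = "set js"
  let ?p = "\<lambda>S z. (\<Prod>i\<in>S. indicator {a $ i<..<b $ i} (z i)) :: ennreal"
  let ?o = "\<lambda>S z. (\<chi> i. if i \<in> S then z i else x $ i) :: real ^ 'n"
  have j: "j \<notin> ?S" and dis: "distinct js" using Cons.prems by auto
  have pm: "?p S \<in> borel_measurable (PiM S (\<lambda>_. lborel))" for S
  proof (intro borel_measurable_prod_ennreal)
    fix i assume "i \<in> S"
    from measurable_component_singleton[OF this, of "\<lambda>_. lborel :: real measure"]
    have "(\<lambda>z. z i) \<in> PiM S (\<lambda>_. lborel) \<rightarrow>\<^sub>M (borel :: real measure)" by (simp add: measurable_lborel1)
    thus "(\<lambda>z. indicator {a $ i<..<b $ i} (z i) :: ennreal) \<in> borel_measurable (PiM S (\<lambda>_. lborel))"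
      by (rule measurable_compose) simp
  qed
  have "coord_integrals a b (j # js) f x = (\<integral>\<^sup>+z. ?p ?S z * coord_integral a b j f (?o ?S z) \<partial>PiM ?S (\<lambda>_. lborel))"
    using Cons.IH[OF measurable_coord_integral[OF Cons.prems(1)] dis] by simp
  also have "\<dots> = (\<integral>\<^sup>+z. \<integral>\<^sup>+t. ?p (insert j ?S) (z(j := t)) * f (?o (insert j ?S) (z(j := t))) \<partial>lborel \<partial>PiM ?S (\<lambda>_. lborel))"
  proof (intro nn_integral_cong)
    fix z :: "'n \<Rightarrow> real"
    have "set_coord (?o ?S z) j t = ?o (insert j ?S) (z(j := t))" for t using j by (auto simp: vec_eq_iff)
    moreover have "?p (insert j ?S) (z(j := t)) = ?p ?S z * indicator {a $ j<..<b $ j} t" for t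
      using j by (simp add: mult.commute) (intro arg_cong2[where f = "(*)"] prod.cong; auto)
    moreover have "(\<lambda>t. indicator {a $ j<..<b $ j} t * f (set_coord (?o ?S z) j t)) \<in> borel_measurable borel"
      using measurable_compose[OF measurable_set_coord' Cons.prems(1)] by simp
    ultimately show "?p ?S z * coord_integral a b j f (?o ?S z) =
      (\<integral>\<^sup>+t. ?p (insert j ?S) (z(j := t)) * f (?o (insert j ?S) (z(j := t))) \<partial>lborel)"
      unfolding coord_integral_def by (subst nn_integral_cmult[symmetric]) (auto simp: mult.assoc)
  qed
  also have "\<dots> = (\<integral>\<^sup>+z. ?p (insert j ?S) z * f (?o (insert j ?S) z) \<partial>PiM (insert j ?S) (\<lambda>_. lborel))"
    using j by (intro product_nn_integral_insert[symmetric] borel_measurable_times_ennreal pm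
        measurable_compose[OF measurable_override Cons.prems(1)]) auto
  finally show ?case by simp
qed

lemma coord_integrals_UNIV:
  fixes G :: "(real ^ 'n) set"
  assumes "set js = UNIV" "distinct js" "G \<in> sets borel"
  shows "coord_integrals a b js (indicator G) x = emeasure lborel (box a b \<inter> G)"
proof -
  have "coord_integrals a b js (indicator G) x = (\<integral>\<^sup>+z. indicator (box a b \<inter> G) (\<chi> i. z i) \<partial>PiM UNIV (\<lambda>_. lborel))"
    using assms
    by (subst coord_integrals_eq_integral)
       (auto intro!: nn_integral_cong simp: indicator_def mem_box_cart prod_eq_1_iff prod_zero_iff)
  also have "\<dots> = (\<integral>\<^sup>+x. indicator (box a b \<inter> G) x \<partial>lborel)"
    using assms unfolding lborel_vec by (subst nn_integral_distr[OF measurable_vec_lambda]) auto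
  also have "\<dots> = emeasure lborel (box a b \<inter> G)" using assms by simp
  finally show ?thesis .
qed

text \<open>
  The integral of the indicator of the complement measures how much of a box is missing from \<open>E\<close>.
  If a point of the box is not in the halo in direction \<open>j\<close>, then its line misses at least the
  proportion \<open>sqrt d\<close>. By Chebyshev's inequality the points outside that halo take up less than the
  proportion \<open>d / sqrt d = sqrt d\<close> with respect to the remaining coordinates, and the argument
  continues with the halo in place of \<open>E\<close>. When no coordinate is left, less than everything is
  missing at the point \<open>x\<close> itself.
\<close>

lemma coord_integrals_small_imp_iter_dir_halo:
  fixes x :: "real ^ 'n"
  assumes "distinct js" "\<And>i. i \<in> set js \<Longrightarrow> a $ i < x $ i \<and> x $ i < b $ i \<and> a $ i \<in> \<rat> \<and> b $ i \<in> \<rat>"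
    "E \<in> sets borel" "0 < d" "d \<le> 1"
    "coord_integrals a b js (indicator (- E)) x < ennreal (d * (\<Prod>i\<in>set js. b $ i - a $ i))"
  shows "x \<in> iter_dir_halo js d E"
  using assms
proof (induction js arbitrary: d E)
  case Nil
  hence "indicator (- E) x < (1 :: ennreal)" by (auto elim!: order.strict_trans2 simp: ennreal_le_1)
  thus ?case by (cases "x \<in> E") auto
next
  case (Cons j js)
  let ?E' = "dir_halo j (sqrt d) E" let ?L = "b $ j - a $ j" let ?P = "\<Prod>i\<in>set js. b $ i - a $ i"
  let ?c = "ennreal (sqrt d * ?L)"
  have E': "?E' \<in> sets borel" using Cons.prems by (intro dir_halo_borel) auto
  have L: "?L > 0" using Cons.prems(2)[of j] by simp
  have P: "?P \<ge> 0" using Cons.prems(2) by (intro prod_nonneg) force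
  have sd: "sqrt d > 0" "sqrt d \<le> 1" "sqrt d * sqrt d = d" using Cons.prems by auto
  have j: "j \<notin> set js" using Cons.prems by simp
  (* Chebyshev's inequality, inside the integrals over the remaining coordinates. *)
  have "?c * coord_integrals a b js (indicator (- ?E')) x = coord_integrals a b js (\<lambda>z. ?c * indicator (- ?E') z) x"
    using E' by (subst coord_integrals_cmult) auto
  also have "\<dots> \<le> coord_integrals a b js (coord_integral a b j (indicator (- E))) x"
  proof (rule coord_integrals_mono[where P = "\<lambda>z. a $ j < z $ j \<and> z $ j < b $ j"])
    fix z :: "real ^ 'n" assume z: "a $ j < z $ j \<and> z $ j < b $ j"
    show "?c * indicator (- ?E') z \<le> coord_integral a b j (indicator (- E)) z"
    proof (cases "z \<in> ?E'")
      case False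
      have "a $ j \<in> \<rat>" "b $ j \<in> \<rat>" using Cons.prems(2)[of j] by auto
      hence "\<not> emeasure lborel ({a $ j<..<b $ j} - {t. set_coord z j t \<in> E}) < ennreal (sqrt d * ?L)"
        using False z unfolding dir_halo_def mem_Collect_eq mem_interval_halo by blast
      moreover have "emeasure lborel ({a $ j<..<b $ j} - {t. set_coord z j t \<in> E}) = coord_integral a b j (indicator (- E)) z"
        unfolding coord_integral_def by (rule emeasure_interval_diff_slice[OF Cons.prems(3)])
      ultimately show ?thesis using False by (simp add: not_less)
    qed simp
  qed (use j Cons.prems(2)[of j] in auto)
  also have "\<dots> < ennreal (d * (\<Prod>i\<in>set (j # js). b $ i - a $ i))" using Cons.prems(6) by simp
  also have "d * (\<Prod>i\<in>set (j # js). b $ i - a $ i) = (sqrt d * ?L) * (sqrt d * ?P)"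
  proof -
    have "(sqrt d * ?L) * (sqrt d * ?P) = (sqrt d * sqrt d) * (?L * ?P)" by (simp only: ac_simps)
    thus ?thesis using j by (simp only: sd(3)) simp
  qed
  also have "ennreal \<dots> = ?c * ennreal (sqrt d * ?P)" using sd L P by (intro ennreal_mult) auto
  finally have "coord_integrals a b js (indicator (- ?E')) x < ennreal (sqrt d * ?P)"
    using mult_left_mono[of "ennreal (sqrt d * ?P)" "coord_integrals a b js (indicator (- ?E')) x" ?c]
    by (meson leD not_le zero_le)
  hence "x \<in> iter_dir_halo js (sqrt d) ?E'" using Cons.prems sd E' by (intro Cons.IH) auto
  thus ?case by simp
qed

lemma iter_dir_halo_borel: "E \<in> sets borel \<Longrightarrow> iter_dir_halo js d E \<in> sets borel"
  by (induction js arbitrary: d E) (simp_all add: dir_halo_borel)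

text \<open>The proportions that occur are \<open>d powr (1 / 2 ^ i)\<close> for \<open>i\<close> up to the length of the list;
  the last one is the largest, and \<open>\<theta>\<close> bounds its power.\<close>

lemma iter_dir_halo_estimate:
  assumes step: "\<And>j d E. 0 < d \<Longrightarrow> d \<le> 1 \<Longrightarrow> 16 * d powr p \<le> 1 \<Longrightarrow> E \<in> sets borel \<Longrightarrow>
      emeasure M (dir_halo j d E) \<le> ennreal (1 + 16 * d powr p) * emeasure M E"
    and p: "0 < p" and "0 < d" "d \<le> 1" "d powr (p / 2 ^ length js) \<le> \<theta>" "16 * \<theta> \<le> 1" "E \<in> sets borel"
  shows "emeasure M (iter_dir_halo js d E) \<le> ennreal ((1 + 16 * \<theta>) ^ length js) * emeasure M E"
  using assms(3-)
proof (induction js arbitrary: d E)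
  case (Cons j js)
  have sd: "0 < sqrt d" "sqrt d \<le> 1" using Cons.prems by auto
  have half: "sqrt d powr q = d powr (q / 2)" for q
    using Cons.prems by (simp add: powr_half_sqrt[symmetric] powr_powr)
  have "(1::real) \<le> 2 ^ length js" by simp
  hence "p / 2 ^ length (j # js) \<le> p / 2" using p by (intro divide_left_mono) auto
  hence "sqrt d powr p \<le> d powr (p / 2 ^ length (j # js))"
    unfolding half using Cons.prems by (intro powr_mono') auto
  hence sp: "sqrt d powr p \<le> \<theta>" using Cons.prems by linarith
  have th: "0 \<le> \<theta>" using sp powr_ge_zero[of "sqrt d" p] by linarith
  have "emeasure M (iter_dir_halo js (sqrt d) (dir_halo j (sqrt d) E)) \<le>
      ennreal ((1 + 16 * \<theta>) ^ length js) * emeasure M (dir_halo j (sqrt d) E)"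
    using Cons.prems sd by (intro Cons.IH dir_halo_borel) (auto simp: half mult.commute)
  also have "\<dots> \<le> ennreal ((1 + 16 * \<theta>) ^ length js) * (ennreal (1 + 16 * sqrt d powr p) * emeasure M E)"
    using Cons.prems sd sp by (intro mult_left_mono step) auto
  also have "\<dots> \<le> ennreal ((1 + 16 * \<theta>) ^ length js) * (ennreal (1 + 16 * \<theta>) * emeasure M E)"
    using sp by (intro mult_left_mono mult_right_mono ennreal_leI) auto
  also have "\<dots> = ennreal ((1 + 16 * \<theta>) ^ length (j # js)) * emeasure M E"
  proof -
    have "ennreal ((1 + 16 * \<theta>) ^ length (j # js)) = ennreal ((1 + 16 * \<theta>) ^ length js * (1 + 16 * \<theta>))"
      by (simp add: mult.commute)
    also have "\<dots> = ennreal ((1 + 16 * \<theta>) ^ length js) * ennreal (1 + 16 * \<theta>)"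
      using th by (intro ennreal_mult) auto
    finally show ?thesis by (simp only: mult.assoc)
  qed
  finally show ?case by simp
qed simp

section \<open>Halos of the strong maximal operator\<close>

definition halo :: "real \<Rightarrow> 'a::euclidean_space set \<Rightarrow> 'a set" where
  "halo \<alpha> E = {x. ennreal \<alpha> < strong_maximal (indicator E) x}"

lemma emeasure_bounded_eq:
  fixes A :: "'a::euclidean_space set"
  assumes "bounded A"
  shows "emeasure lborel A = ennreal (measure lborel A)"
  using emeasure_bounded_finite[OF assms] by (intro emeasure_eq_ennreal_measure) auto

lemma emeasure_box_cart:
  fixes a b :: "real ^ 'n"
  assumes "\<And>i. a $ i \<le> b $ i"
  shows "emeasure lborel (box a b) = ennreal (\<Prod>i\<in>UNIV. b $ i - a $ i)"
proof -
  have "a \<bullet> e \<le> b \<bullet> e" if "e \<in> Basis" for e using that assms by (auto simp: Basis_vec_def inner_axis)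
  hence "emeasure lborel (box a b) = ennreal (\<Prod>e\<in>Basis. (b - a) \<bullet> e)" by (subst emeasure_lborel_box) auto
  also have "(\<Prod>e\<in>Basis. (b - a) \<bullet> e) = (\<Prod>i\<in>UNIV. b $ i - a $ i)" by (rule prod_Basis_cart)
  finally show ?thesis .
qed

lemma parallelepiped_sandwich:
  fixes R :: "(real ^ 'n) set"
  assumes R: "is_interval R" "bounded R" "R \<noteq> {}"
  obtains l u where "box l u \<subseteq> R" "R \<subseteq> cbox l u"
proof -
  define l u where "l = (\<chi> i. Inf ((\<lambda>x. x $ i) ` R))" and "u = (\<chi> i. Sup ((\<lambda>x. x $ i) ` R))"
  have bd: "bdd_above ((\<lambda>x. x $ i) ` R)" "bdd_below ((\<lambda>x. x $ i) ` R)" for i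
    using bounded_component_cart[OF R(2), of i] by (auto intro: bounded_imp_bdd_above bounded_imp_bdd_below)
  have "R \<subseteq> cbox l u"
    using bd by (auto simp: mem_box_cart l_def u_def intro!: cInf_lower cSup_upper)
  moreover have "x \<in> R" if x: "x \<in> box l u" for x
  proof (rule mem_box_componentwiseI[OF R(1)])
    fix b :: "real ^ 'n" assume "b \<in> Basis"
    then obtain i where b: "b = axis i 1" by (auto simp: Basis_vec_def)
    have xi: "l $ i < x $ i" "x $ i < u $ i" using x by (auto simp: mem_box_cart)
    obtain y where y: "y \<in> R" "y $ i < x $ i"
      using cInf_lessD[of "(\<lambda>x. x $ i) ` R" "x $ i"] xi(1) R(3) by (auto simp: l_def)
    obtain z where z: "z \<in> R" "x $ i < z $ i"
      using less_cSupD[of "(\<lambda>x. x $ i) ` R" "x $ i"] xi(2) R(3) by (auto simp: u_def)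
    have "is_interval ((\<lambda>x. x $ i) ` R)"
      unfolding is_interval_convex_1
      by (intro convex_linear_image is_interval_convex R(1)) (rule bounded_linear.linear[OF bounded_linear_vec_nth])
    hence "x $ i \<in> (\<lambda>x. x $ i) ` R" using y z by (force simp: is_interval_1)
    thus "x \<bullet> b \<in> (\<lambda>x. x \<bullet> b) ` R" by (simp add: b inner_axis)
  qed
  ultimately show thesis using that[of l u] by blast
qed

text \<open>The volume of a box depends continuously on its corners, so a strict inequality survives a
  small enlargement.\<close>

lemma rational_box_around:
  fixes R :: "(real ^ 'n) set"
  assumes R: "is_interval R" "bounded R" "R \<noteq> {}" and v: "ennreal \<alpha> * emeasure lebesgue R < v" and \<alpha>: "0 \<le> \<alpha>"
  obtains a b where "R \<subseteq> box a b" "\<And>i. a $ i \<in> \<rat> \<and> b $ i \<in> \<rat>"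
    "ennreal (\<alpha> * (\<Prod>i\<in>UNIV. b $ i - a $ i)) < v"
proof -
  obtain l u where lu: "box l u \<subseteq> R" "R \<subseteq> cbox l u" using parallelepiped_sandwich[OF R] .
  obtain q where "q \<in> R" using R by blast
  hence "q \<in> cbox l u" using lu(2) by blast
  hence le: "l $ i \<le> u $ i" for i by (auto simp: mem_box_cart intro: order_trans)
  let ?V = "\<lambda>s. \<alpha> * (\<Prod>i\<in>UNIV. (u $ i + s) - (l $ i - s))"
  have "ennreal (?V 0) \<le> ennreal \<alpha> * emeasure lebesgue R"
  proof -
    have "ennreal (?V 0) = ennreal \<alpha> * emeasure lebesgue (box l u)"
      using emeasure_box_cart[of l u] le \<alpha> by (simp add: ennreal_mult prod_nonneg)
    also have "\<dots> \<le> ennreal \<alpha> * emeasure lebesgue R"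
      using lu(1) measurable_convex[OF is_interval_convex[OF R(1)] R(2)]
      by (intro mult_left_mono emeasure_mono) auto
    finally show ?thesis .
  qed
  hence V0: "ennreal (?V 0) < v" using v by simp
  have "((\<lambda>s. ennreal (?V s)) \<longlongrightarrow> ennreal (?V 0)) (at_right 0)"
    by (intro tendsto_intros)
  hence "eventually (\<lambda>s. ennreal (?V s) < v) (at_right 0)" using V0 by (rule order_tendstoD)
  with eventually_at_right_less[of "0::real"]
  have "eventually (\<lambda>s. 0 < s \<and> ennreal (?V s) < v) (at_right 0)" by eventually_elim auto
  then obtain s where s: "0 < s" "ennreal (?V s) < v"
    using eventually_happens'[OF trivial_limit_at_right_real] by blast
  have "\<exists>r\<in>\<rat>. l $ i - s < r \<and> r < l $ i" for i using Rats_dense_in_real[of "l $ i - s" "l $ i"] s by auto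
  then obtain f where f: "\<And>i. f i \<in> \<rat>" "\<And>i. l $ i - s < f i" "\<And>i. f i < l $ i" by metis
  have "\<exists>r\<in>\<rat>. u $ i < r \<and> r < u $ i + s" for i using Rats_dense_in_real[of "u $ i" "u $ i + s"] s by auto
  then obtain g where g: "\<And>i. g i \<in> \<rat>" "\<And>i. u $ i < g i" "\<And>i. g i < u $ i + s" by metis
  show thesis
  proof (rule that[of "\<chi> i. f i" "\<chi> i. g i"])
    show "R \<subseteq> box (\<chi> i. f i) (\<chi> i. g i)"
    proof
      fix x assume "x \<in> R"
      hence "l $ i \<le> x $ i \<and> x $ i \<le> u $ i" for i using lu(2) by (auto simp: mem_box_cart)
      thus "x \<in> box (\<chi> i. f i) (\<chi> i. g i)" using f(3) g(2) by (auto simp: mem_box_cart) (meson order_less_le_trans order_le_less_trans)+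
    qed
    have "f i \<le> g i" for i using f(3)[of i] g(2)[of i] le[of i] by linarith
    moreover have "g i - f i \<le> (u $ i + s) - (l $ i - s)" for i using f(2)[of i] g(3)[of i] by linarith
    ultimately have "\<alpha> * (\<Prod>i\<in>UNIV. g i - f i) \<le> ?V s"
      using \<alpha> by (intro mult_left_mono prod_mono) auto
    hence "ennreal (\<alpha> * (\<Prod>i\<in>UNIV. g i - f i)) \<le> ennreal (?V s)" by (rule ennreal_leI)
    thus "ennreal (\<alpha> * (\<Prod>i\<in>UNIV. (\<chi> i. g i) $ i - (\<chi> i. f i) $ i)) < v" using s(2) by simp
  qed (use f g in auto)
qed

lemma average_indicator:
  fixes E :: "'a::euclidean_space set"
  assumes "E \<in> sets lebesgue" "R \<in> sets lebesgue"
  shows "(\<integral>\<^sup>+y\<in>R. ennreal \<bar>indicator E y\<bar> \<partial>lebesgue) = emeasure lebesgue (E \<inter> R)"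
proof -
  have "(\<integral>\<^sup>+y\<in>R. ennreal \<bar>indicator E y\<bar> \<partial>lebesgue) = (\<integral>\<^sup>+y. indicator (E \<inter> R) y \<partial>lebesgue)"
    by (intro nn_integral_cong) (auto simp: indicator_def)
  thus ?thesis using assms by simp
qed

lemma mem_haloI:
  fixes E :: "'a::euclidean_space set"
  assumes E: "E \<in> sets lebesgue" and R: "is_interval R" "bounded R" "0 < emeasure lebesgue R" "x \<in> R"
    and gt: "ennreal \<alpha> * emeasure lebesgue R < emeasure lebesgue (E \<inter> R)"
  shows "x \<in> halo \<alpha> E"
proof -
  have Rl: "R \<in> lmeasurable" using measurable_convex[OF is_interval_convex[OF R(1)] R(2)] .
  have "\<not> emeasure lebesgue (E \<inter> R) / emeasure lebesgue R \<le> ennreal \<alpha>"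
    using gt R(3) Rl by (subst ennreal_divide_le_iff) (auto simp: fmeasurable_def not_le)
  hence "ennreal \<alpha> < (\<integral>\<^sup>+y\<in>R. ennreal \<bar>indicator E y\<bar> \<partial>lebesgue) / emeasure lebesgue R"
    using Rl by (subst average_indicator[OF E]) (auto simp: not_le)
  also have "\<dots> \<le> strong_maximal (indicator E) x"
    unfolding strong_maximal_def using R by (intro SUP_upper) (auto simp: parallelepipeds_def)
  finally show ?thesis by (simp add: halo_def)
qed

lemma mem_halo_rational_box:
  fixes E :: "(real ^ 'n) set"
  assumes E: "E \<in> sets lebesgue" and \<alpha>: "0 \<le> \<alpha>" and x: "x \<in> halo \<alpha> E"
  shows "\<exists>a b. (\<forall>i. a $ i \<in> \<rat> \<and> b $ i \<in> \<rat>) \<and> (\<forall>i. a $ i < x $ i \<and> x $ i < b $ i) \<and>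
    emeasure lborel (box a b) = ennreal (\<Prod>i\<in>UNIV. b $ i - a $ i) \<and>
    ennreal (\<alpha> * (\<Prod>i\<in>UNIV. b $ i - a $ i)) < emeasure lebesgue (E \<inter> box a b)"
proof -
  obtain R where R: "R \<in> parallelepipeds" "x \<in> R"
    and gt: "ennreal \<alpha> < (\<integral>\<^sup>+y\<in>R. ennreal \<bar>indicator E y\<bar> \<partial>lebesgue) / emeasure lebesgue R"
    using x unfolding halo_def strong_maximal_def mem_Collect_eq less_SUP_iff by blast
  have Ri: "is_interval R" "bounded R" "0 < emeasure lebesgue R" using R by (auto simp: parallelepipeds_def)
  have Rl: "R \<in> lmeasurable" using measurable_convex[OF is_interval_convex[OF Ri(1)] Ri(2)] .
  have "\<not> emeasure lebesgue (E \<inter> R) / emeasure lebesgue R \<le> ennreal \<alpha>"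
    using gt Rl by (subst (asm) average_indicator[OF E]) (auto simp: not_le)
  hence gt': "ennreal \<alpha> * emeasure lebesgue R < emeasure lebesgue (E \<inter> R)"
    using Ri(3) Rl by (subst (asm) ennreal_divide_le_iff) (auto simp: fmeasurable_def not_le)
  obtain a b where ab: "R \<subseteq> box a b" "\<And>i. a $ i \<in> \<rat> \<and> b $ i \<in> \<rat>"
    "ennreal (\<alpha> * (\<Prod>i\<in>UNIV. b $ i - a $ i)) < emeasure lebesgue (E \<inter> R)"
    using rational_box_around[OF Ri(1,2) _ gt' \<alpha>] R by blast
  have xb: "a $ i < x $ i \<and> x $ i < b $ i" for i using ab(1) R(2) by (auto simp: mem_box_cart)
  have "emeasure lebesgue (E \<inter> R) \<le> emeasure lebesgue (E \<inter> box a b)"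
    using ab(1) E by (intro emeasure_mono) auto
  moreover have "emeasure lborel (box a b) = ennreal (\<Prod>i\<in>UNIV. b $ i - a $ i)"
    using xb by (intro emeasure_box_cart) (meson less_imp_le order.strict_trans)
  ultimately show ?thesis using ab xb by (intro exI[of _ a] exI[of _ b]) auto
qed

text \<open>Parallelepipeds may be enlarged to open boxes without losing the strict inequality.\<close>

lemma open_halo:
  fixes E :: "(real ^ 'n) set"
  assumes E: "E \<in> sets lebesgue" and \<alpha>: "0 \<le> \<alpha>"
  shows "open (halo \<alpha> E)"
proof (subst open_subopen, intro ballI)
  fix x assume "x \<in> halo \<alpha> E"
  then obtain a b where ab: "\<forall>i. a $ i \<in> \<rat> \<and> b $ i \<in> \<rat>" "\<forall>i. a $ i < x $ i \<and> x $ i < b $ i"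
    "emeasure lborel (box a b) = ennreal (\<Prod>i\<in>UNIV. b $ i - a $ i)"
    "ennreal (\<alpha> * (\<Prod>i\<in>UNIV. b $ i - a $ i)) < emeasure lebesgue (E \<inter> box a b)"
    using mem_halo_rational_box[OF E \<alpha>] by blast
  have "a $ i < b $ i" for i using ab(2) by (meson order.strict_trans)
  hence L: "0 < (\<Prod>i\<in>UNIV. b $ i - a $ i)" by (intro prod_pos) auto
  have "y \<in> halo \<alpha> E" if "y \<in> box a b" for y
    using that ab L \<alpha>
    by (intro mem_haloI[OF E, of "box a b"]) (auto simp: is_interval_box ennreal_mult less_imp_le)
  moreover have "x \<in> box a b" using ab(2) by (simp add: mem_box_cart)
  ultimately show "\<exists>T. open T \<and> x \<in> T \<and> T \<subseteq> halo \<alpha> E" by (intro exI[of _ "box a b"]) auto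
qed

text \<open>Stopping partition of \<open>R\<close> at height \<open>\<gamma>\<close> for Lebesgue measure restricted to \<open>E\<close>. The selected
  boxes have density \<open>\<gamma> > \<beta>\<close>, so they lie in the halo. The part \<open>B\<close> of \<open>E\<close> outside of them satisfies
  \<open>\<bar>B\<bar> \<le> \<gamma> * \<bar>B\<bar>\<close> and \<open>\<gamma> < 1\<close>, so it is a null set.\<close>

lemma halo_contains_stopping_set:
  fixes E :: "(real ^ 'n) set"
  assumes E: "E \<in> sets borel" and \<beta>: "0 \<le> \<beta>" "\<beta> < \<gamma>" "\<gamma> < 1"
    and R: "is_interval R" "bounded R" "R \<in> sets borel"
    and le: "emeasure lborel (E \<inter> R) \<le> ennreal \<gamma> * emeasure lborel R"
  shows "\<exists>S\<in>sets borel. S \<subseteq> R \<inter> halo \<beta> E \<and> emeasure lborel (E \<inter> R) \<le> ennreal \<gamma> * emeasure lborel S \<and>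
    emeasure lborel ((E \<inter> R) - S) = 0"
proof -
  let ?M = "density lborel (indicator E)"
  have M: "sets ?M = sets borel" "absolutely_continuous lborel ?M"
    using E by (auto intro!: absolutely_continuousI_density)
  have MA: "emeasure ?M A = emeasure lborel (E \<inter> A)" if "A \<in> sets borel" for A
    using that E by (subst emeasure_density) (auto simp: indicator_inter_arith[symmetric])
  have \<gamma>0: "0 \<le> \<gamma>" using \<beta> by simp
  have "cell ?M \<gamma> R" using R le by (simp add: cell_def MA)
  from stopping_partition[OF M \<gamma>0 this]
  obtain \<F> where F: "countable \<F>" "disjoint \<F>"
    "\<And>C. C \<in> \<F> \<Longrightarrow> is_interval C \<and> C \<subseteq> R \<and> C \<in> sets borel \<and> bounded C \<and> 0 < emeasure lborel C"
    "\<And>C. C \<in> \<F> \<Longrightarrow> emeasure ?M C = ennreal \<gamma> * emeasure lborel C"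
    "\<And>B. B \<in> sets borel \<Longrightarrow> B \<subseteq> R - \<Union>\<F> \<Longrightarrow> emeasure ?M B \<le> ennreal \<gamma> * emeasure lborel B" by blast
  define S where "S = \<Union>\<F>"
  have Sb: "S \<in> sets borel" unfolding S_def using F(1,3) by (intro sets.countable_Union) auto
  have SR: "S \<subseteq> R" unfolding S_def using F(3) by blast
  have "x \<in> halo \<beta> E" if "x \<in> S" for x
  proof -
    obtain C where C: "C \<in> \<F>" "x \<in> C" using \<open>x \<in> S\<close> unfolding S_def by blast
    note C' = F(3)[OF C(1)]
    have fin: "emeasure lborel C < \<infinity>" using C' by (intro emeasure_bounded_finite) auto
    have "ennreal \<beta> * emeasure lborel C < ennreal \<gamma> * emeasure lborel C"
      using C' fin \<beta> by (intro ennreal_mult_strict_right_mono) (auto simp: ennreal_less_iff)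
    also have "\<dots> = emeasure lborel (E \<inter> C)" using F(4)[OF C(1)] MA[of C] C' by simp
    finally show ?thesis using C C' E by (intro mem_haloI[of E C]) auto
  qed
  hence SH: "S \<subseteq> R \<inter> halo \<beta> E" using SR by blast
  let ?B = "(E \<inter> R) - S"
  have Bb: "?B \<in> sets borel" using E R Sb by auto
  have "emeasure ?M ?B \<le> ennreal \<gamma> * emeasure lborel ?B" using Bb by (intro F(5)) (auto simp: S_def)
  moreover have "E \<inter> ?B = ?B" by blast
  ultimately have B: "emeasure lborel ?B \<le> ennreal \<gamma> * emeasure lborel ?B" using MA[OF Bb] by simp
  have "bounded ?B" using R(2) by (rule bounded_subset) auto
  hence "emeasure lborel ?B = ennreal (measure lborel ?B)"
    by (rule emeasure_bounded_eq)
  moreover from this have "measure lborel ?B \<le> \<gamma> * measure lborel ?B"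
    using B \<beta> by (simp add: ennreal_mult[symmetric])
  hence "(1 - \<gamma>) * measure lborel ?B \<le> 0" by (simp add: algebra_simps)
  hence "measure lborel ?B \<le> 0" using \<beta> by (simp add: mult_le_0_iff)
  ultimately have B0: "emeasure lborel ?B = 0" by (simp add: ennreal_neg)
  have "emeasure lborel (E \<inter> R) \<le> emeasure lborel ((E \<inter> S) \<union> ?B)"
    using E Sb Bb by (intro emeasure_mono) auto
  also have "\<dots> \<le> emeasure lborel (E \<inter> S) + emeasure lborel ?B"
    using E Sb Bb by (intro emeasure_subadditive) auto
  also have "\<dots> = emeasure ?M S" using B0 MA[OF Sb] by simp
  also have "\<dots> = ennreal \<gamma> * emeasure lborel S"
    unfolding S_def using F by (intro emeasure_Union_eq_cmult) auto
  finally show ?thesis using Sb SH B0 by blast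
qed

text \<open>In every box, either the density of \<open>E\<close> exceeds \<open>\<beta>\<close> and the whole box is in the halo, or the
  stopping set covers \<open>E\<close> up to a null set.\<close>

lemma subset_halo_AE:
  fixes E :: "(real ^ 'n) set"
  assumes E: "E \<in> sets borel" and \<beta>: "0 \<le> \<beta>" "\<beta> < 1"
  shows "E - halo \<beta> E \<in> null_sets lborel"
proof -
  have H: "halo \<beta> E \<in> sets borel" using open_halo[of E \<beta>] E \<beta> by auto
  have null: "(E \<inter> R) - halo \<beta> E \<in> null_sets lborel"
    if R: "is_interval R" "bounded R" "R \<in> sets borel" "0 < emeasure lborel R" for R
  proof (cases "ennreal \<beta> * emeasure lborel R < emeasure lborel (E \<inter> R)")
    case True
    hence "x \<in> halo \<beta> E" if "x \<in> R" for x using that R E by (intro mem_haloI[of E R]) auto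
    hence "(E \<inter> R) - halo \<beta> E = {}" by blast
    thus ?thesis by (simp only: null_sets.empty_sets)
  next
    case False
    obtain \<gamma> where \<gamma>: "\<beta> < \<gamma>" "\<gamma> < 1" using dense[OF \<beta>(2)] by blast
    have "ennreal \<beta> * emeasure lborel R \<le> ennreal \<gamma> * emeasure lborel R"
      using \<gamma> by (intro mult_right_mono ennreal_leI) auto
    hence "emeasure lborel (E \<inter> R) \<le> ennreal \<gamma> * emeasure lborel R" using False by (simp add: not_less)
    from halo_contains_stopping_set[OF E \<beta>(1) \<gamma> R(1-3) this] obtain S
      where S: "S \<in> sets borel" "S \<subseteq> R \<inter> halo \<beta> E" "emeasure lborel ((E \<inter> R) - S) = 0" by blast
    have "(E \<inter> R) - S \<in> null_sets lborel" using S E R by auto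
    thus ?thesis by (rule null_sets_subset) (use S E R H in auto)
  qed
  define R :: "nat \<Rightarrow> (real ^ 'n) set" where "R k = box (\<chi> i. - real (Suc k)) (\<chi> i. real (Suc k))" for k
  have "(E \<inter> R k) - halo \<beta> E \<in> null_sets lborel" for k
  proof (rule null)
    show "0 < emeasure lborel (R k)"
      unfolding R_def by (subst emeasure_box_cart) (auto intro!: prod_pos)
  qed (auto simp: R_def is_interval_box)
  hence "(\<Union>k. (E \<inter> R k) - halo \<beta> E) \<in> null_sets lborel" by (intro null_sets_UN) auto
  moreover have "(\<Union>k. (E \<inter> R k) - halo \<beta> E) = E - halo \<beta> E"
  proof -
    have "x \<in> (\<Union>k. R k)" for x
    proof -
      obtain k where k: "norm x < real k" using reals_Archimedean2 by blast
      have "- real (Suc k) < x $ i \<and> x $ i < real (Suc k)" for i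
        using component_le_norm_cart[of x i] k by (simp add: abs_le_iff)
      hence "x \<in> R k" unfolding R_def by (simp add: mem_box_cart)
      thus ?thesis by blast
    qed
    thus ?thesis by blast
  qed
  ultimately show ?thesis by simp
qed

text \<open>
  Let \<open>E\<close> have density more than \<open>\<alpha>\<close> in a box \<open>R\<close>. If its density in \<open>R\<close> exceeds \<open>\<beta>\<close>, all of \<open>R\<close> is
  in the halo of level \<open>\<beta>\<close>. Otherwise disjoint boxes of density \<open>\<gamma>\<close>, slightly above \<open>\<beta>\<close>, contain
  almost all of \<open>E \<inter> R\<close>, and their volume is that of \<open>E \<inter> R\<close> divided by \<open>\<gamma>\<close>, which is more than
  \<open>\<alpha> / \<beta>\<close> times the volume of \<open>R\<close>.
\<close>

lemma halo_subset_halo_halo: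
  fixes E :: "(real ^ 'n) set"
  assumes E: "E \<in> sets borel" and "0 < \<alpha>" "\<alpha> < \<beta>" "\<beta> < 1"
  shows "halo \<alpha> E \<subseteq> halo (\<alpha> / \<beta>) (halo \<beta> E)"
proof
  have El: "E \<in> sets lebesgue" using E by simp
  fix x assume "x \<in> halo \<alpha> E"
  then obtain a b where ab: "\<forall>i. a $ i \<in> \<rat> \<and> b $ i \<in> \<rat>" "\<forall>i. a $ i < x $ i \<and> x $ i < b $ i"
    "emeasure lborel (box a b) = ennreal (\<Prod>i\<in>UNIV. b $ i - a $ i)"
    "ennreal (\<alpha> * (\<Prod>i\<in>UNIV. b $ i - a $ i)) < emeasure lebesgue (E \<inter> box a b)"
    using mem_halo_rational_box[OF El less_imp_le[OF assms(2)]] by blast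
  define L where "L = (\<Prod>i\<in>UNIV. b $ i - a $ i)"
  have "a $ i < b $ i" for i using ab(2) by (meson order.strict_trans)
  hence L: "0 < L" unfolding L_def by (intro prod_pos) auto
  let ?R = "box a b"
  have xR: "x \<in> ?R" using ab(2) by (simp add: mem_box_cart)
  have RL: "emeasure lborel ?R = ennreal L" using ab by (simp add: L_def)
  have H: "halo \<beta> E \<in> sets borel" using open_halo[of E \<beta>] E assms by auto
  define v where "v = measure lborel (E \<inter> ?R)"
  have "bounded (E \<inter> ?R)" by (rule bounded_subset[OF bounded_box]) auto
  hence v: "emeasure lborel (E \<inter> ?R) = ennreal v"
    unfolding v_def by (rule emeasure_bounded_eq)
  have "v \<ge> 0" by (simp add: v_def)
  have av: "\<alpha> * L < v" using ab(4) E v assms L \<open>v \<ge> 0\<close> by (auto simp: L_def[symmetric] ennreal_less_iff)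
  have "ennreal (\<alpha> / \<beta>) * emeasure lborel ?R < emeasure lborel (halo \<beta> E \<inter> ?R)"
  proof (cases "\<beta> * L < v")
    case True
    have "y \<in> halo \<beta> E" if "y \<in> ?R" for y
      using that E True L assms v RL
      by (intro mem_haloI[of E ?R]) (auto simp: is_interval_box ennreal_mult[symmetric] ennreal_less_iff)
    hence "halo \<beta> E \<inter> ?R = ?R" by blast
    moreover have "\<alpha> / \<beta> * L < L" using assms L by (simp add: field_simps)
    ultimately show ?thesis using assms L by (simp add: RL ennreal_mult[symmetric] ennreal_less_iff)
  next
    case False
    have "\<beta> < min 1 (v * \<beta> / (\<alpha> * L))" using av assms L by (simp add: field_simps)
    from dense[OF this] obtain \<gamma> where \<gamma>: "\<beta> < \<gamma>" "\<gamma> < 1" "\<gamma> < v * \<beta> / (\<alpha> * L)" by auto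
    have "\<beta> * L \<le> \<gamma> * L" using \<gamma> L by simp
    hence "v \<le> \<gamma> * L" using False by linarith
    hence "emeasure lborel (E \<inter> ?R) \<le> ennreal \<gamma> * emeasure lborel ?R"
      using L \<gamma> assms by (simp add: v RL ennreal_mult[symmetric])
    moreover have "0 \<le> \<beta>" "is_interval ?R" "bounded ?R" "?R \<in> sets borel"
      using assms by (auto simp: is_interval_box)
    ultimately obtain S
      where S: "S \<in> sets borel" "S \<subseteq> ?R \<inter> halo \<beta> E" "emeasure lborel (E \<inter> ?R) \<le> ennreal \<gamma> * emeasure lborel S"
      using halo_contains_stopping_set[OF E _ \<gamma>(1,2)] by blast
    have "bounded S" by (rule bounded_subset[OF bounded_box]) (use S in auto)
    hence eS: "emeasure lborel S = ennreal (measure lborel S)"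
      by (rule emeasure_bounded_eq)
    hence "v \<le> \<gamma> * measure lborel S" using S(3) \<gamma> assms by (simp add: v ennreal_mult[symmetric])
    moreover have "\<gamma> * (\<alpha> / \<beta> * L) < v" using \<gamma>(3) assms L by (simp add: field_simps)
    ultimately have "\<gamma> * (\<alpha> / \<beta> * L) < \<gamma> * measure lborel S" by linarith
    hence "\<alpha> / \<beta> * L < measure lborel S" using \<gamma> assms by (subst (asm) mult_less_cancel_left_pos) auto
    hence "ennreal (\<alpha> / \<beta>) * emeasure lborel ?R < emeasure lborel S"
      using assms L by (simp add: RL eS ennreal_mult[symmetric] ennreal_less_iff)
    also have "\<dots> \<le> emeasure lborel (halo \<beta> E \<inter> ?R)" using S H by (intro emeasure_mono) auto
    finally show ?thesis .
  qed
  thus "x \<in> halo (\<alpha> / \<beta>) (halo \<beta> E)" using H L RL xR by (intro mem_haloI[of _ ?R]) (auto simp: is_interval_box)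
qed

section \<open>Borel versions of weights and their slices\<close>

lemma weight_measure_cong:
  assumes "AE x in lebesgue. w x = w' x" "AE x in lebesgue. x \<in> A \<longleftrightarrow> x \<in> B"
  shows "weight_measure w A = weight_measure w' B"
  unfolding weight_measure_def
proof (rule nn_integral_cong_AE)
  from assms show "AE x in lebesgue. ennreal (w x) * indicator A x = ennreal (w' x) * indicator B x"
    by eventually_elim (auto simp: indicator_def)
qed

lemma strong_maximal_cong:
  assumes "AE x in lebesgue. f x = g x"
  shows "strong_maximal f x = strong_maximal g x"
proof -
  have "(\<integral>\<^sup>+y\<in>R. ennreal \<bar>f y\<bar> \<partial>lebesgue) = (\<integral>\<^sup>+y\<in>R. ennreal \<bar>g y\<bar> \<partial>lebesgue)" for R
    by (rule nn_integral_cong_AE) (use assms in eventually_elim, simp)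
  thus ?thesis by (simp add: strong_maximal_def)
qed

lemma fujii_wilson_cong:
  assumes "AE t in lebesgue. \<nu> t = \<nu>' t"
  shows "fujii_wilson \<nu> = fujii_wilson \<nu>'"
proof -
  have "weight_measure \<nu> I = weight_measure \<nu>' I" for I
    using assms by (rule weight_measure_cong) simp
  moreover have "strong_maximal (\<lambda>s. \<nu> s * indicator I s) t = strong_maximal (\<lambda>s. \<nu>' s * indicator I s) t" for I t
    by (rule strong_maximal_cong) (use assms in eventually_elim, simp)
  ultimately show ?thesis by (simp add: fujii_wilson_def)
qed

lemma weight_borel_version:
  fixes w :: "'a::euclidean_space \<Rightarrow> real"
  assumes "weight w"
  obtains w' where "w' \<in> borel_measurable borel" "\<And>x. 0 \<le> w' x" "AE x in lebesgue. w x = w' x"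
    "\<And>J. bounded J \<Longrightarrow> emeasure (weighted w') J < \<infinity>"
proof -
  have nn: "0 \<le> w x" for x using assms by (simp add: weight_def)
  have int: "integrable lebesgue (\<lambda>x. indicator (cball 0 (real k)) x *\<^sub>R w x)" for k :: nat
  proof -
    have "w absolutely_integrable_on cball 0 (real k)" using assms by (simp add: weight_def)
    thus ?thesis by (simp add: set_integrable_def)
  qed
  have lim: "(\<lambda>k. indicator (cball 0 (real k)) x *\<^sub>R w x) \<longlonglongrightarrow> w x" for x
  proof (rule tendsto_eventually)
    obtain K where "norm x \<le> real K" using real_arch_simple by blast
    hence "\<forall>k\<ge>K. indicator (cball 0 (real k)) x *\<^sub>R w x = w x" by (auto simp: indicator_def)
    thus "\<forall>\<^sub>F k in sequentially. indicator (cball 0 (real k)) x *\<^sub>R w x = w x"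
      by (auto simp: eventually_sequentially)
  qed
  have "w \<in> borel_measurable lebesgue"
    by (rule borel_measurable_LIMSEQ_real[OF lim]) (rule borel_measurable_integrable[OF int])
  then obtain g where g: "g \<in> borel_measurable lborel" "AE x in lborel. w x = g x"
    using completion_ex_borel_measurable_real by blast
  define w' where "w' x = max 0 (g x)" for x
  have w': "w' \<in> borel_measurable borel" using g(1) unfolding w'_def by simp
  have "AE x in lebesgue. w x = g x" using g(2) by (rule AE_completion)
  hence eq: "AE x in lebesgue. w x = w' x" by eventually_elim (metis nn w'_def max.absorb2)
  show thesis
  proof (rule that[OF w' _ eq])
    fix J :: "'a set" assume "bounded J"
    then obtain r where "\<And>x. x \<in> J \<Longrightarrow> norm x \<le> r" by (auto simp: bounded_iff)
    moreover obtain k where "r \<le> real k" using real_arch_simple by blast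
    ultimately have J: "J \<subseteq> cball 0 (real k)" by (force intro: order_trans)
    have "emeasure (weighted w') (cball 0 (real k)) = weight_measure w' (cball 0 (real k))"
      by (rule weight_measure_eq_weighted[symmetric]) (use w' in auto)
    also have "\<dots> = weight_measure w (cball 0 (real k))"
      by (rule weight_measure_cong[symmetric]) (use eq in auto)
    also have "\<dots> = (\<integral>\<^sup>+x. ennreal (norm (indicator (cball 0 (real k)) x *\<^sub>R w x)) \<partial>lebesgue)"
      unfolding weight_measure_def using nn by (intro nn_integral_cong) (auto simp: indicator_def)
    also have "\<dots> < \<infinity>" using int[of k] by (simp add: integrable_iff_bounded)
    finally have "emeasure (weighted w') (cball 0 (real k)) < \<infinity>" .
    moreover have "emeasure (weighted w') J \<le> emeasure (weighted w') (cball 0 (real k))"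
      using J by (intro emeasure_mono) auto
    ultimately show "emeasure (weighted w') J < \<infinity>" by (rule order.strict_trans1[rotated])
  qed (simp add: w'_def)
qed

lemma AE_slices:
  fixes P :: "real ^ 'n \<Rightarrow> bool"
  assumes "AE x in lborel. P x"
  shows "AE y in PiM (UNIV - {j}) (\<lambda>_. lborel). AE t in lborel. P (line_point j y t)"
proof -
  obtain N where N: "{x. \<not> P x} \<subseteq> N" "N \<in> sets borel" "emeasure lborel N = 0"
    using AE_E[OF assms] by auto
  have "(\<integral>\<^sup>+y. \<integral>\<^sup>+t. indicator N (line_point j y t) \<partial>lborel \<partial>PiM (UNIV - {j}) (\<lambda>_. lborel)) = (\<integral>\<^sup>+x. indicator N x \<partial>lborel)"
    using N by (subst nn_integral_slices[of _ j]) auto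
  also have "\<dots> = 0" using N by simp
  finally have "AE y in PiM (UNIV - {j}) (\<lambda>_. lborel). (\<integral>\<^sup>+t. indicator N (line_point j y t) \<partial>lborel :: ennreal) = 0"
    using N by (subst (asm) nn_integral_0_iff_AE) (auto intro!: measurable_integral_line_point)
  thus ?thesis
  proof eventually_elim
    case (elim y)
    have "(\<lambda>t. indicator N (line_point j y t) :: ennreal) \<in> borel_measurable lborel"
      using measurable_compose[OF measurable_line_point' borel_measurable_indicator[of N borel]] N by simp
    hence "AE t in lborel. indicator N (line_point j y t) = (0 :: ennreal)"
      using elim by (simp add: nn_integral_0_iff_AE)
    thus ?case by eventually_elim (use N in \<open>auto simp: indicator_def split: if_splits\<close>)
  qed
qed

text \<open>A bounded set on the line with parameter \<open>y\<close> lies in one of countably many boxes, and the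
  mass of almost every slice of each box is finite.\<close>

lemma slices_locally_finite:
  fixes w :: "real ^ 'n \<Rightarrow> real"
  assumes w: "w \<in> borel_measurable borel" and fin: "\<And>J. bounded J \<Longrightarrow> emeasure (weighted w) J < \<infinity>"
  shows "AE y in PiM (UNIV - {j}) (\<lambda>_. lborel). \<forall>J. bounded J \<longrightarrow> emeasure (weighted (slice w j y)) J < \<infinity>"
proof -
  define R :: "nat \<Rightarrow> (real ^ 'n) set" where "R k = box (\<chi> i. - real k) (\<chi> i. real k)" for k
  have "AE y in PiM (UNIV - {j}) (\<lambda>_. lborel). emeasure (weighted (slice w j y)) {t. line_point j y t \<in> R k} \<noteq> \<infinity>" for k
  proof (rule nn_integral_PInf_AE)
    have eq: "emeasure (weighted (slice w j y)) {t. line_point j y t \<in> R k} =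
      (\<integral>\<^sup>+t. ennreal (w (line_point j y t)) * indicator (R k) (line_point j y t) \<partial>lborel)" for y
    proof -
      have "{t. line_point j y t \<in> R k} \<in> sets borel"
        using measurable_sets_borel[OF measurable_line_point', of "R k"] by (simp add: vimage_def R_def)
      moreover have "(\<lambda>t. w (line_point j y t)) \<in> borel_measurable borel"
        by (rule measurable_compose[OF measurable_line_point' w])
      ultimately show ?thesis unfolding slice_eq_line_point[abs_def]
        by (subst emeasure_density) (auto simp: indicator_def intro!: nn_integral_cong)
    qed
    show "(\<lambda>y. emeasure (weighted (slice w j y)) {t. line_point j y t \<in> R k}) \<in> borel_measurable (PiM (UNIV - {j}) (\<lambda>_. lborel))"
      unfolding eq using w by (intro measurable_integral_line_point) (auto simp: R_def)
    have "bounded (R k)" unfolding R_def by simp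
    hence "emeasure (weighted w) (R k) < \<infinity>" by (rule fin)
    thus "(\<integral>\<^sup>+y. emeasure (weighted (slice w j y)) {t. line_point j y t \<in> R k} \<partial>PiM (UNIV - {j}) (\<lambda>_. lborel)) \<noteq> \<infinity>"
      by (subst emeasure_weighted_slices[OF w, symmetric]) (auto simp: R_def)
  qed
  hence "AE y in PiM (UNIV - {j}) (\<lambda>_. lborel). \<forall>k. emeasure (weighted (slice w j y)) {t. line_point j y t \<in> R k} \<noteq> \<infinity>"
    by (simp add: AE_all_countable)
  thus ?thesis
  proof eventually_elim
    case (elim y)
    show ?case
    proof (intro allI impI)
      fix J :: "real set" assume "bounded J"
      then obtain r where r: "\<And>t. t \<in> J \<Longrightarrow> \<bar>t\<bar> \<le> r" by (auto simp: bounded_iff)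
      obtain k where k: "max r (Max (range (\<lambda>i. \<bar>y i\<bar>))) < real k" using reals_Archimedean2 by blast
      have "\<bar>y i\<bar> \<le> Max (range (\<lambda>i. \<bar>y i\<bar>))" for i by (intro Max_ge) auto
      hence yi: "\<bar>y i\<bar> < real k" for i using k by (meson max_less_iff_conj order_le_less_trans)
      have "J \<subseteq> {t. line_point j y t \<in> R k}"
      proof
        fix t assume "t \<in> J"
        hence "\<bar>t\<bar> < real k" using r[of t] k by linarith
        hence "\<bar>line_point j y t $ i\<bar> < real k" for i using yi[of i] by (simp add: line_point_def)
        thus "t \<in> {t. line_point j y t \<in> R k}" by (auto simp: R_def mem_box_cart abs_less_iff minus_less_iff)
      qed
      moreover have "{t. line_point j y t \<in> R k} \<in> sets borel"
        using measurable_sets_borel[OF measurable_line_point', of "R k"] by (simp add: vimage_def R_def)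
      ultimately have "emeasure (weighted (slice w j y)) J \<le> emeasure (weighted (slice w j y)) {t. line_point j y t \<in> R k}"
        by (intro emeasure_mono) auto
      thus "emeasure (weighted (slice w j y)) J < \<infinity>" using elim by (metis infinity_ennreal_def less_top order_le_less_trans)
    qed
  qed
qed

text \<open>On an interval the maximal function is at least the average over that interval.\<close>

lemma one_le_fujii_wilson:
  fixes \<nu> :: "real \<Rightarrow> real"
  assumes \<nu>: "\<nu> \<in> borel_measurable borel" "\<And>x. 0 \<le> \<nu> x" and fin: "\<And>J. bounded J \<Longrightarrow> emeasure (weighted \<nu>) J < \<infinity>"
    and nz: "emeasure (weighted \<nu>) UNIV \<noteq> 0"
  shows "1 \<le> fujii_wilson \<nu>"
proof -
  let ?M = "weighted \<nu>"
  have "\<exists>k::nat. emeasure ?M {- real k..real k} \<noteq> 0"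
  proof (rule ccontr)
    assume "\<not> (\<exists>k::nat. emeasure ?M {- real k..real k} \<noteq> 0)"
    hence "(\<Union>k. {- real k..real k}) \<in> null_sets ?M" by (intro null_sets_UN) auto
    moreover have "(\<Union>k. {- real k..real k}) = UNIV"
    proof -
      have "x \<in> (\<Union>k. {- real k..real k})" for x :: real
        using real_arch_simple[of "\<bar>x\<bar>"] by (auto simp: abs_le_iff minus_le_iff)
      thus ?thesis by blast
    qed
    ultimately show False using nz by auto
  qed
  then obtain k :: nat where k: "emeasure ?M {- real k..real k} \<noteq> 0" by blast
  define I where "I = {- real k..real k}"
  have I: "is_interval I" "bounded I" "I \<in> sets borel" by (auto simp: I_def is_interval_cc)
  have MI: "0 < emeasure ?M I" "emeasure ?M I < \<infinity>" using k fin[OF I(2)] by (auto simp: I_def zero_less_iff_neq_zero)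
  have "emeasure lborel I \<noteq> 0"
    using lborel_pos_if_weighted_pos[OF \<nu>(1) I(3) MI(1)] by simp
  hence L: "0 < emeasure lborel I" "emeasure lborel I < \<infinity>"
    using emeasure_bounded_finite[OF I(2)] by (auto simp: zero_less_iff_neq_zero)
  have "emeasure ?M I = emeasure ?M I / emeasure lborel I * emeasure lborel I"
    using L by (metis ennreal_times_divide infinity_ennreal_def mult.commute mult_divide_eq_ennreal order_less_irrefl)
  also have "\<dots> = (\<integral>\<^sup>+t\<in>I. (emeasure ?M I / emeasure lborel I) \<partial>lebesgue)"
    using I by (simp add: nn_integral_cmult_indicator)
  also have "\<dots> \<le> (\<integral>\<^sup>+t\<in>I. strong_maximal (\<lambda>s. \<nu> s * indicator I s) t \<partial>lebesgue)"
    using strong_maximal_ge_average[OF \<nu> I(1-3) L(1) order_refl]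
    by (intro nn_integral_mono) (auto simp: indicator_def)
  also have "\<dots> \<le> fujii_wilson \<nu> * emeasure ?M I"
    by (rule fujii_wilson_integral_le[OF \<nu>(1) order_refl I MI])
  finally have "1 * emeasure ?M I \<le> fujii_wilson \<nu> * emeasure ?M I" by simp
  thus ?thesis using MI by (metis ennreal_mult_le_mult_iff infinity_ennreal_def less_numeral_extra(3) mult.commute order_less_irrefl)
qed

section \<open>The Solyanik estimate for the strong maximal operator\<close>

text \<open>The halo of level \<open>1 - d\<close> is contained in the iterated directional halo over all coordinates,
  whose mass grows by a controlled factor in each direction.\<close>

lemma halo_solyanik:
  fixes w :: "real ^ 'n \<Rightarrow> real"
  assumes w: "w \<in> borel_measurable borel" "\<And>x. 0 \<le> w x"
    and Q: "\<And>j. AE y in PiM (UNIV - {j}) (\<lambda>_. lborel). fujii_wilson (slice w j y) \<le> ennreal Q"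
    and fin: "\<And>J. bounded J \<Longrightarrow> emeasure (weighted w) J < \<infinity>"
    and m: "8 * Q \<le> real m" "0 \<le> Q" "0 < m"
    and d: "0 < d" "d \<le> 1" "16 * d powr (1 / (real m + 2) / 2 ^ CARD('n)) \<le> 1" and E: "E \<in> sets borel"
  shows "emeasure (weighted w) (halo (1 - d) E) \<le>
    ennreal ((1 + 16 * d powr (1 / (real m + 2) / 2 ^ CARD('n))) ^ CARD('n)) * emeasure (weighted w) E"
proof -
  obtain js :: "'n list" where js: "set js = UNIV" "distinct js" using finite_distinct_list[OF finite[of "UNIV :: 'n set"]] by blast
  have len: "length js = CARD('n)" using distinct_card[OF js(2)] js(1) by simp
  have "halo (1 - d) E \<subseteq> iter_dir_halo js d E"
  proof
    fix x assume "x \<in> halo (1 - d) E"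
    moreover have "E \<in> sets lebesgue" "0 \<le> 1 - d" using E d by auto
    ultimately obtain a b where ab: "\<forall>i. a $ i \<in> \<rat> \<and> b $ i \<in> \<rat>" "\<forall>i. a $ i < x $ i \<and> x $ i < b $ i"
      "emeasure lborel (box a b) = ennreal (\<Prod>i\<in>UNIV. b $ i - a $ i)"
      "ennreal ((1 - d) * (\<Prod>i\<in>UNIV. b $ i - a $ i)) < emeasure lebesgue (E \<inter> box a b)"
      using mem_halo_rational_box by blast
    define L where "L = (\<Prod>i\<in>UNIV. b $ i - a $ i)"
    have "a $ i < b $ i" for i using ab(2) by (meson order.strict_trans)
    hence L: "0 < L" unfolding L_def by (intro prod_pos) auto
    have bd: "bounded (box a b \<inter> - E)" "bounded (E \<inter> box a b)"
      by (auto intro: bounded_subset[OF bounded_box])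
    have "E \<inter> box a b \<in> sets lborel" "box a b \<inter> - E \<in> sets lborel" using E by auto
    hence "emeasure lborel ((E \<inter> box a b) \<union> (box a b \<inter> - E)) = emeasure lborel (E \<inter> box a b) + emeasure lborel (box a b \<inter> - E)"
      by (intro plus_emeasure[symmetric]) auto
    also have "(E \<inter> box a b) \<union> (box a b \<inter> - E) = box a b" by blast
    finally have "L = measure lborel (E \<inter> box a b) + measure lborel (box a b \<inter> - E)"
      unfolding ab(3) L_def[symmetric] bd[THEN emeasure_bounded_eq] using L
      by (simp add: ennreal_plus[symmetric] del: ennreal_plus)
    moreover have "(1 - d) * L < measure lborel (E \<inter> box a b)"
      using ab(4) E L d emeasure_bounded_eq[OF bd(2)] by (simp add: L_def[symmetric] ennreal_less_iff)
    ultimately have "measure lborel (box a b \<inter> - E) < d * L" by (simp add: algebra_simps)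
    hence "coord_integrals a b js (indicator (- E)) x < ennreal (d * (\<Prod>i\<in>set js. b $ i - a $ i))"
      using E js by (subst coord_integrals_UNIV) (auto simp: emeasure_bounded_eq[OF bd(1)] L_def[symmetric] ennreal_less_iff)
    thus "x \<in> iter_dir_halo js d E" using ab(1,2) by (intro coord_integrals_small_imp_iter_dir_halo[OF js(2) _ E d(1,2)]) auto
  qed
  hence "emeasure (weighted w) (halo (1 - d) E) \<le> emeasure (weighted w) (iter_dir_halo js d E)"
    using iter_dir_halo_borel[OF E] by (intro emeasure_mono) auto
  also have "\<dots> \<le> ennreal ((1 + 16 * d powr (1 / (real m + 2) / 2 ^ CARD('n))) ^ length js) * emeasure (weighted w) E"
  proof (rule iter_dir_halo_estimate[where p = "1 / (real m + 2)"])
    fix j d and E :: "(real ^ 'n) set"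
    assume "0 < d" "d \<le> 1" "16 * d powr (1 / (real m + 2)) \<le> 1" "E \<in> sets borel"
    thus "emeasure (weighted w) (dir_halo j d E) \<le> ennreal (1 + 16 * d powr (1 / (real m + 2))) * emeasure (weighted w) E"
      by (intro dir_halo_estimate[OF w Q slices_locally_finite[OF w(1) fin] m])
  qed (use d E len in auto)
  finally show ?thesis by (simp only: len)
qed

section \<open>From submultiplicativity to local Hoelder continuity\<close>

lemma power_one_plus_le:
  fixes u :: real
  assumes "0 \<le> u" "u \<le> 1"
  shows "(1 + u) ^ n \<le> 1 + (2 ^ n - 1) * u"
proof (induction n)
  case (Suc n)
  have "(1 + u) ^ Suc n \<le> (1 + u) * (1 + (2 ^ n - 1) * u)"
    using Suc assms by (simp add: mult_left_mono)
  also have "\<dots> = 1 + u + (2 ^ n - 1) * u + (2 ^ n - 1) * (u * u)" by (simp add: algebra_simps)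
  also have "(2 ^ n - 1) * (u * u) \<le> (2 ^ n - 1) * (1 * u)"
    using assms by (intro mult_left_mono mult_right_mono) auto
  finally show ?case by (simp add: algebra_simps)
qed simp

text \<open>Every \<open>\<alpha> < \<gamma>\<close> is reached from \<open>\<alpha> / \<gamma>\<close> at the cost of the factor \<open>C \<gamma>\<close>, and finitely many
  such steps lead into the interval where \<open>C\<close> is known to be finite.\<close>

lemma finite_of_submultiplicative:
  fixes C :: "real \<Rightarrow> ennreal"
  assumes sub: "\<And>\<alpha> \<beta>. 0 < \<alpha> \<Longrightarrow> \<alpha> < \<beta> \<Longrightarrow> \<beta> < 1 \<Longrightarrow> C \<beta> < \<infinity> \<Longrightarrow> C \<alpha> \<le> C (\<alpha> / \<beta>) * C \<beta>"
    and \<gamma>: "0 < \<gamma>" "\<gamma> < 1" and near: "\<And>\<alpha>. \<gamma> \<le> \<alpha> \<Longrightarrow> \<alpha> < 1 \<Longrightarrow> C \<alpha> < \<infinity>"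
    and \<alpha>: "0 < \<alpha>" "\<alpha> < 1"
  shows "C \<alpha> < \<infinity>"
proof -
  have "\<gamma> ^ Suc k \<le> \<alpha> \<Longrightarrow> \<alpha> < 1 \<Longrightarrow> 0 < \<alpha> \<Longrightarrow> C \<alpha> < \<infinity>" for k \<alpha>
  proof (induction k arbitrary: \<alpha>)
    case 0
    thus ?case using near by simp
  next
    case (Suc k)
    show ?case
    proof (cases "\<gamma> \<le> \<alpha>")
      case True thus ?thesis using near Suc.prems by simp
    next
      case False
      have b: "\<gamma> ^ Suc k \<le> \<alpha> / \<gamma>" "\<alpha> / \<gamma> < 1" "\<alpha> < \<alpha> / \<gamma>" "\<alpha> / (\<alpha> / \<gamma>) = \<gamma>" "0 < \<alpha> / \<gamma>"
        using Suc.prems \<gamma> False by (auto simp: field_simps)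
      have fin: "C (\<alpha> / \<gamma>) < \<infinity>" using Suc.IH[OF b(1,2,5)] .
      have "C \<alpha> \<le> C \<gamma> * C (\<alpha> / \<gamma>)" using sub[OF Suc.prems(3) b(3,2) fin] b(4) by simp
      also have "\<dots> < \<infinity>" using fin near[of \<gamma>] \<gamma> by (simp add: ennreal_mult_less_top)
      finally show ?thesis .
    qed
  qed
  moreover obtain k where "\<gamma> ^ k < \<alpha>" using real_arch_pow_inv[OF \<alpha>(1) \<gamma>(2)] by blast
  moreover have "\<gamma> ^ Suc k \<le> \<gamma> ^ k" using \<gamma> by (intro power_decreasing) auto
  ultimately show ?thesis using \<alpha> by (meson less_imp_le order_trans)
qed

text \<open>For \<open>x < y\<close> the increment \<open>C x - C y\<close> is at most \<open>C y * (C (x / y) - 1)\<close>, and \<open>x / y\<close> is close to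
  \<open>1\<close> when \<open>y - x\<close> is small. For larger \<open>y - x\<close> the boundedness of \<open>C\<close> away from \<open>0\<close> is enough.\<close>

lemma local_hoelder_of_submultiplicative:
  fixes C :: "real \<Rightarrow> ennreal"
  assumes anti: "\<And>\<alpha> \<beta>. 0 < \<alpha> \<Longrightarrow> \<alpha> \<le> \<beta> \<Longrightarrow> \<beta> < 1 \<Longrightarrow> C \<beta> \<le> C \<alpha>"
    and fin: "\<And>\<alpha>. 0 < \<alpha> \<Longrightarrow> \<alpha> < 1 \<Longrightarrow> C \<alpha> < \<infinity>"
    and sub: "\<And>\<alpha> \<beta>. 0 < \<alpha> \<Longrightarrow> \<alpha> < \<beta> \<Longrightarrow> \<beta> < 1 \<Longrightarrow> C \<alpha> \<le> C (\<alpha> / \<beta>) * C \<beta>"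
    and r: "0 < r" and K: "0 \<le> K" and \<delta>: "0 < \<delta>" "\<delta> < 1"
    and near: "\<And>d. 0 < d \<Longrightarrow> d \<le> \<delta> \<Longrightarrow> C (1 - d) \<le> ennreal (1 + K * d powr r)"
  shows "local_hoelder r {0<..<1} (\<lambda>\<alpha>. enn2real (C \<alpha>))"
  unfolding local_hoelder_def
proof (intro allI impI)
  fix X :: "real set" assume X: "X \<subseteq> {0<..<1}" "compact X"
  let ?f = "\<lambda>\<alpha>. enn2real (C \<alpha>)"
  show "\<exists>H. \<forall>x\<in>X. \<forall>y\<in>X. \<bar>?f x - ?f y\<bar> \<le> H * \<bar>x - y\<bar> powr r"
  proof (cases "X = {}")
    case False
    obtain a where a: "a \<in> X" "\<And>x. x \<in> X \<Longrightarrow> a \<le> x"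
      using compact_attains_inf[OF X(2) False] by blast
    have a01: "0 < a" "a < 1" using a(1) X(1) by auto
    define B where "B = ?f a"
    define H where "H = B * K / a powr r + B / (\<delta> * a) powr r"
    have B: "0 \<le> B" by (simp add: B_def)
    have mono: "?f y \<le> ?f x" if "0 < x" "x \<le> y" "y < 1" for x y
      using anti[OF that] fin[of x] that by (intro enn2real_mono) auto
    have key: "\<bar>?f x - ?f y\<bar> \<le> H * \<bar>x - y\<bar> powr r" if xy: "x \<in> X" "y \<in> X" "x < y" for x y
    proof -
      have x: "a \<le> x" "0 < x" "y < 1" using a X xy by auto
      have le: "?f y \<le> ?f x" "?f x \<le> B" "?f y \<le> B" "0 \<le> ?f y"
        using mono[of x y] mono[of a x] mono[of a y] x xy a01 by (auto simp: B_def)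
      define d where "d = 1 - x / y"
      have d: "0 < d" "d \<le> (y - x) / a"
      proof -
        show "0 < d" using x xy by (simp add: d_def)
        have "d = (y - x) / y" using x xy by (simp add: d_def field_simps)
        also have "\<dots> \<le> (y - x) / a" using x xy a01 by (intro divide_left_mono) auto
        finally show "d \<le> (y - x) / a" .
      qed
      have "?f x - ?f y \<le> H * (y - x) powr r"
      proof (cases "d \<le> \<delta>")
        case True
        have "C x \<le> C (1 - d) * C y" using sub[of x y] x xy by (simp add: d_def)
        also have "\<dots> \<le> ennreal (1 + K * d powr r) * ennreal (?f y)"
          using near[OF d(1) True] fin[of y] x xy by (intro mult_mono) auto
        also have "\<dots> = ennreal ((1 + K * d powr r) * ?f y)"
          using K by (intro ennreal_mult[symmetric]) auto
        finally have "?f x \<le> (1 + K * d powr r) * ?f y"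
          using K by (intro enn2real_leI) auto
        hence "?f x - ?f y \<le> K * d powr r * ?f y" by (simp add: algebra_simps)
        also have "\<dots> \<le> K * ((y - x) / a) powr r * B"
          using K d le r by (intro mult_mono powr_mono2) auto
        also have "\<dots> = B * K / a powr r * (y - x) powr r"
          using xy a01 by (simp add: powr_divide)
        also have "\<dots> \<le> H * (y - x) powr r"
          using B by (intro mult_right_mono) (auto simp: H_def)
        finally show ?thesis .
      next
        case False
        hence "\<delta> < (y - x) / a" using d by linarith
        hence "\<delta> * a \<le> y - x" using a01 by (simp add: field_simps)
        hence "(\<delta> * a) powr r \<le> (y - x) powr r" using r \<delta> a01 by (intro powr_mono2) auto
        moreover have "0 < (\<delta> * a) powr r" using \<delta> a01 by simp
        ultimately have "B * 1 \<le> B * ((y - x) powr r / (\<delta> * a) powr r)"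
          using B by (intro mult_left_mono) auto
        moreover have "?f x - ?f y \<le> B" using le by linarith
        moreover have "B / (\<delta> * a) powr r * (y - x) powr r \<le> H * (y - x) powr r"
          using B K by (intro mult_right_mono) (auto simp: H_def)
        ultimately show ?thesis by simp
      qed
      thus ?thesis using le xy by (simp add: abs_minus_commute)
    qed
    have "\<bar>?f x - ?f y\<bar> \<le> H * \<bar>x - y\<bar> powr r" if "x \<in> X" "y \<in> X" for x y
      using key[OF that] key[OF that(2,1)] by (cases x y rule: linorder_cases) (auto simp: abs_minus_commute)
    thus ?thesis by blast
  qed simp
qed

lemma AE_fujii_wilson_slice_less:
  fixes w :: "real ^ 'n \<Rightarrow> real"
  assumes "A_infinity_star_const w < c"
  shows "AE y in PiM (UNIV - {j}) (\<lambda>_. lborel). fujii_wilson (slice w j y) < c"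
proof -
  have "ess_sup (PiM (UNIV - {j}) (\<lambda>_. lborel)) (\<lambda>y. fujii_wilson (slice w j y)) \<le> A_infinity_star_const w"
    unfolding A_infinity_star_const_def by (rule SUP_upper) simp
  also note assms
  finally obtain b where "AE y in PiM (UNIV - {j}) (\<lambda>_. lborel). fujii_wilson (slice w j y) \<le> b" "b < c"
    unfolding ess_sup_def Inf_less_iff by blast
  thus ?thesis by (auto elim!: eventually_mono)
qed

theorem theorem4:
  shows "\<exists>c>0. \<forall>w :: real ^ 'n::finite \<Rightarrow> real. w \<in> A_infinity_star \<longrightarrow>
    (\<forall>\<alpha>\<in>{0<..<1}. sharp_tauberian w \<alpha> < \<infinity>) \<and>
    local_hoelder (inverse (c * enn2real (A_infinity_star_const w))) {0<..<1}
      (\<lambda>\<alpha>. enn2real (sharp_tauberian w \<alpha>))"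
proof (intro exI[of _ "19 * 2 ^ CARD('n) :: real"] conjI allI impI)
  fix w :: "real ^ 'n \<Rightarrow> real" assume w: "w \<in> A_infinity_star"
  define N where "N = CARD('n)"
  define Q where "Q = enn2real (A_infinity_star_const w)"
  have A: "A_infinity_star_const w = ennreal Q" and "weight w"
    using w by (auto simp: A_infinity_star_def Q_def)
  obtain v where v: "v \<in> borel_measurable borel" "\<And>x. 0 \<le> v x" and eq: "AE x in lebesgue. w x = v x"
    and fin: "\<And>J. bounded J \<Longrightarrow> emeasure (weighted v) J < \<infinity>"
    using weight_borel_version[OF \<open>weight w\<close>] by blast
  let ?M = "weighted v"
  have FW: "AE y in PiM (UNIV - {j}) (\<lambda>_. lborel). fujii_wilson (slice v j y) < c"
    if "A_infinity_star_const w < c" for j c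
  proof -
    have "AE x in lborel. w x = v x" using eq by (simp add: AE_completion_iff)
    from AE_slices[OF this, of j] AE_fujii_wilson_slice_less[OF that, of j]
    show ?thesis
    proof eventually_elim
      case (elim y)
      have "AE t in lebesgue. slice w j y t = slice v j y t"
        using elim(1) by (intro AE_completion) (simp add: slice_eq_line_point)
      thus ?case using elim(2) by (simp add: fujii_wilson_cong)
    qed
  qed
  have slices_fin: "AE y in PiM (UNIV - {j}) (\<lambda>_. lborel). \<forall>J. bounded J \<longrightarrow> emeasure (weighted (slice v j y)) J < \<infinity>" for j
    by (rule slices_locally_finite[OF v(1)]) (rule fin)
  (* Otherwise almost every slice in a given direction would vanish, hence also the weight. The
     bound is used to replace Q + 1 by a multiple of Q in the exponent. *)
  have Q1: "1 \<le> Q"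
  proof (rule ccontr)
    assume "\<not> 1 \<le> Q"
    hence "A_infinity_star_const w < 1" by (simp add: A)
    fix j :: 'n
    have "AE y in PiM (UNIV - {j}) (\<lambda>_. lborel). emeasure (weighted (slice v j y)) {t. line_point j y t \<in> UNIV} = 0"
      using FW[OF \<open>A_infinity_star_const w < 1\<close>, of j] slices_fin[of j]
    proof eventually_elim
      case (elim y)
      have "slice v j y \<in> borel_measurable borel"
        unfolding slice_eq_line_point[abs_def] by (rule measurable_compose[OF measurable_line_point' v(1)])
      with elim show ?case using one_le_fujii_wilson[of "slice v j y"] v(2) by (auto simp: slice_def not_le[symmetric])
    qed
    hence "(\<integral>\<^sup>+y. emeasure (weighted (slice v j y)) {t. line_point j y t \<in> UNIV} \<partial>PiM (UNIV - {j}) (\<lambda>_. lborel)) =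
       (\<integral>\<^sup>+y. 0 \<partial>PiM (UNIV - {j}) (\<lambda>_. lborel :: real measure))"
      by (rule nn_integral_cong_AE)
    hence "emeasure ?M UNIV = 0" by (subst emeasure_weighted_slices[OF v(1), where j = j]) auto
    hence "AE x in lborel. ennreal (v x) = 0" using v(1) by (simp add: emeasure_density nn_integral_0_iff_AE)
    hence "AE x in lebesgue. ennreal (v x) = 0" by (rule AE_completion)
    with eq have "AE x in lebesgue. w x = 0" by eventually_elim (use v(2) in \<open>simp add: antisym\<close>)
    thus False using \<open>weight w\<close> by (simp add: weight_def)
  qed
  (* The essential supremum only bounds the slices by numbers larger than Q; Q + 1 is one. *)
  define m where "m = nat \<lceil>8 * (Q + 1)\<rceil>"
  have m: "8 * (Q + 1) \<le> real m" "0 \<le> Q + 1" "0 < m" "real m \<le> 8 * (Q + 1) + 1"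
  proof -
    have "0 \<le> \<lceil>8 * (Q + 1)\<rceil>" using Q1 by simp
    hence "real m = of_int \<lceil>8 * (Q + 1)\<rceil>" by (simp add: m_def)
    moreover have "8 * (Q + 1) \<le> of_int \<lceil>8 * (Q + 1)\<rceil>" "of_int \<lceil>8 * (Q + 1)\<rceil> \<le> 8 * (Q + 1) + 1"
      by linarith+
    ultimately show "8 * (Q + 1) \<le> real m" "real m \<le> 8 * (Q + 1) + 1" by simp_all
    hence "0 < real m" using Q1 by argo
    thus "0 < m" by simp
    show "0 \<le> Q + 1" using Q1 by linarith
  qed
  have FQ: "AE y in PiM (UNIV - {j}) (\<lambda>_. lborel). fujii_wilson (slice v j y) \<le> ennreal (Q + 1)" for j
  proof -
    have "A_infinity_star_const w < ennreal (Q + 1)" using Q1 by (simp add: A ennreal_less_iff)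
    from FW[OF this, of j] show ?thesis by eventually_elim simp
  qed
  define q where "q = 1 / (real m + 2) / 2 ^ N"
  define r where "r = inverse (19 * 2 ^ N * Q)"
  have r: "0 < r" using Q1 by (simp add: r_def)
  have rq: "r \<le> q"
  proof -
    (* m + 2 <= 8 (Q + 1) + 3 = 8 Q + 11 and 1 <= Q, which is where the constant 19 comes from. *)
    have "real m + 2 \<le> 19 * Q" using m(4) Q1 by argo
    hence "(real m + 2) * 2 ^ N \<le> 19 * Q * 2 ^ N" by (intro mult_right_mono) auto
    hence "(real m + 2) * 2 ^ N \<le> 19 * 2 ^ N * Q" by (simp only: ac_simps)
    hence "inverse (19 * 2 ^ N * Q) \<le> inverse ((real m + 2) * 2 ^ N)"
      by (intro le_imp_inverse_le) (auto intro: add_nonneg_pos)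
    thus ?thesis by (simp add: r_def q_def field_simps)
  qed
  define \<delta> where "\<delta> = (1 / 16 :: real) powr (1 / r)"
  have \<delta>: "0 < \<delta>" "\<delta> < 1" "\<delta> powr r = 1 / 16"
    using r by (auto simp: \<delta>_def powr_powr powr01_less_one)
  define K :: real where "K = (2 ^ N - 1) * 16"
  have K: "0 \<le> K" by (simp add: K_def)
  have near: "emeasure ?M (halo (1 - d) E) \<le> ennreal (1 + K * d powr r) * emeasure ?M E"
    if d: "0 < d" "d \<le> \<delta>" and E: "E \<in> sets borel" for d E
  proof -
    have "d \<le> 1" using d \<delta> by simp
    have dq: "d powr q \<le> d powr r" using d \<open>d \<le> 1\<close> rq by (intro powr_mono') auto
    have "d powr r \<le> \<delta> powr r" using d r by (intro powr_mono2) auto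
    hence small: "16 * d powr q \<le> 1" using dq \<delta>(3) by simp
    have "emeasure ?M (halo (1 - d) E) \<le> ennreal ((1 + 16 * d powr q) ^ N) * emeasure ?M E"
      using halo_solyanik[OF v FQ fin m(1-3) d(1) \<open>d \<le> 1\<close> _ E] small unfolding q_def N_def by simp
    also have "\<dots> \<le> ennreal (1 + K * d powr r) * emeasure ?M E"
    proof (intro mult_right_mono ennreal_leI)
      have "(1 + 16 * d powr q) ^ N \<le> 1 + (2 ^ N - 1) * (16 * d powr q)"
        using small by (intro power_one_plus_le) auto
      also have "\<dots> = 1 + K * d powr q" by (simp add: K_def)
      also have "\<dots> \<le> 1 + K * d powr r" using dq K by (intro add_left_mono mult_left_mono)
      finally show "(1 + 16 * d powr q) ^ N \<le> 1 + K * d powr r" .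
    qed simp
    finally show ?thesis .
  qed
  have WM: "weight_measure w B = emeasure ?M B" if "B \<in> sets borel" for B
    using weight_measure_cong[OF eq, of B B] weight_measure_eq_weighted[OF v(1) that] by simp
  have tauberian: "sharp_tauberian w \<alpha> = (SUP E\<in>{E \<in> sets lebesgue. 0 < weight_measure w E \<and> weight_measure w E < \<infinity>}.
      weight_measure w (halo \<alpha> E) / weight_measure w E)" for \<alpha>
    by (simp add: sharp_tauberian_def halo_def)
  have upper: "sharp_tauberian w \<alpha> \<le> c"
    if \<alpha>: "0 \<le> \<alpha>"
      and c: "\<And>E. E \<in> sets borel \<Longrightarrow> 0 < emeasure ?M E \<Longrightarrow> emeasure ?M E < \<infinity> \<Longrightarrow>
        emeasure ?M (halo \<alpha> E) \<le> c * emeasure ?M E" for \<alpha> c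
    unfolding tauberian
  proof (rule SUP_least)
    fix E assume E: "E \<in> {E \<in> sets lebesgue. 0 < weight_measure w E \<and> weight_measure w E < \<infinity>}"
    hence El: "E \<in> sets lebesgue" by simp
    obtain S Z Z' where S: "E = S \<union> Z" "Z \<subseteq> Z'" "Z' \<in> null_sets lborel" "S \<in> sets lborel"
      using sets_completionE[OF El] by metis
    have AE: "AE x in lebesgue. x \<in> E \<longleftrightarrow> x \<in> S"
    proof (rule AE_completion)
      show "AE x in lborel. x \<in> E \<longleftrightarrow> x \<in> S" using AE_not_in[OF S(3)] by eventually_elim (use S in auto)
    qed
    have "AE x in lebesgue. indicator E x = (indicator S x :: real)"
      using AE by eventually_elim (simp add: indicator_def)
    hence H: "halo \<alpha> E = halo \<alpha> S" unfolding halo_def by (simp add: strong_maximal_cong)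
    have ES: "weight_measure w E = emeasure ?M S"
      using weight_measure_cong[OF _ AE, of w w] WM[of S] S(4) by simp
    have "halo \<alpha> S \<in> sets borel" using open_halo[of S \<alpha>] S(4) \<alpha> by auto
    hence "weight_measure w (halo \<alpha> E) \<le> c * weight_measure w E"
      using c[of S] S(4) E by (simp add: ES H WM)
    thus "weight_measure w (halo \<alpha> E) / weight_measure w E \<le> c" using E by (simp add: ennreal_divide_le_iff)
  qed
  have lower: "emeasure ?M (halo \<alpha> E) \<le> sharp_tauberian w \<alpha> * emeasure ?M E"
    if "0 \<le> \<alpha>" and E: "E \<in> sets borel" "0 < emeasure ?M E" "emeasure ?M E < \<infinity>" for \<alpha> E
  proof -
    have "halo \<alpha> E \<in> sets borel" using open_halo[of E \<alpha>] that by auto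
    have "weight_measure w (halo \<alpha> E) / weight_measure w E \<le> sharp_tauberian w \<alpha>"
      unfolding tauberian using E by (intro SUP_upper) (simp add: WM)
    thus ?thesis using E \<open>halo \<alpha> E \<in> sets borel\<close> by (simp add: WM ennreal_divide_le_iff)
  qed
  let ?C = "sharp_tauberian w"
  have near': "?C (1 - d) \<le> ennreal (1 + K * d powr r)" if "0 < d" "d \<le> \<delta>" for d
    using that \<delta> by (intro upper near) auto
  have anti: "?C \<beta> \<le> ?C \<alpha>" if "0 < \<alpha>" "\<alpha> \<le> \<beta>" "\<beta> < 1" for \<alpha> \<beta>
  proof (rule upper)
    fix E :: "(real ^ 'n) set" assume E: "E \<in> sets borel" "0 < emeasure ?M E" "emeasure ?M E < \<infinity>"
    have "halo \<beta> E \<subseteq> halo \<alpha> E" unfolding halo_def using that by (auto intro: ennreal_leI order.strict_trans1)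
    moreover have "halo \<alpha> E \<in> sets borel" using open_halo[of E \<alpha>] that E by auto
    ultimately have "emeasure ?M (halo \<beta> E) \<le> emeasure ?M (halo \<alpha> E)" by (intro emeasure_mono) auto
    also have "\<dots> \<le> ?C \<alpha> * emeasure ?M E" using that E by (intro lower) auto
    finally show "emeasure ?M (halo \<beta> E) \<le> ?C \<alpha> * emeasure ?M E" .
  qed (use that in simp)
  (* The halo of level \<beta> competes in the supremum at level \<alpha> / \<beta>; for this its mass must be
     finite and positive. *)
  have sub: "?C \<alpha> \<le> ?C (\<alpha> / \<beta>) * ?C \<beta>" if ab: "0 < \<alpha>" "\<alpha> < \<beta>" "\<beta> < 1" and "?C \<beta> < \<infinity>" for \<alpha> \<beta>
  proof (rule upper)
    fix E :: "(real ^ 'n) set" assume E: "E \<in> sets borel" "0 < emeasure ?M E" "emeasure ?M E < \<infinity>"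
    let ?F = "halo \<beta> E"
    have F: "?F \<in> sets borel" using open_halo[of E \<beta>] ab E by auto
    have F': "halo (\<alpha> / \<beta>) ?F \<in> sets borel" using open_halo[of ?F "\<alpha> / \<beta>"] ab F by auto
    have FE: "emeasure ?M ?F \<le> ?C \<beta> * emeasure ?M E" using ab E by (intro lower) auto
    have Ffin: "emeasure ?M ?F < \<infinity>"
      using FE E(3) \<open>?C \<beta> < \<infinity>\<close> by (auto intro: order.strict_trans1 simp: ennreal_mult_less_top)
    have "E - ?F \<in> null_sets ?M"
      using subset_halo_AE[OF E(1), of \<beta>] absolutely_continuous_weighted[OF v(1)] ab
      unfolding absolutely_continuous_def by auto
    hence "emeasure ?M E \<le> emeasure ?M ?F"
      using E F emeasure_mono[of E "?F \<union> (E - ?F)" ?M] emeasure_Un_null_set[of ?F ?M "E - ?F"] by auto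
    hence Fpos: "0 < emeasure ?M ?F" using E(2) by (rule order.strict_trans2[rotated])
    have "emeasure ?M (halo \<alpha> E) \<le> emeasure ?M (halo (\<alpha> / \<beta>) ?F)"
      using F' halo_subset_halo_halo[OF E(1) ab] by (intro emeasure_mono) auto
    also have "\<dots> \<le> ?C (\<alpha> / \<beta>) * emeasure ?M ?F" using ab by (intro lower F Fpos Ffin) auto
    also have "\<dots> \<le> ?C (\<alpha> / \<beta>) * (?C \<beta> * emeasure ?M E)" by (intro mult_left_mono FE) simp
    finally show "emeasure ?M (halo \<alpha> E) \<le> ?C (\<alpha> / \<beta>) * ?C \<beta> * emeasure ?M E" by (simp add: mult.assoc)
  qed (use ab in simp)
  have finite: "?C \<alpha> < \<infinity>" if \<alpha>: "0 < \<alpha>" "\<alpha> < 1" for \<alpha>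
  proof (rule finite_of_submultiplicative[OF sub _ _ _ \<alpha>])
    show "0 < 1 - \<delta>" "1 - \<delta> < 1" using \<delta> by auto
    fix \<beta> assume "1 - \<delta> \<le> \<beta>" "\<beta> < 1"
    hence "?C \<beta> \<le> ennreal (1 + K * (1 - \<beta>) powr r)" using near'[of "1 - \<beta>"] by simp
    thus "?C \<beta> < \<infinity>" by (auto intro: order.strict_trans1)
  qed
  thus "\<forall>\<alpha>\<in>{0<..<1}. sharp_tauberian w \<alpha> < \<infinity>" by simp
  have "local_hoelder r {0<..<1} (\<lambda>\<alpha>. enn2real (?C \<alpha>))"
    using finite sub by (intro local_hoelder_of_submultiplicative[OF anti _ _ r K \<delta>(1,2) near']) auto
  thus "local_hoelder (inverse (19 * 2 ^ CARD('n) * enn2real (A_infinity_star_const w))) {0<..<1}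
      (\<lambda>\<alpha>. enn2real (sharp_tauberian w \<alpha>))"
    by (simp add: r_def N_def Q_def)
qed simp

end
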